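(* Let $d\ge3$, $\sigma,M>0$, and let $F$ be decreasing of exponential decay at infinity. For every centered chain $\boldsymbol b_0\in\mathcal E^{\mathrm{SRI}}_{2\times d}(\Psi_\sigma,M,F)$ that is $\delta$-repulsive for some $\delta>0$ there is $\epsilon>0$ such that the following holds. Let $\boldsymbol b_N\in\mathcal E^{\mathrm{SRI}}_{2\times d}(\Psi_\sigma,M,F)$ be diagonally translation invariant chains converging to an SRI chain $\boldsymbol b$ which is $\delta'$-repulsive for some $\delta'>0$, satisfies $d_{\mathrm{SRI}}(\boldsymbol b,\boldsymbol b_0)<\epsilon$, whose base measure has covariance matrix $\mathrm{Id}_{d\times d}$, and whose difference kernel $\boldsymbol b_{\mathrm{dif}}$ satisfies (F). Let $s_N=\int_Iu\,\nu_N(du)$ with $\nu_N$ the base measure of $\boldsymbol b_N$. Let $\mathbf x_N=(x_N^1,x_N^2)\in I^2$ satisfy $N^{-1/2}x_N^1\to x_1\in\mathbb R^d$ and $x_N^1-x_N^2\to y\in I$. Let $m\in\mathbb N$, let $\phi_1,\dots,\phi_m:\mathbb R^d\to\mathbb R$ be smooth and bounded with bounded first and second partial derivatives, and let $f^1,\dots,f^m:I\to\mathbb R$ be continuous of exponential decay at infinity. Then for every $t>0$ $$\lim_{N\to\infty}\mathbf E^{\boldsymbol b_N}_{\mathbf x_N}\Big[\sum_{0\le r_1<\dots<r_m\le Nt}\ \prod_{\ell=1}^mf^\ell(R^1_{r_\ell}-R^2_{r_\ell})\,\phi_\ell\big(N^{-1/2}(R^1_{r_\ell}-s_Nr_\ell)\big)\Big]$$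 $$=\phi_1(x_1)\cdots\phi_m(x_1)\sum_{0\le r_1<\dots<r_m<\infty}\mathbf E_y^{\boldsymbol b_{\mathrm{dif}}}\big[f^1(X_{r_1})\cdots f^m(X_{r_m})\big],$$ where $(X_r)$ is the Markov chain on $I$ with kernel $\boldsymbol b_{\mathrm{dif}}$ started at $y$. The claim remains true if $(f^1,\dots,f^m)$ on the left is replaced by $(f_N^1,\dots,f_N^m)$ equicontinuous and converging uniformly on compact sets to $(f^1,\dots,f^m)$, provided $\sup_N|f^j_N|$ decays exponentially at infinity for each $j$.
   Context: $I\subset\mathbb R^d$ is a locally compact additive subgroup. "Exponential decay" means bounded in absolute value by $Ae^{-b|x|}$, $A,b>0$. SRI chains ($k=2$). For a probability measure $\nu$ on $I$, a $2\times d$ SRI chain with base measure $\nu$ and decay function $F$ is a Markov kernel $\boldsymbol b(\mathbf x,d\mathbf y)$ on $I^2$ such that for all $\mathbf x=(x_1,x_2)$, $\|\boldsymbol b(\mathbf x,\cdot)-\nu^{\otimes2}_{\mathbf x}\|_{TV}\le F(|x_1-x_2|)$, where $\nu_{\mathbf x}^{\otimes2}$ is the law of $\mathbf x+\mathbf u$, $\mathbf u\sim\nu^{\otimes2}$. $\mathcal E^{\mathrm{SRI}}_{2\times d}(\Psi_\sigma,M,F)$: SRI chains (any base measure) with decay function $F$ and $\int e^{\sigma|y_i-x_i|}\boldsymbol b(\mathbf x,d\mathbf y)\le M$ for all $\mathbf x$, $i=1,2$. Centered: $\int(y_j-x_j)\boldsymbol b(\mathbf x,d\mathbf y)=\int_Iu\,\nu(du)$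 for all $\mathbf x,j$. $\delta$-repulsive: $\int|y_1-y_2-(x_1-x_2)|\boldsymbol b(\mathbf x,d\mathbf y)>\delta$ for all $\mathbf x$. $d_{\mathrm{SRI}}(\boldsymbol b,\boldsymbol b')=\sup_{\mathbf x}\|\boldsymbol b(\mathbf x,\cdot)-\boldsymbol b'(\mathbf x,\cdot)\|_{TV}$; convergence of chains is in $d_{\mathrm{SRI}}$. $\mathbf E^{\boldsymbol b}_{\mathbf x}$: expectation for the chain $\mathbf R_r=(R^1_r,R^2_r)$ with kernel $\boldsymbol b$ started at $\mathbf x$. Diagonally translation invariant: $\boldsymbol b(\mathbf x+(a,a),A+(a,a))=\boldsymbol b(\mathbf x,A)$ for all $a\in I$. Difference kernel: $\boldsymbol b_{\mathrm{dif}}(x,A)=\int_{I^2}\mathbf 1_{\{y_1-y_2\in A\}}\boldsymbol b((x,0),d\mathbf y)$. (F): $x\mapsto\boldsymbol b_{\mathrm{dif}}(x,\cdot)$ is continuous in total variation, and for every $x\in I$ and nonempty open $U\subset I$ there is $m$ with $\boldsymbol b_{\mathrm{dif}}^m(x,U)>0$. *)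

theory Defs
  imports "HOL-Probability.Probability"
begin

section \<open>Markov kernels and Markov chains\<close>

abbreviation borel_on :: "'a::topological_space set \<Rightarrow> 'a measure" where
  "borel_on S \<equiv> restrict_space borel S"

abbreviation markov_kernel :: "'a measure \<Rightarrow> ('a \<Rightarrow> 'a measure) \<Rightarrow> bool" where
  "markov_kernel S K \<equiv> K \<in> S \<rightarrow>\<^sub>M prob_algebra S"

primrec kernel_pow :: "'a measure \<Rightarrow> ('a \<Rightarrow> 'a measure) \<Rightarrow> nat \<Rightarrow> 'a \<Rightarrow> 'a measure" where
  "kernel_pow S K 0 = return S"
| "kernel_pow S K (Suc n) = (\<lambda>x. K x \<bind> kernel_pow S K n)"

text \<open>
  The law on path space of the chain with kernel \<open>K\<close> started at \<open>x\<close> is obtained from the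
  Ionescu-Tulcea theorem. The conditional law of coordinate \<open>n\<close> given the coordinates \<open>0, ..., n - 1\<close>
  is the point mass at \<open>x\<close> for \<open>n = 0\<close>, and depends on coordinate \<open>n - 1\<close> only for \<open>n > 0\<close>.
\<close>

definition chain_step :: "'a measure \<Rightarrow> ('a \<Rightarrow> 'a measure) \<Rightarrow> 'a \<Rightarrow> nat \<Rightarrow> (nat \<Rightarrow> 'a) \<Rightarrow> 'a measure" where
  "chain_step S K x n \<omega> = (case n of 0 \<Rightarrow> return S x | Suc k \<Rightarrow> K (\<omega> k))"

definition chain_law :: "'a measure \<Rightarrow> ('a \<Rightarrow> 'a measure) \<Rightarrow> 'a \<Rightarrow> (nat \<Rightarrow> 'a) measure" where
  "chain_law S K x =
     projective_family.lim UNIV (Ionescu_Tulcea.CI (chain_step S K x) (\<lambda>_. S)) (\<lambda>_. S)"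

lemma Ionescu_Tulcea_chain_step:
  assumes K: "markov_kernel S K" and x: "x \<in> space S"
  shows "Ionescu_Tulcea (chain_step S K x) (\<lambda>_. S)"
proof (rule Ionescu_Tulcea.intro)
  fix i :: nat
  show "chain_step S K x i \<in> PiM {0..<i} (\<lambda>_. S) \<rightarrow>\<^sub>M subprob_algebra S"
  proof (cases i)
    case 0
    have "return S x \<in> space (subprob_algebra S)"
      using x by (simp add: space_subprob_algebra prob_space_return prob_space_imp_subprob_space)
    then show ?thesis
      unfolding chain_step_def 0 by simp
  next
    case (Suc k)
    have "(\<lambda>\<omega>. \<omega> k) \<in> PiM {0..<i} (\<lambda>_. S) \<rightarrow>\<^sub>M S"
      using Suc by (intro measurable_component_singleton) auto
    then have "(\<lambda>\<omega>. K (\<omega> k)) \<in> PiM {0..<i} (\<lambda>_. S) \<rightarrow>\<^sub>M subprob_algebra S"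
      using measurable_prob_algebraD[OF K] by (rule measurable_compose)
    then show ?thesis
      unfolding chain_step_def Suc by simp
  qed
next
  fix i :: nat and \<omega> assume "\<omega> \<in> space (PiM {0..<i} (\<lambda>_. S))"
  then show "prob_space (chain_step S K x i \<omega>)"
    using x measurable_space[OF K]
    by (auto simp: chain_step_def space_prob_algebra space_PiM PiE_iff
        intro!: prob_space_return split: nat.split)
qed

section \<open>SRI chains\<close>

text \<open>
  Total variation distance of two probability measures on the same measurable space. The other common
  normalization (the total mass of the variation) is twice this number; the factor can be absorbed
  into decay functions and closeness thresholds.
\<close>

definition tv_dist :: "'a measure \<Rightarrow> 'a measure \<Rightarrow> real" where
  "tv_dist \<mu> \<nu> = (SUP A\<in>sets \<mu>. \<bar>measure \<mu> A - measure \<nu> A\<bar>)"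

definition exp_decay_on :: "'a::real_normed_vector set \<Rightarrow> ('a \<Rightarrow> real) \<Rightarrow> bool" where
  "exp_decay_on S f \<longleftrightarrow> (\<exists>A>0. \<exists>c>0. \<forall>x\<in>S. \<bar>f x\<bar> \<le> A * exp (- c * norm x))"

text \<open>Decay functions are used on \<open>{0..}\<close> only.\<close>

definition sri_chain ::
  "'a::euclidean_space set \<Rightarrow> 'a measure \<Rightarrow> (real \<Rightarrow> real) \<Rightarrow> ('a \<times> 'a \<Rightarrow> ('a \<times> 'a) measure) \<Rightarrow> bool"
where
  "sri_chain I \<nu> F b \<longleftrightarrow>
     \<nu> \<in> space (prob_algebra (borel_on I)) \<and>
     markov_kernel (borel_on (I \<times> I)) b \<and>
     (\<forall>x\<in>I \<times> I.
        tv_dist (b x) (distr (\<nu> \<Otimes>\<^sub>M \<nu>) (borel_on (I \<times> I)) (\<lambda>u. x + u)) \<le> F (norm (fst x - snd x)))"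

definition sri_class ::
  "'a::euclidean_space set \<Rightarrow> real \<Rightarrow> real \<Rightarrow> (real \<Rightarrow> real) \<Rightarrow> ('a \<times> 'a \<Rightarrow> ('a \<times> 'a) measure) set"
where
  "sri_class I \<sigma> M F =
     {b. (\<exists>\<nu>. sri_chain I \<nu> F b) \<and>
         (\<forall>x\<in>I \<times> I.
            (\<integral>\<^sup>+y. ennreal (exp (\<sigma> * norm (fst y - fst x))) \<partial>b x) \<le> ennreal M \<and>
            (\<integral>\<^sup>+y. ennreal (exp (\<sigma> * norm (snd y - snd x))) \<partial>b x) \<le> ennreal M)}"

definition centered ::
  "'a::euclidean_space set \<Rightarrow> 'a measure \<Rightarrow> ('a \<times> 'a \<Rightarrow> ('a \<times> 'a) measure) \<Rightarrow> bool"
where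
  "centered I \<nu> b \<longleftrightarrow>
     (\<forall>x\<in>I \<times> I. (\<integral>y. fst y - fst x \<partial>b x) = (\<integral>u. u \<partial>\<nu>) \<and> (\<integral>y. snd y - snd x \<partial>b x) = (\<integral>u. u \<partial>\<nu>))"

definition repulsive ::
  "'a::euclidean_space set \<Rightarrow> real \<Rightarrow> ('a \<times> 'a \<Rightarrow> ('a \<times> 'a) measure) \<Rightarrow> bool"
where
  "repulsive I \<delta> b \<longleftrightarrow>
     (\<forall>x\<in>I \<times> I. (\<integral>\<^sup>+y. ennreal (norm (fst y - snd y - (fst x - snd x))) \<partial>b x) > ennreal \<delta>)"

definition d_sri ::
  "'a::euclidean_space set \<Rightarrow> ('a \<times> 'a \<Rightarrow> ('a \<times> 'a) measure) \<Rightarrow> ('a \<times> 'a \<Rightarrow> ('a \<times> 'a) measure) \<Rightarrow> real"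
where
  "d_sri I b b' = (SUP x\<in>I \<times> I. tv_dist (b x) (b' x))"

definition diag_trans_inv ::
  "'a::euclidean_space set \<Rightarrow> ('a \<times> 'a \<Rightarrow> ('a \<times> 'a) measure) \<Rightarrow> bool"
where
  "diag_trans_inv I b \<longleftrightarrow>
     (\<forall>x\<in>I \<times> I. \<forall>a\<in>I. \<forall>A\<in>sets (borel_on (I \<times> I)).
        emeasure (b (x + (a, a))) ((\<lambda>z. z + (a, a)) ` A) = emeasure (b x) A)"

definition dif_kernel ::
  "'a::euclidean_space set \<Rightarrow> ('a \<times> 'a \<Rightarrow> ('a \<times> 'a) measure) \<Rightarrow> 'a \<Rightarrow> 'a measure"
where
  "dif_kernel I b x = distr (b (x, 0)) (borel_on I) (\<lambda>y. fst y - snd y)"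

text \<open>
  The case \<open>m = 0\<close> (identity kernel) is harmless: unless \<open>I = {0}\<close>, allowing it does not change the condition.
\<close>

definition condition_F :: "'a::euclidean_space set \<Rightarrow> ('a \<Rightarrow> 'a measure) \<Rightarrow> bool" where
  "condition_F I K \<longleftrightarrow>
     (\<forall>x\<in>I. ((\<lambda>x'. tv_dist (K x') (K x)) \<longlongrightarrow> 0) (at x within I)) \<and>
     (\<forall>x\<in>I. \<forall>U. openin (top_of_set I) U \<and> U \<noteq> {} \<longrightarrow>
        (\<exists>m. emeasure (kernel_pow (borel_on I) K m x) U > 0))"

definition covariance_matrix :: "(real^'n) measure \<Rightarrow> real^'n^'n" where
  "covariance_matrix \<nu> =
     (\<chi> i j. \<integral>u. (u $ i - (\<integral>v. v $ i \<partial>\<nu>)) * (u $ j - (\<integral>v. v $ j \<partial>\<nu>)) \<partial>\<nu>)"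

section \<open>Test functions\<close>

definition partial_deriv :: "'n \<Rightarrow> (real^'n \<Rightarrow> real) \<Rightarrow> real^'n \<Rightarrow> real" where
  "partial_deriv i f x = frechet_derivative f (at x) (axis i 1)"

text \<open>
  Infinite differentiability: every iterated partial derivative is differentiable (hence continuous).
\<close>

definition smooth :: "(real^'n \<Rightarrow> real) \<Rightarrow> bool" where
  "smooth f \<longleftrightarrow> (\<forall>is. \<forall>x. foldr partial_deriv is f differentiable (at x))"

definition admissible_test_fun :: "(real^'n \<Rightarrow> real) \<Rightarrow> bool" where
  "admissible_test_fun \<phi> \<longleftrightarrow>
     smooth \<phi> \<and> bounded (range \<phi>) \<and>
     (\<forall>i. bounded (range (partial_deriv i \<phi>))) \<and>
     (\<forall>i j. bounded (range (partial_deriv i (partial_deriv j \<phi>))))"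

definition equicontinuous_on :: "'a::metric_space set \<Rightarrow> ('i \<Rightarrow> 'a \<Rightarrow> real) \<Rightarrow> bool" where
  "equicontinuous_on S g \<longleftrightarrow>
     (\<forall>x\<in>S. \<forall>e>0. \<exists>d>0. \<forall>n. \<forall>x'\<in>S. dist x' x < d \<longrightarrow> \<bar>g n x' - g n x\<bar> < e)"

section \<open>Multi-time functionals\<close>

text \<open>
  The sequences \<open>r\<^sub>1 < ... < r\<^sub>m\<close> of natural numbers, as extensional functions on \<open>{1..m}\<close>.
\<close>

definition increasing_times :: "nat \<Rightarrow> (nat \<Rightarrow> nat) set" where
  "increasing_times m = {r \<in> {1..m} \<rightarrow>\<^sub>E UNIV. strict_mono_on {1..m} r}"

definition prelimit_functional ::
  "(real^'n) set \<Rightarrow> ((real^'n) \<times> (real^'n) \<Rightarrow> ((real^'n) \<times> (real^'n)) measure) \<Rightarrow> (real^'n) \<times> (real^'n) \<Rightarrow>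
   real^'n \<Rightarrow> nat \<Rightarrow> real \<Rightarrow> nat \<Rightarrow> (nat \<Rightarrow> real^'n \<Rightarrow> real) \<Rightarrow> (nat \<Rightarrow> real^'n \<Rightarrow> real) \<Rightarrow> real"
where
  "prelimit_functional I b x s N t m f \<phi> =
     (\<integral>R. (\<Sum>r | r \<in> increasing_times m \<and> (\<forall>l\<in>{1..m}. real (r l) \<le> real N * t).
             \<Prod>l\<in>{1..m}. f l (fst (R (r l)) - snd (R (r l))) *
                \<phi> l ((1 / sqrt (real N)) *\<^sub>R (fst (R (r l)) - real (r l) *\<^sub>R s)))
      \<partial>chain_law (borel_on (I \<times> I)) b x)"

definition dif_correlation ::
  "(real^'n) set \<Rightarrow> (real^'n \<Rightarrow> (real^'n) measure) \<Rightarrow> real^'n \<Rightarrow> nat \<Rightarrow>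
   (nat \<Rightarrow> real^'n \<Rightarrow> real) \<Rightarrow> (nat \<Rightarrow> nat) \<Rightarrow> real"
where
  "dif_correlation I K y m f r = (\<integral>X. (\<Prod>l\<in>{1..m}. f l (X (r l))) \<partial>chain_law (borel_on I) K y)"

end

(*
  The difference R^1 - R^2 is a centered random walk far from the origin, with covariance close to
  2 Id, and the repulsivity of b0 forbids it to stick near the origin; its residual drift is small and decays
  exponentially in the distance. As d >= 3, the potential u(z) = (K + |z|^2)^(-1/4) therefore satisfies
  P u <= u - c u^5 for every late kernel b_N, with the same K and c. Iterating this inequality shows that the part of
  the sum over r_1 < ... < r_m in which some r_l is large is small uniformly in N and in the starting point.
  Hence the limit can be taken term by term. For fixed times the test functions can be replaced by their values
  at x_1 because R^1 has moved by O(1) only, and diagonal translation invariance turns what is left into a functional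
  of the difference chain, whose kernels converge in total variation along convergent starting points.
*)
theory Submission
  imports Defs
begin

section \<open>Total variation: probabilities, bounded integrands, square-integrable
  integrands\<close>

section \<open>Total variation distance\<close>

text \<open>The exponent lies in a window: in dimension d the function |z|^(-\<beta>) is
  superharmonic for 0 < \<beta> < d - 2, and \<beta> = 1/2 is the middle of the window for d = 3.
  Away from the origin a walk with covariance 2 Id lowers such a u by order u / (K + |z|^2), which
  is exactly u^5; functions of exponential decay are dominated by it, so one inequality controls all
  sums of the f^l.

  The obstacle is that only b0 is centered. Closeness to b0 bounds the drift of b_N by a small
  constant, which is useless after multiplication by a large |z|; near-independence bounds it only
  at large distance. The resulting bound on \<open>z \<bullet> E v\<close> involves \<epsilon>,
  \<sigma>, M and F but not K, so \<epsilon> can be fixed before b is known, while K depends on how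
  fast b approaches independent steps. The decay function of b is merely null at infinity: the
  exponential rate is taken from b_N with its own base measure, the covariance from b. Moments are
  bounded for chains, not for base measures; they are transferred along pairs of distant points,
  which exist because covariance Id excludes I = {0}.\<close>

lemma measure_diff_le_tv_dist:
  assumes "prob_space \<mu>" "prob_space \<nu>" "A \<in> sets \<mu>"
  shows "\<bar>measure \<mu> A - measure \<nu> A\<bar> \<le> tv_dist \<mu> \<nu>"
proof -
  interpret m: prob_space \<mu> by fact
  interpret n: prob_space \<nu> by fact
  have "\<bar>measure \<mu> B - measure \<nu> B\<bar> \<le> 1" for B
    using m.prob_le_1[of B] n.prob_le_1[of B] measure_nonneg[of \<mu> B] measure_nonneg[of \<nu> B]
    by linarith
  then show ?thesis
    unfolding tv_dist_def using assms(3) by (intro cSUP_upper bdd_aboveI2[where M=1]) auto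
qed

lemma tv_dist_nonneg:
  assumes "prob_space \<mu>" "prob_space \<nu>"
  shows "0 \<le> tv_dist \<mu> \<nu>"
  using measure_diff_le_tv_dist[OF assms, of "{}"] by simp

lemma tv_dist_le:
  assumes "\<And>A. A \<in> sets \<mu> \<Longrightarrow> \<bar>measure \<mu> A - measure \<nu> A\<bar> \<le> t"
  shows "tv_dist \<mu> \<nu> \<le> t"
  unfolding tv_dist_def using assms by (intro cSUP_least) (auto intro: sets.empty_sets)

lemma tv_dist_le_1:
  assumes "prob_space \<mu>" "prob_space \<nu>"
  shows "tv_dist \<mu> \<nu> \<le> 1"
proof -
  interpret m: prob_space \<mu> by fact
  interpret n: prob_space \<nu> by fact
  show ?thesis
  proof (rule tv_dist_le)
    fix B
    show "\<bar>measure \<mu> B - measure \<nu> B\<bar> \<le> 1"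
      using m.prob_le_1[of B] n.prob_le_1[of B] measure_nonneg[of \<mu> B] measure_nonneg[of \<nu> B]
      by linarith
  qed
qed

lemma tv_dist_triangle:
  assumes "prob_space \<mu>" "prob_space \<nu>" "prob_space \<rho>" "sets \<mu> = sets \<nu>"
  shows "tv_dist \<mu> \<rho> \<le> tv_dist \<mu> \<nu> + tv_dist \<nu> \<rho>"
proof (rule tv_dist_le)
  fix A assume A: "A \<in> sets \<mu>"
  show "\<bar>measure \<mu> A - measure \<rho> A\<bar> \<le> tv_dist \<mu> \<nu> + tv_dist \<nu> \<rho>"
    using measure_diff_le_tv_dist[OF assms(1,2) A] measure_diff_le_tv_dist[OF assms(2,3), of A] A assms(4)
    by auto
qed

lemma tv_dist_distr_le:
  assumes "prob_space \<mu>" "prob_space \<nu>" "sets \<mu> = sets \<nu>" "g \<in> \<mu> \<rightarrow>\<^sub>M N"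
  shows "tv_dist (distr \<mu> N g) (distr \<nu> N g) \<le> tv_dist \<mu> \<nu>"
proof (rule tv_dist_le)
  fix A assume "A \<in> sets (distr \<mu> N g)"
  then have A: "A \<in> sets N" by simp
  have g': "g \<in> \<nu> \<rightarrow>\<^sub>M N" using assms(3,4) by (simp cong: measurable_cong_sets)
  show "\<bar>measure (distr \<mu> N g) A - measure (distr \<nu> N g) A\<bar> \<le> tv_dist \<mu> \<nu>"
    using measure_diff_le_tv_dist[OF assms(1,2) measurable_sets[OF assms(4) A]] A assms(4) g'
      sets_eq_imp_space_eq[OF assms(3)] by (simp add: measure_distr)
qed

text \<open>The number of thresholds \<open>k / n\<close> below x is the integer part of
  \<open>n * x\<close>. Applied to the values of a function, this replaces its integral by an
  average of measures of level sets.\<close>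

lemma sum_threshold_approx:
  fixes x :: real
  assumes "0 \<le> x" "x \<le> 1" "n > 0"
  shows "\<bar>x - (\<Sum>k\<in>{1..n}. indicator {x. real k \<le> real n * x} x) / real n\<bar> \<le> 1 / real n"
proof -
  have "{k\<in>{1..n}. real k \<le> real n * x} = {1..nat \<lfloor>real n * x\<rfloor>}"
  proof -
    have "real n * x \<le> real n" using assms by (simp add: mult_left_le)
    then have "nat \<lfloor>real n * x\<rfloor> \<le> n" by linarith
    moreover have "real k \<le> real n * x \<longleftrightarrow> k \<le> nat \<lfloor>real n * x\<rfloor>" for k
      using assms by (simp add: le_nat_floor le_nat_iff le_floor_iff)
    ultimately show ?thesis by (intro set_eqI) (simp del: le_nat_floor, linarith)
  qed
  then have "(\<Sum>k\<in>{1..n}. indicator {x. real k \<le> real n * x} x) = real (nat \<lfloor>real n * x\<rfloor>)"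
    by (simp add: indicator_def sum.If_cases Int_def)
  moreover have "\<bar>real n * x - real (nat \<lfloor>real n * x\<rfloor>)\<bar> \<le> 1" using assms by simp linarith
  ultimately have "\<bar>real n * (x - (\<Sum>k\<in>{1..n}. indicator {x. real k \<le> real n * x} x) / real n)\<bar> \<le> 1"
    using assms by (simp add: right_diff_distrib)
  then show ?thesis using assms(3)
    unfolding abs_mult by (simp add: pos_le_divide_eq mult.commute[of "real n"] del: One_nat_def)
qed

text \<open>Layer cake: f is within \<open>1 / n\<close> of an average of n indicators of level
  sets, and the measure of each level set changes by at most \<open>tv_dist \<mu> \<nu>\<close>.
  Letting n tend to infinity removes the error \<open>2 / n\<close>.\<close>

lemma integral_diff_le_tv_dist_unit:
  fixes f :: "'a \<Rightarrow> real"
  assumes "prob_space \<mu>" "prob_space \<nu>" and sets: "sets \<mu> = sets \<nu>" and f: "f \<in> borel_measurable \<mu>"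
    and f01: "\<And>x. x \<in> space \<mu> \<Longrightarrow> 0 \<le> f x \<and> f x \<le> 1"
  shows "\<bar>(\<integral>x. f x \<partial>\<mu>) - (\<integral>x. f x \<partial>\<nu>)\<bar> \<le> tv_dist \<mu> \<nu>"
proof -
  interpret m: prob_space \<mu> by fact
  interpret n: prob_space \<nu> by fact
  have sp: "space \<mu> = space \<nu>" by (rule sets_eq_imp_space_eq[OF sets])
  have f': "f \<in> borel_measurable \<nu>" using f sets by (simp cong: measurable_cong_sets)
  define A where "A n k = {x \<in> space \<mu>. real k \<le> real n * f x}" for n k :: nat
  have A: "A n k \<in> sets \<mu>" for n k unfolding A_def using f by measurable
  define g where "g n x = (\<Sum>k\<in>{1..n}. indicator (A n k) x) / real n" for n x
  have fg: "\<bar>f x - g n x\<bar> \<le> 1 / real n" if "x \<in> space \<mu>" "n > 0" for x n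
  proof -
    have "(indicator (A n k) x::real) = indicator {x. real k \<le> real n * x} (f x)" for k
      using that by (auto simp: A_def indicator_def)
    then show ?thesis using sum_threshold_approx[of "f x" n] that f01 unfolding g_def by simp
  qed
  have dm: "\<bar>(\<integral>x. f x \<partial>\<mu>) - (\<integral>x. f x \<partial>\<nu>)\<bar> \<le> tv_dist \<mu> \<nu> + 2 / real n" if n: "n > 0" for n
  proof -
    have key: "\<bar>(\<integral>x. f x \<partial>P) - (\<Sum>k\<in>{1..n}. measure P (A n k)) / real n\<bar> \<le> 1 / real n"
      if P: "prob_space P" "sets P = sets \<mu>" for P
    proof -
      interpret P: prob_space P by fact
      have spP: "space P = space \<mu>" by (rule sets_eq_imp_space_eq[OF P(2)])
      have fP[measurable]: "f \<in> borel_measurable P" using f P(2) by (simp cong: measurable_cong_sets)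
      have AP[measurable]: "A n k \<in> sets P" for k using A P by simp
      have gP[measurable]: "g n \<in> borel_measurable P" unfolding g_def by measurable
      have fi: "integrable P f" by (rule P.integrable_const_bound[where B=1]) (use f01 spP in auto)
      have gi: "integrable P (g n)" unfolding g_def by (auto intro!: integrable_real_indicator simp: P.emeasure_eq_measure)
      have "(\<integral>x. g n x \<partial>P) = (\<Sum>k\<in>{1..n}. measure P (A n k)) / real n"
        unfolding g_def by (simp add: P.emeasure_eq_measure)
      moreover have "\<bar>\<integral>x. f x - g n x \<partial>P\<bar> \<le> (\<integral>x. 1 / real n \<partial>P)"
        by (rule integral_abs_bound[THEN order_trans], rule integral_mono)
          (use fi gi fg spP n in \<open>auto\<close>)
      ultimately show ?thesis using fi gi by (simp add: P.prob_space)
    qed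
    have "\<bar>(\<Sum>k\<in>{1..n}. measure \<mu> (A n k)) - (\<Sum>k\<in>{1..n}. measure \<nu> (A n k))\<bar>
        \<le> (\<Sum>k\<in>{1..n}. tv_dist \<mu> \<nu>)"
      unfolding sum_subtractf[symmetric]
      by (rule order_trans[OF sum_abs sum_mono], rule measure_diff_le_tv_dist[OF assms(1,2) A])
    then have "\<bar>(\<Sum>k\<in>{1..n}. measure \<mu> (A n k)) / real n - (\<Sum>k\<in>{1..n}. measure \<nu> (A n k)) / real n\<bar>
        \<le> tv_dist \<mu> \<nu>"
      unfolding diff_divide_distrib[symmetric] using n by (simp add: field_simps)
    with key[OF assms(1) refl] key[OF assms(2) sets[symmetric]] show ?thesis
      by (simp add: field_simps)
  qed
  show ?thesis
  proof (rule LIMSEQ_le_const[of _ "tv_dist \<mu> \<nu>"])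
    show "(\<lambda>n. tv_dist \<mu> \<nu> + 2 / real n) \<longlonglongrightarrow> tv_dist \<mu> \<nu>"
      by (intro tendsto_eq_intros lim_const_over_n) auto
    show "\<exists>N. \<forall>n\<ge>N. \<bar>(\<integral>x. f x \<partial>\<mu>) - (\<integral>x. f x \<partial>\<nu>)\<bar> \<le> tv_dist \<mu> \<nu> + 2 / real n"
      using dm by (intro exI[of _ 1]) auto
  qed
qed

text \<open>An affine map carries the range [-B, B] to the unit interval, at the price of the factor
  \<open>2 * B\<close>.\<close>

lemma integral_diff_le_tv_dist:
  fixes f :: "'a \<Rightarrow> real"
  assumes "prob_space \<mu>" "prob_space \<nu>" and sets: "sets \<mu> = sets \<nu>" and f: "f \<in> borel_measurable \<mu>"
    and fB: "\<And>x. x \<in> space \<mu> \<Longrightarrow> \<bar>f x\<bar> \<le> B" and "B > 0"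
  shows "\<bar>(\<integral>x. f x \<partial>\<mu>) - (\<integral>x. f x \<partial>\<nu>)\<bar> \<le> 2 * B * tv_dist \<mu> \<nu>"
proof -
  interpret m: prob_space \<mu> by fact
  interpret n: prob_space \<nu> by fact
  have sp: "space \<mu> = space \<nu>" by (rule sets_eq_imp_space_eq[OF sets])
  have f': "f \<in> borel_measurable \<nu>" using f sets by (simp cong: measurable_cong_sets)
  have i: "integrable \<mu> f" by (rule m.integrable_const_bound[where B=B]) (use fB f in auto)
  have i': "integrable \<nu> f" by (rule n.integrable_const_bound[where B=B]) (use fB f' sp in auto)
  have "\<bar>(\<integral>x. (f x + B) / (2 * B) \<partial>\<mu>) - (\<integral>x. (f x + B) / (2 * B) \<partial>\<nu>)\<bar> \<le> tv_dist \<mu> \<nu>"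
    using assms fB by (intro integral_diff_le_tv_dist_unit) (fastforce simp: abs_le_iff)+
  then show ?thesis using i i' \<open>B > 0\<close>
    by (simp add: m.prob_space n.prob_space diff_divide_distrib[symmetric] field_simps)
qed

text \<open>Truncation of f at level L costs at most \<open>B / L\<close> under each measure, since
  the error is at most \<open>f^2 / L\<close> pointwise, and the integral of the truncated function
  changes by at most \<open>2 * L * t\<close>. This transfers first and second moments of increments
  between laws that are close in total variation.\<close>

lemma integral_diff_le_sqrt_tv:
  fixes f :: "'a \<Rightarrow> real"
  assumes "prob_space \<mu>" "prob_space \<nu>" and sets: "sets \<mu> = sets \<nu>" and f: "f \<in> borel_measurable \<mu>"
    and i: "integrable \<mu> (\<lambda>x. (f x)\<^sup>2)" and i': "integrable \<nu> (\<lambda>x. (f x)\<^sup>2)"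
    and B: "(\<integral>x. (f x)\<^sup>2 \<partial>\<mu>) \<le> B" "(\<integral>x. (f x)\<^sup>2 \<partial>\<nu>) \<le> B" and t: "tv_dist \<mu> \<nu> \<le> t"
  shows "\<bar>(\<integral>x. f x \<partial>\<mu>) - (\<integral>x. f x \<partial>\<nu>)\<bar> \<le> 2 * (1 + B) * sqrt t"
proof -
  interpret m: prob_space \<mu> by fact
  interpret n: prob_space \<nu> by fact
  have f': "f \<in> borel_measurable \<nu>" using f sets by (simp cong: measurable_cong_sets)
  have t0: "0 \<le> t" using tv_dist_nonneg[OF assms(1,2)] t by simp
  have main: "\<bar>(\<integral>x. f x \<partial>\<mu>) - (\<integral>x. f x \<partial>\<nu>)\<bar> \<le> 2 * L * t + 2 * B / L" if L: "L > 0" for L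
  proof -
    define g where "g x = max (- L) (min L (f x))" for x
    have fg: "\<bar>f x - g x\<bar> \<le> (f x)\<^sup>2 / L" for x
    proof -
      have "\<bar>f x - g x\<bar> * L \<le> \<bar>f x\<bar> * \<bar>f x\<bar>"
      proof (cases "\<bar>f x\<bar> \<le> L")
        case True then show ?thesis using L by (auto simp: g_def min_def max_def abs_le_iff)
      next
        case False
        then show ?thesis using L by (intro mult_mono) (auto simp: g_def min_def max_def abs_if)
      qed
      then show ?thesis using L by (simp add: field_simps power2_eq_square)
    qed
    have key: "\<bar>(\<integral>x. f x \<partial>P) - (\<integral>x. g x \<partial>P)\<bar> \<le> B / L"
      if P: "prob_space P" "f \<in> borel_measurable P" "integrable P (\<lambda>x. (f x)\<^sup>2)" "(\<integral>x. (f x)\<^sup>2 \<partial>P) \<le> B" for P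
    proof -
      interpret P: prob_space P by fact
      have fi: "integrable P f" by (rule P.square_integrable_imp_integrable[OF P(2,3)])
      have gi: "integrable P g" unfolding g_def
        by (rule P.integrable_const_bound[where B=L]) (use L P(2) in \<open>auto simp: abs_le_iff\<close>)
      have "\<bar>\<integral>x. f x - g x \<partial>P\<bar> \<le> (\<integral>x. (f x)\<^sup>2 / L \<partial>P)"
        by (rule integral_abs_bound[THEN order_trans], rule integral_mono) (use fi gi fg P in auto)
      also have "\<dots> \<le> B / L" using P(4) L by (simp add: divide_right_mono)
      finally show ?thesis using fi gi by simp
    qed
    have "g \<in> borel_measurable \<mu>" unfolding g_def using f by measurable
    then have "\<bar>(\<integral>x. g x \<partial>\<mu>) - (\<integral>x. g x \<partial>\<nu>)\<bar> \<le> 2 * L * tv_dist \<mu> \<nu>"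
      using L assms by (intro integral_diff_le_tv_dist) (auto simp: g_def abs_le_iff)
    also have "\<dots> \<le> 2 * L * t" using L t by (intro mult_left_mono) auto
    finally show ?thesis using key[OF assms(1) f i B(1)] key[OF assms(2) f' i' B(2)] by argo
  qed
  have B0: "0 \<le> B" by (rule order_trans[OF _ B(1)]) simp
  show ?thesis
  proof (cases "t = 0")
    case True
    have "(\<lambda>n. 2 * B / real n) \<longlonglongrightarrow> 0" by (rule lim_const_over_n)
    then have "\<bar>(\<integral>x. f x \<partial>\<mu>) - (\<integral>x. f x \<partial>\<nu>)\<bar> \<le> 0"
      by (rule LIMSEQ_le_const) (use main True in \<open>auto intro!: exI[of _ 1]\<close>)
    then show ?thesis using True by simp
  next
    case False
    have s: "sqrt t * sqrt t = t" "sqrt t > 0" using t0 False by auto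
    have "2 * (1 / sqrt t) * t + 2 * B / (1 / sqrt t) = 2 * (1 + B) * sqrt t"
      using s by (simp add: field_simps)
    then show ?thesis using main[of "1 / sqrt t"] s by simp
  qed
qed

section \<open>Expectations of products along a Markov chain as iterated integrals\<close>

section \<open>Path functionals\<close>

text \<open>This is the expectation of \<open>h 0 (X 0) * ... * h (n - 1) (X (n - 1))\<close> for
  the chain started at x, written by conditioning on the first step. Estimates and limits become
  inductions over this recursion; \<open>integral_chain_law_prod\<close> links it to path
  space.\<close>

primrec chain_prod :: "('a \<Rightarrow> 'a measure) \<Rightarrow> nat \<Rightarrow> (nat \<Rightarrow> 'a \<Rightarrow> real) \<Rightarrow> 'a \<Rightarrow> real" where
  "chain_prod K 0 h x = 1"
| "chain_prod K (Suc n) h x = h 0 x * (\<integral>y. chain_prod K n (\<lambda>k. h (Suc k)) y \<partial>K x)"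

lemma markov_kernelD:
  assumes "markov_kernel S K" "x \<in> space S"
  shows "prob_space (K x)" "sets (K x) = sets S" "space (K x) = space S"
  using measurable_space[OF assms] by (auto simp: space_prob_algebra dest: sets_eq_imp_space_eq)

lemma markov_kernel_integral_measurable:
  fixes f :: "'a \<Rightarrow> real"
  assumes "markov_kernel S K" "f \<in> borel_measurable S"
  shows "(\<lambda>x. \<integral>y. f y \<partial>K x) \<in> borel_measurable S"
  using measurable_compose[OF measurable_prob_algebraD[OF assms(1)] integral_measurable_subprob_algebra[OF assms(2)]]
  by simp

lemma markov_kernel_integrable:
  fixes f :: "'a \<Rightarrow> real"
  assumes "markov_kernel S K" "x \<in> space S" "f \<in> borel_measurable S" "\<And>y. y \<in> space S \<Longrightarrow> \<bar>f y\<bar> \<le> C"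
  shows "integrable (K x) f"
proof -
  interpret prob_space "K x" by (rule markov_kernelD[OF assms(1,2)])
  show ?thesis using assms(3,4) markov_kernelD[OF assms(1,2)]
    by (intro integrable_const_bound[where B=C]) (auto cong: measurable_cong_sets)
qed

lemma markov_kernel_integral_le:
  fixes f :: "'a \<Rightarrow> real"
  assumes "markov_kernel S K" "x \<in> space S" "f \<in> borel_measurable S" "\<And>y. y \<in> space S \<Longrightarrow> \<bar>f y\<bar> \<le> C"
  shows "\<bar>\<integral>y. f y \<partial>K x\<bar> \<le> C"
proof -
  interpret prob_space "K x" by (rule markov_kernelD[OF assms(1,2)])
  have "\<bar>\<integral>y. f y \<partial>K x\<bar> \<le> (\<integral>y. C \<partial>K x)"
    by (rule integral_abs_bound[THEN order_trans], rule integral_mono)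
      (use markov_kernel_integrable[OF assms] assms(4) markov_kernelD[OF assms(1,2)] in auto)
  then show ?thesis by (simp add: prob_space)
qed

lemma chain_prod_measurable:
  assumes "markov_kernel S K" "\<And>k. h k \<in> borel_measurable S"
  shows "chain_prod K n h \<in> borel_measurable S"
  using assms(2)
proof (induction n arbitrary: h)
  case (Suc n)
  have "(\<lambda>x. \<integral>y. chain_prod K n (\<lambda>k. h (Suc k)) y \<partial>K x) \<in> borel_measurable S"
    by (rule markov_kernel_integral_measurable[OF assms(1) Suc.IH]) (rule Suc.prems)
  then show ?case using borel_measurable_times[OF Suc.prems[of 0]]
    by (simp add: chain_prod.simps(2)[abs_def])
qed (simp add: chain_prod.simps(1)[abs_def])

lemma chain_prod_bound:
  assumes "markov_kernel S K" "\<And>k. h k \<in> borel_measurable S" "\<And>k x. x \<in> space S \<Longrightarrow> \<bar>h k x\<bar> \<le> C"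
    and "0 \<le> C" "x \<in> space S"
  shows "\<bar>chain_prod K n h x\<bar> \<le> C ^ n"
  using assms(2,3,5)
proof (induction n arbitrary: h x)
  case (Suc n)
  have "\<bar>\<integral>y. chain_prod K n (\<lambda>k. h (Suc k)) y \<partial>K x\<bar> \<le> C ^ n"
    using Suc by (intro markov_kernel_integral_le[OF assms(1)] chain_prod_measurable[OF assms(1)]) auto
  then show ?case using Suc.prems assms(4) by (simp add: abs_mult mult_mono)
qed simp

lemma chain_prod_integrable:
  assumes "markov_kernel S K" "\<And>k. h k \<in> borel_measurable S" "\<And>k x. x \<in> space S \<Longrightarrow> \<bar>h k x\<bar> \<le> C"
    and "0 \<le> C" "x \<in> space S"
  shows "integrable (K x) (chain_prod K n h)"
proof (rule markov_kernel_integrable[OF assms(1,5), where C="C ^ n"])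
  show "chain_prod K n h \<in> borel_measurable S"
    by (rule chain_prod_measurable[OF assms(1)]) (rule assms(2))
  show "\<bar>chain_prod K n h y\<bar> \<le> C ^ n" if "y \<in> space S" for y
    by (rule chain_prod_bound[OF assms(1) _ _ assms(4) that]) (use assms(2,3) in auto)
qed

lemma chain_prod_nonneg:
  assumes "markov_kernel S K" "\<And>k x. x \<in> space S \<Longrightarrow> 0 \<le> h k x" "x \<in> space S"
  shows "0 \<le> chain_prod K n h x"
  using assms(2,3)
proof (induction n arbitrary: h x)
  case (Suc n)
  have "0 \<le> (\<integral>y. chain_prod K n (\<lambda>k. h (Suc k)) y \<partial>K x)"
  proof (rule Bochner_Integration.integral_nonneg)
    fix y assume "y \<in> space (K x)"
    then have y: "y \<in> space S" using markov_kernelD(3)[OF assms(1) Suc.prems(2)] by simp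
    show "0 \<le> chain_prod K n (\<lambda>k. h (Suc k)) y" by (rule Suc.IH[OF _ y]) (rule Suc.prems(1))
  qed
  then show ?case using Suc.prems(1)[OF Suc.prems(2), of 0] by simp
qed simp

text \<open>\<open>chain_prod\<close> peels off the first time, whereas the Ionescu-Tulcea
  construction adds a last one. Absorbing the last factor into its predecessor reconciles the two
  directions.\<close>

lemma chain_prod_Suc_last:
  assumes "markov_kernel S K" "x \<in> space S"
  shows "chain_prod K (Suc (Suc n)) h x =
    chain_prod K (Suc n) (h(n := \<lambda>y. h n y * (\<integral>z. h (Suc n) z \<partial>K y))) x"
  using assms(2)
proof (induction n arbitrary: h x)
  case 0
  interpret prob_space "K x" by (rule markov_kernelD[OF assms(1) 0])
  have "(\<integral>y. chain_prod K (Suc 0) (\<lambda>k. h (Suc k)) y \<partial>K x) = (\<integral>y. h (Suc 0) y \<partial>K x)"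
  proof (intro Bochner_Integration.integral_cong refl)
    fix y assume "y \<in> space (K x)"
    then have "y \<in> space S" using markov_kernelD[OF assms(1) 0] by simp
    then interpret Y: prob_space "K y" by (rule markov_kernelD[OF assms(1)])
    show "chain_prod K (Suc 0) (\<lambda>k. h (Suc k)) y = h (Suc 0) y" by (simp add: Y.prob_space)
  qed
  then show ?case by (simp add: prob_space)
next
  case (Suc n)
  have "(\<integral>y. chain_prod K (Suc (Suc n)) (\<lambda>k. h (Suc k)) y \<partial>K x)
      = (\<integral>y. chain_prod K (Suc n) (\<lambda>k. (h(Suc n := \<lambda>y. h (Suc n) y * (\<integral>z. h (Suc (Suc n)) z \<partial>K y))) (Suc k)) y \<partial>K x)"
  proof (intro Bochner_Integration.integral_cong refl)
    fix y assume "y \<in> space (K x)"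
    then have y: "y \<in> space S" using markov_kernelD[OF assms(1) Suc.prems] by simp
    have eq: "(\<lambda>k. h (Suc k))(n := \<lambda>y. h (Suc n) y * (\<integral>z. h (Suc (Suc n)) z \<partial>K y))
        = (\<lambda>k. (h(Suc n := \<lambda>y. h (Suc n) y * (\<integral>z. h (Suc (Suc n)) z \<partial>K y))) (Suc k))"
      by auto
    show "chain_prod K (Suc (Suc n)) (\<lambda>k. h (Suc k)) y =
      chain_prod K (Suc n) (\<lambda>k. (h(Suc n := \<lambda>y. h (Suc n) y * (\<integral>z. h (Suc (Suc n)) z \<partial>K y))) (Suc k)) y"
      using Suc.IH[OF y, of "\<lambda>k. h (Suc k)"] unfolding eq .
  qed
  then show ?case
    unfolding chain_prod.simps(2)[of K "Suc (Suc n)" h] chain_prod.simps(2)[of K "Suc n" "h(Suc n := _)"]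
    by (simp only: fun_upd_other[OF nat.distinct(1)])
qed

lemma component_compose_measurable:
  assumes "h \<in> S \<rightarrow>\<^sub>M N" "k \<in> J"
  shows "(\<lambda>\<omega>. h (\<omega> k)) \<in> PiM J (\<lambda>_. S) \<rightarrow>\<^sub>M N"
  using measurable_compose[OF measurable_component_singleton[OF assms(2), of "\<lambda>_. S"] assms(1)] .

context
  fixes S :: "'a measure" and K :: "'a \<Rightarrow> 'a measure" and x :: 'a
  assumes K: "markov_kernel S K" and x: "x \<in> space S"
begin

interpretation IT: Ionescu_Tulcea "chain_step S K x" "\<lambda>_. S"
  by (rule Ionescu_Tulcea_chain_step[OF K x])

lemma chain_law_sets: "sets (chain_law S K x) = sets (PiM UNIV (\<lambda>_. S))"
  unfolding chain_law_def by (rule IT.PF.sets_lim)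

lemma chain_law_space: "space (chain_law S K x) = UNIV \<rightarrow>\<^sub>E space S"
  using sets_eq_imp_space_eq[OF chain_law_sets] by (simp add: space_PiM)

text \<open>The projective limit is specified by its finite marginals \<open>CI\<close>, each
  defined through the initial segment found by \<open>up_to\<close>. For an index set that is an
  initial segment already, this is the composition of the first n steps.\<close>

lemma chain_law_restrict:
  "distr (chain_law S K x) (PiM {0..<n} (\<lambda>_. S)) (\<lambda>\<omega>. restrict \<omega> {0..<n}) = IT.C 0 n (\<lambda>_. undefined)"
proof -
  have "IT.up_to {0..<n} = n"
    by (rule antisym) (simp_all add: IT.up_to_iff_Ico, use IT.up_to[of "{0..<n}"] in auto)
  have "distr (chain_law S K x) (PiM {0..<n} (\<lambda>_. S)) (\<lambda>\<omega>. restrict \<omega> {0..<n}) = IT.CI {0..<n}"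
    unfolding chain_law_def by (rule IT.distr_lim) simp
  also have "\<dots> = IT.C 0 n (\<lambda>_. undefined)"
    unfolding IT.CI_def \<open>IT.up_to {0..<n} = n\<close>
    using IT.distr_C[of n n "\<lambda>_. undefined" 0] by (simp add: space_PiM)
  finally show ?thesis .
qed

lemma prob_space_chain_law: "prob_space (chain_law S K x)"
proof -
  have m: "(\<lambda>\<omega>. restrict \<omega> {0..<0}) \<in> chain_law S K x \<rightarrow>\<^sub>M PiM {0..<0} (\<lambda>_. S)"
    by (subst measurable_cong_sets[OF chain_law_sets refl]) (rule measurable_restrict_subset, simp)
  have "prob_space (IT.C 0 0 (\<lambda>_. undefined))" by (rule IT.prob_space_C) (simp add: space_PiM)
  then show ?thesis unfolding chain_law_restrict[symmetric] by (rule prob_space_distrD[OF m])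
qed

lemma chain_law_component_measurable: "(\<lambda>\<omega>. \<omega> k) \<in> chain_law S K x \<rightarrow>\<^sub>M S"
  by (subst measurable_cong_sets[OF chain_law_sets refl]) (rule measurable_component_singleton, simp)

lemma integral_C_prod:
  assumes h: "\<And>k. h k \<in> borel_measurable S" and hC: "\<And>k x. x \<in> space S \<Longrightarrow> \<bar>h k x\<bar> \<le> C" and C0: "0 \<le> C"
  shows "(\<integral>\<omega>. (\<Prod>k<Suc n. h k (\<omega> k)) \<partial>IT.C 0 (Suc n) (\<lambda>_. undefined)) = chain_prod K (Suc n) h x"
  using h hC C0
proof (induction n arbitrary: h C)
  case 0
  have u: "(\<lambda>_. undefined) \<in> space (PiM {0..<0::nat} (\<lambda>_. S))" by (simp add: space_PiM)
  have "IT.C 0 (Suc 0) (\<lambda>_. undefined) = IT.eP 0 (\<lambda>_. undefined)"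
    using bind_return[OF IT.measurable_eP u] by simp
  moreover have "(\<integral>\<omega>. h 0 (\<omega> 0) \<partial>IT.eP 0 (\<lambda>_. undefined)) = h 0 x"
  proof -
    have "(\<integral>\<omega>. h 0 (\<omega> 0) \<partial>IT.eP 0 (\<lambda>_. undefined)) = (\<integral>y. h 0 y \<partial>chain_step S K x 0 (\<lambda>_. undefined))"
      unfolding IT.eP_def
    proof (subst integral_distr)
      show "fun_upd (\<lambda>_. undefined) 0 \<in> chain_step S K x 0 (\<lambda>_. undefined) \<rightarrow>\<^sub>M PiM {0..<Suc 0} (\<lambda>_. S)"
        by (subst measurable_cong_sets[OF IT.sets_P[OF u] refl])
          (rule measurable_fun_upd[where J="{0..<0}"], use u in auto)
      show "(\<lambda>\<omega>. h 0 (\<omega> 0)) \<in> borel_measurable (PiM {0..<Suc 0} (\<lambda>_. S))"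
        by (rule component_compose_measurable[OF 0(1)]) simp
    qed simp
    also have "\<dots> = h 0 x" unfolding chain_step_def using integral_return[OF x 0(1)] by simp
    finally show ?thesis .
  qed
  ultimately show ?case by (simp add: prob_space.prob_space[OF markov_kernelD(1)[OF K x]])
next
  case (Suc n)
  have u: "(\<lambda>_. undefined) \<in> space (PiM {0..<0::nat} (\<lambda>_. S))" by (simp add: space_PiM)
  let ?h = "h(n := \<lambda>y. h n y * (\<integral>z. h (Suc n) z \<partial>K y))"
  let ?D = "IT.C 0 (Suc n) (\<lambda>_. undefined)"
  have spD: "space ?D = space (PiM {0..<Suc n} (\<lambda>_. S))" using IT.space_C[OF u, of "Suc n"] by simp
  have prodm: "(\<lambda>\<omega>. \<Prod>k<m. h k (\<omega> k)) \<in> borel_measurable (PiM {0..<m} (\<lambda>_. S))" for m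
    by (intro borel_measurable_prod component_compose_measurable Suc.prems(1)) auto
  have prodb: "\<bar>\<Prod>k<m. h k (\<omega> k)\<bar> \<le> C ^ m" if "\<omega> \<in> space (PiM {0..<m} (\<lambda>_. S))" for m \<omega>
    using that prod_mono[of "{..<m}" "\<lambda>k. \<bar>h k (\<omega> k)\<bar>" "\<lambda>_. C"] Suc.prems(2)
    by (auto simp: abs_prod space_PiM PiE_iff)
  interpret D: prob_space ?D by (rule IT.prob_space_C[OF u])
  have "(\<integral>\<omega>. (\<Prod>k<Suc (Suc n). h k (\<omega> k)) \<partial>(?D \<bind> IT.eP (Suc n)))
      = (\<integral>\<omega>. (\<integral>\<omega>'. (\<Prod>k<Suc (Suc n). h k (\<omega>' k)) \<partial>IT.eP (Suc n) \<omega>) \<partial>?D)"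
  proof (rule integral_bind[where K="PiM {0..<Suc (Suc n)} (\<lambda>_. S)" and B="C ^ Suc (Suc n)" and B'=1])
    show "IT.eP (Suc n) \<in> ?D \<rightarrow>\<^sub>M subprob_algebra (PiM {0..<Suc (Suc n)} (\<lambda>_. S))"
      unfolding measurable_cong_sets[OF IT.sets_C[OF u, of "Suc n"] refl] by simp
    show "finite_measure ?D" by (rule D.finite_measure_axioms)
    show "AE w in ?D. emeasure (IT.eP (Suc n) w) (space (IT.eP (Suc n) w)) \<le> ennreal 1"
    proof (rule AE_I2)
      fix w assume "w \<in> space ?D"
      then interpret e: prob_space "IT.eP (Suc n) w" using spD by (intro IT.prob_space_eP) simp
      show "emeasure (IT.eP (Suc n) w) (space (IT.eP (Suc n) w)) \<le> ennreal 1"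
        by (simp add: e.emeasure_space_1)
    qed
  qed (rule prodm, erule prodb)
  also have "\<dots> = (\<integral>\<omega>. (\<Prod>k<Suc n. ?h k (\<omega> k)) \<partial>?D)"
  proof (rule Bochner_Integration.integral_cong[OF refl])
    fix \<omega> assume "\<omega> \<in> space ?D"
    then have w: "\<omega> \<in> space (PiM {0..<Suc n} (\<lambda>_. S))" using spD by simp
    have "(\<integral>\<omega>'. (\<Prod>k<Suc (Suc n). h k (\<omega>' k)) \<partial>IT.eP (Suc n) \<omega>)
        = (\<integral>y. (\<Prod>k<Suc (Suc n). h k (fun_upd \<omega> (Suc n) y k)) \<partial>chain_step S K x (Suc n) \<omega>)"
      unfolding IT.eP_def
    proof (subst integral_distr)
      show "fun_upd \<omega> (Suc n) \<in> chain_step S K x (Suc n) \<omega> \<rightarrow>\<^sub>M PiM {0..<Suc (Suc n)} (\<lambda>_. S)"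
        by (subst measurable_cong_sets[OF IT.sets_P[OF w] refl])
          (rule measurable_fun_upd[where J="{0..<Suc n}"], use w in auto)
    qed (rule prodm, rule refl)
    also have "\<dots> = (\<Prod>k<Suc n. h k (\<omega> k)) * (\<integral>y. h (Suc n) y \<partial>K (\<omega> n))"
      by (simp add: chain_step_def)
    also have "\<dots> = (\<Prod>k<Suc n. ?h k (\<omega> k))" by simp
    finally show "(\<integral>\<omega>'. (\<Prod>k<Suc (Suc n). h k (\<omega>' k)) \<partial>IT.eP (Suc n) \<omega>) = (\<Prod>k<Suc n. ?h k (\<omega> k))" .
  qed
  also have "\<dots> = chain_prod K (Suc n) ?h x"
  \<comment> \<open>The merged factor at time n is only bounded by \<open>C * C\<close>, so the
    bound has to vary together with h in the induction.\<close>
  proof (rule Suc.IH[where C="max C (C * C)"])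
    show "?h k \<in> borel_measurable S" for k
      using Suc.prems(1) markov_kernel_integral_measurable[OF K Suc.prems(1)] by auto
    show "\<bar>?h k y\<bar> \<le> max C (C * C)" if "y \<in> space S" for k y
      using Suc.prems(2)[OF that] markov_kernel_integral_le[OF K that Suc.prems(1,2)] Suc.prems(3)
      by (auto simp: abs_mult le_max_iff_disj intro!: mult_mono)
  qed (use Suc.prems(3) in auto)
  also have "\<dots> = chain_prod K (Suc (Suc n)) h x"
    by (rule chain_prod_Suc_last[OF K x, symmetric])
  finally show ?case by simp
qed

lemma integral_chain_law_prod:
  assumes h: "\<And>k. h k \<in> borel_measurable S" and hC: "\<And>k x. x \<in> space S \<Longrightarrow> \<bar>h k x\<bar> \<le> C" and C0: "0 \<le> C"
  shows "(\<integral>\<omega>. (\<Prod>k<n. h k (\<omega> k)) \<partial>chain_law S K x) = chain_prod K n h x"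
proof (cases n)
  case 0
  interpret prob_space "chain_law S K x" by (rule prob_space_chain_law)
  show ?thesis using 0 by (simp add: prob_space)
next
  case (Suc m)
  have "(\<integral>\<omega>. (\<Prod>k<n. h k (\<omega> k)) \<partial>distr (chain_law S K x) (PiM {0..<n} (\<lambda>_. S)) (\<lambda>\<omega>. restrict \<omega> {0..<n}))
      = (\<integral>\<omega>. (\<Prod>k<n. h k (restrict \<omega> {0..<n} k)) \<partial>chain_law S K x)"
  proof (rule integral_distr)
    show "(\<lambda>\<omega>. restrict \<omega> {0..<n}) \<in> chain_law S K x \<rightarrow>\<^sub>M PiM {0..<n} (\<lambda>_. S)"
      by (subst measurable_cong_sets[OF chain_law_sets refl]) (rule measurable_restrict_subset, simp)
    show "(\<lambda>\<omega>. \<Prod>k<n. h k (\<omega> k)) \<in> borel_measurable (PiM {0..<n} (\<lambda>_. S))"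
      by (intro borel_measurable_prod component_compose_measurable h) auto
  qed
  also have "\<dots> = (\<integral>\<omega>. (\<Prod>k<n. h k (\<omega> k)) \<partial>chain_law S K x)" by simp
  finally show ?thesis
    using integral_C_prod[of h, OF h hC C0, of m] unfolding chain_law_restrict Suc by (simp only:)
qed

end

section \<open>The power potential and its second-order expansion\<close>

section \<open>A Lyapunov function\<close>

text \<open>The polynomial is the second-order Taylor polynomial at 1. It lies above the function
  for p >= 1, so a correction is due only for p < 1; there it carries the factor
  \<open>p powr (-1/4)\<close> because the function blows up at 0.\<close>

lemma powr_neg_quarter_le:
  fixes p :: real
  assumes "p > 0"
  shows "p powr (-1/4) \<le> 1 - (p - 1) / 4 + 5 * (p - 1)\<^sup>2 / 32
    + (if p < 1 then 45 / 32 * \<bar>p - 1\<bar> ^ 3 * p powr (-1/4) else 0)"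
proof -
  define r where "r = p powr (1/4)"
  have r0: "r > 0" using assms by (simp add: r_def)
  have p: "p = r ^ 4" using assms by (simp add: r_def powr_realpow[symmetric] powr_powr)
  have i: "p powr (-1/4) = 1 / r" unfolding r_def using powr_minus[of p "1/4"] by (simp add: inverse_eq_divide)
  \<comment> \<open>With p = \<open>r ^ 4\<close> the claim becomes polynomial: the Taylor
    polynomial minus the function, times \<open>32 * r\<close>, is divisible by
    \<open>(r - 1) ^ 3\<close>, and the cofactor g has positive coefficients only.\<close>
  define g where "g = 5*r^6 + 15*r^5 + 30*r^4 + 50*r^3 + 57*r^2 + 51*r + 32"
  have f: "32 * (r * (1 - (p - 1) / 4 + 5 * (p - 1)\<^sup>2 / 32)) - 32 = (r - 1) ^ 3 * g"
  proof -
    have eq: "32 * (r * (1 - (p - 1) / 4 + 5 * (p - 1)\<^sup>2 / 32)) = r * (32 - 8 * (p - 1) + 5 * (p - 1)\<^sup>2)"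
      by (simp add: field_simps)
    show ?thesis unfolding eq unfolding p g_def by algebra
  qed
  show ?thesis
  proof (cases "p < 1")
    case False
    have "r \<ge> 1" using False assms by (simp add: r_def ge_one_powr_ge_zero)
    then have "0 \<le> (r - 1) ^ 3 * g" unfolding g_def by (intro mult_nonneg_nonneg add_nonneg_nonneg) auto
    then have "1 \<le> r * (1 - (p - 1) / 4 + 5 * (p - 1)\<^sup>2 / 32)" using f by linarith
    then show ?thesis using False r0 unfolding i by (simp add: pos_divide_le_eq mult.commute)
  next
    case True
    have "r < 1" using powr_less_mono2[of "1/4" p 1] True assms by (simp add: r_def)
    \<comment> \<open>The cube is the right comparison since
      \<open>(1 - r) * (1 + r + r^2 + r^3) = 1 - p\<close>.\<close>
    have "g \<le> 45 * (1 + r + r^2 + r^3) ^ 3"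
    proof -
      have "45 * (1 + r + r^2 + r^3) ^ 3 - g
        = 45*r^9 + 135*r^8 + 270*r^7 + 445*r^6 + 525*r^5 + 510*r^4 + 400*r^3 + 213*r^2 + 84*r + 13"
        unfolding g_def by algebra
      also have "\<dots> \<ge> 0" using r0 by (intro add_nonneg_nonneg) auto
      finally show ?thesis by simp
    qed
    then have "(1 - r) ^ 3 * g \<le> (1 - r) ^ 3 * (45 * (1 + r + r^2 + r^3) ^ 3)"
      using \<open>r < 1\<close> by (intro mult_left_mono) auto
    also have "\<dots> = 45 * (1 - p) ^ 3" unfolding p by algebra
    also have "\<dots> = 45 * \<bar>p - 1\<bar> ^ 3" using True by simp
    finally have "- ((r - 1) ^ 3 * g) \<le> 45 * \<bar>p - 1\<bar> ^ 3" by (simp add: power3_eq_cube algebra_simps)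
    then have "1 \<le> r * (1 - (p - 1) / 4 + 5 * (p - 1)\<^sup>2 / 32) + 45 / 32 * \<bar>p - 1\<bar> ^ 3" using f by linarith
    then have "1 / r \<le> (r * (1 - (p - 1) / 4 + 5 * (p - 1)\<^sup>2 / 32) + 45 / 32 * \<bar>p - 1\<bar> ^ 3) / r"
      using r0 by (intro divide_right_mono) auto
    also have "\<dots> = 1 - (p - 1) / 4 + 5 * (p - 1)\<^sup>2 / 32 + 45 / 32 * \<bar>p - 1\<bar> ^ 3 * (1 / r)"
      using r0 by (simp add: add_divide_distrib)
    finally show ?thesis using True unfolding i by simp
  qed
qed

text \<open>This is \<open>norm z powr (-1/2)\<close> smoothed at scale \<open>sqrt K\<close>. A
  large K makes the Taylor remainder small against the second-order term everywhere, even at the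
  origin.\<close>

definition pot :: "real \<Rightarrow> 'a::real_normed_vector \<Rightarrow> real" where
  "pot K z = (K + (norm z)\<^sup>2) powr (-1/4)"

lemma pot_pos: "K \<ge> 1 \<Longrightarrow> 0 < pot K z"
  using add_pos_nonneg[of K "(norm z)\<^sup>2"] by (simp add: pot_def)

lemma pot_le_1: "K \<ge> 1 \<Longrightarrow> pot K z \<le> 1"
  unfolding pot_def using powr_mono[of "-1/4" 0 "K + (norm z)\<^sup>2"] zero_le_power2[of "norm z"]
  by (simp add: add_increasing2 add_pos_nonneg del: zero_le_power2)

text \<open>The fourth power of the potential is \<open>1 / (K + (norm z)^2)\<close>, the relative
  size of its mean decrease per step; this fixes the exponent 5 of the drift condition.\<close>

lemma pot_power5:
  assumes "K \<ge> 1"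
  shows "pot K z ^ 5 = pot K z / (K + (norm z)\<^sup>2)"
proof -
  have pos: "K + (norm z)\<^sup>2 > 0" using assms by (simp add: add_pos_nonneg)
  then have "pot K z ^ 4 = (K + (norm z)\<^sup>2) powr (-1)"
    by (simp add: pot_def powr_power)
  then have "pot K z ^ 4 = 1 / (K + (norm z)\<^sup>2)"
    using pos by (simp add: powr_minus_divide)
  then show ?thesis using power_Suc[of "pot K z" 4] by simp
qed

lemma pot_measurable [measurable]: "pot K \<in> borel_measurable (borel :: 'a::real_normed_vector measure)"
  unfolding pot_def by measurable

text \<open>Taylor expansion in the relative change of s. The term in
  \<open>(z \<bullet> v)^2\<close> is kept exactly because it competes with
  \<open>(norm v)^2\<close>. The fourth power of \<open>norm v\<close> in the remainder is the price
  for jumps that bring z close to the origin, where the potential is much larger.\<close>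

lemma pot_step:
  fixes z v :: "'a::real_inner"
  assumes K: "K \<ge> 1"
  defines "s \<equiv> K + (norm z)\<^sup>2"
  shows "pot K (z + v) \<le> pot K z * (1 - (2 * (z \<bullet> v) + (norm v)\<^sup>2) / (4 * s)
    + 5 / 8 * (z \<bullet> v)\<^sup>2 / s\<^sup>2 + 50 * (1 + norm v ^ 4) / (s * sqrt s))"
proof -
  define s' where "s' = K + (norm (z + v))\<^sup>2"
  define a where "a = z \<bullet> v"
  define n where "n = norm v"
  define q where "q = (2 * a + n\<^sup>2) / s"
  define w where "w = sqrt s"
  have n0: "n \<ge> 0" by (simp add: n_def)
  have s1: "s \<ge> 1" and s'1: "s' \<ge> 1" unfolding s_def s'_def using K by (auto intro: add_increasing2)
  have w1: "w \<ge> 1" "s = w\<^sup>2" using s1 by (auto simp: w_def)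
  have w0: "w > 0" using w1 by simp
  have zw: "norm z \<le> w" unfolding w_def s_def using K by (intro real_le_rsqrt) simp
  have a: "\<bar>a\<bar> \<le> w * n" unfolding a_def n_def
    by (rule order_trans[OF Cauchy_Schwarz_ineq2 mult_right_mono[OF zw]]) simp
  have s'eq: "s' = s + (2 * a + n\<^sup>2)" unfolding s'_def s_def a_def n_def
    by (simp add: power2_norm_eq_inner inner_add_left inner_add_right inner_commute)
  have p: "s' / s = 1 + q" unfolding s'eq q_def using s1 by (simp add: add_divide_distrib)
  have p0: "1 + q > 0" unfolding p[symmetric] using s1 s'1 by simp
  have "s * (1 + q) = s'" unfolding p[symmetric] using s1 by simp
  then have "pot K (z + v) = (s * (1 + q)) powr (-1/4)" by (simp add: pot_def s'_def)
  also have "\<dots> = pot K z * (1 + q) powr (-1/4)"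
    using s1 p0 by (subst powr_mult) (auto simp: pot_def s_def)
  finally have eq: "pot K (z + v) = pot K z * (1 + q) powr (-1/4)" .
  have n34: "n ^ 3 \<le> 1 + n ^ 4"
  proof (cases "n \<le> 1")
    case True then show ?thesis using power_le_one[OF n0 True, of 3] zero_le_power[OF n0, of 4] by linarith
  next
    case False then show ?thesis using power_increasing[of 3 4 n] by linarith
  qed
  have q2: "5 * q\<^sup>2 / 32 \<le> 5 / 8 * a\<^sup>2 / s\<^sup>2 + (5 / 8 * n ^ 3 + 5 / 32 * n ^ 4) / (s * w)"
  proof -
    have "q\<^sup>2 = (4 * a\<^sup>2 + 4 * (a * n\<^sup>2) + n ^ 4) / s\<^sup>2"
      unfolding q_def by (simp add: power_divide power2_sum power_mult_distrib flip: power_mult)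
    then have "5 * q\<^sup>2 / 32 = 5 / 8 * a\<^sup>2 / s\<^sup>2 + 5 / 8 * (a * n\<^sup>2 / s\<^sup>2) + 5 / 32 * (n ^ 4 / s\<^sup>2)"
      by (simp add: add_divide_distrib)
    moreover have "a * n\<^sup>2 / s\<^sup>2 \<le> n ^ 3 / (s * w)"
    proof -
      have "a * n\<^sup>2 \<le> w * n * n\<^sup>2" using a n0 by (intro mult_right_mono) auto
      then have "a * n\<^sup>2 / s\<^sup>2 \<le> w * n * n\<^sup>2 / s\<^sup>2" by (intro divide_right_mono) auto
      also have "\<dots> = n ^ 3 / (s * w)" using w0 unfolding w1(2)
        by (simp add: power2_eq_square power3_eq_cube)
      finally show ?thesis .
    qed
    moreover have "n ^ 4 / s\<^sup>2 \<le> n ^ 4 / (s * w)"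
    proof (rule divide_left_mono)
      have "w \<le> s" using w1 by (simp add: power2_eq_square)
      then show "s * w \<le> s\<^sup>2" using s1 by (simp add: power2_eq_square)
    qed (use s1 w0 n0 in auto)
    moreover have "(5 / 8 * n ^ 3 + 5 / 32 * n ^ 4) / (s * w) = 5 / 8 * (n ^ 3 / (s * w)) + 5 / 32 * (n ^ 4 / (s * w))"
      by (simp add: add_divide_distrib)
    ultimately show ?thesis by linarith
  qed
  have q3: "(if 1 + q < 1 then 45 / 32 * \<bar>(1 + q) - 1\<bar> ^ 3 * (1 + q) powr (-1/4) else 0)
      \<le> 45 / 2 * (n ^ 3 + n ^ 4) / (s * w)"
  proof (cases "q < 0")
    case True
    have "\<bar>q\<bar> \<le> 2 * n / w"
    proof -
      have "\<bar>q\<bar> = - (2 * a + n\<^sup>2) / s" using abs_of_neg[OF True] unfolding q_def minus_divide_left .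
      also have "\<dots> \<le> 2 * (w * n) / s"
      proof (rule divide_right_mono)
        show "- (2 * a + n\<^sup>2) \<le> 2 * (w * n)" using a zero_le_power2[of n] by linarith
      qed (use s1 in simp)
      also have "\<dots> = 2 * n / w" using w0 unfolding w1(2) by (simp add: power2_eq_square)
      finally show ?thesis .
    qed
    then have "\<bar>q\<bar> ^ 3 \<le> (2 * n / w) ^ 3" by (intro power_mono) auto
    also have "\<dots> = 8 * n ^ 3 / (s * w)" unfolding w1(2)
      by (simp add: power_divide power_mult_distrib power3_eq_cube power2_eq_square)
    finally have A: "\<bar>q\<bar> ^ 3 \<le> 8 * n ^ 3 / (s * w)" .
    \<comment> \<open>\<open>1 + q\<close> is the ratio of the new to the old value of s. A step of
      length n shrinks s at most by the factor \<open>2 * (1 + n^2)\<close>, so the potential grows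
      by a factor that is at most linear in n.\<close>
    have Q: "(1 + q) powr (-1/4) \<le> 2 * (1 + n)"
    proof -
      have "s \<le> 2 * s' * (1 + n\<^sup>2)"
      proof -
        have "norm z \<le> norm (z + v) + n" using norm_triangle_ineq4[of "z + v" v] by (simp add: n_def)
        then have "(norm z)\<^sup>2 \<le> (norm (z + v) + n)\<^sup>2" by (intro power_mono) auto
        also have "\<dots> \<le> 2 * (norm (z + v))\<^sup>2 + 2 * n\<^sup>2"
          using sum_squares_bound[of "norm (z + v)" n] by (simp add: power2_sum)
        finally have "s \<le> 2 * s' + 2 * n\<^sup>2" unfolding s_def s'_def using K by simp
        also have "\<dots> \<le> 2 * s' + 2 * s' * n\<^sup>2" using s'1 mult_right_mono[of 1 s' "n\<^sup>2"] by simp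
        finally show ?thesis by (simp add: algebra_simps)
      qed
      then have "s / s' \<le> 2 * (1 + n\<^sup>2)" using s'1 by (simp add: pos_divide_le_eq mult_ac)
      also have "\<dots> \<le> (2 * (1 + n)) ^ 4"
      proof -
        have eq: "(2 * (1 + n)) ^ 4 = 16 * n ^ 4 + 64 * n ^ 3 + 96 * n\<^sup>2 + 64 * n + 16" by algebra
        have "0 \<le> n ^ 4" "0 \<le> n ^ 3" "0 \<le> n\<^sup>2" using n0 by auto
        then show ?thesis unfolding eq using n0 by (simp add: algebra_simps)
      qed
      finally have "(s / s') powr (1/4) \<le> ((2 * (1 + n)) ^ 4) powr (1/4)"
        using s1 s'1 by (intro powr_mono2) auto
      also have "\<dots> = 2 * (1 + n)"
      proof -
        have eq: "(2 * (1 + n)) ^ 4 = (2 * (1 + n)) powr 4" using n0 powr_realpow[of "2 * (1 + n)" 4] by simp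
        show ?thesis unfolding eq powr_powr using n0 by simp
      qed
      also have "(s / s') powr (1/4) = (1 + q) powr (-1/4)"
      proof -
        have "s / s' = inverse (1 + q)" unfolding p[symmetric] by simp
        then show ?thesis using p0 powr_minus[of "1 + q" "1/4"] by (simp add: inverse_powr)
      qed
      finally show ?thesis .
    qed
    have "\<bar>q\<bar> ^ 3 * (1 + q) powr (-1/4) \<le> 8 * n ^ 3 / (s * w) * (2 * (1 + n))"
      using A Q n0 order_trans[OF zero_le_power[OF abs_ge_zero[of q]] A] by (intro mult_mono) auto
    also have "\<dots> = 16 * (n ^ 3 + n ^ 4) / (s * w)"
      by (simp add: eval_nat_numeral algebra_simps add_divide_distrib)
    finally have "45 / 32 * (\<bar>q\<bar> ^ 3 * (1 + q) powr (-1/4)) \<le> 45 / 32 * (16 * (n ^ 3 + n ^ 4) / (s * w))"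
      by (rule mult_left_mono) simp
    also have "45 / 32 * (16 * (n ^ 3 + n ^ 4) / (s * w)) = 45 / 2 * (n ^ 3 + n ^ 4) / (s * w)"
      by (simp only: times_divide_eq_right mult.assoc[symmetric])
    finally have "45 / 32 * (\<bar>q\<bar> ^ 3 * (1 + q) powr (-1/4)) \<le> 45 / 2 * (n ^ 3 + n ^ 4) / (s * w)" .
    moreover have "1 + q < 1" "1 + q - 1 = q" using True by simp_all
    ultimately show ?thesis by (simp only: if_True mult.assoc)
  qed (use n0 s1 w0 in auto)
  have "(1 + q) powr (-1/4) \<le> 1 - q / 4 + 5 * q\<^sup>2 / 32
     + (if 1 + q < 1 then 45 / 32 * \<bar>(1 + q) - 1\<bar> ^ 3 * (1 + q) powr (-1/4) else 0)"
    using powr_neg_quarter_le[OF p0] by simp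
  also have "\<dots> \<le> 1 - q / 4 + (5 / 8 * a\<^sup>2 / s\<^sup>2 + (5 / 8 * n ^ 3 + 5 / 32 * n ^ 4) / (s * w))
      + 45 / 2 * (n ^ 3 + n ^ 4) / (s * w)"
    using q2 q3 by linarith
  also have "\<dots> = 1 - q / 4 + 5 / 8 * a\<^sup>2 / s\<^sup>2
      + (5 / 8 * n ^ 3 + 5 / 32 * n ^ 4 + 45 / 2 * (n ^ 3 + n ^ 4)) / (s * w)"
    by (simp add: add_divide_distrib)
  also have "\<dots> \<le> 1 - q / 4 + 5 / 8 * a\<^sup>2 / s\<^sup>2 + 50 * (1 + n ^ 4) / (s * w)"
  proof (intro add_left_mono divide_right_mono)
    \<comment> \<open>With \<open>n ^ 3 \<le> 1 + n ^ 4\<close> the left side is at most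
      \<open>185 / 8 + 1465 / 32 * n ^ 4\<close>, and 50 exceeds both coefficients.\<close>
    show "5 / 8 * n ^ 3 + 5 / 32 * n ^ 4 + 45 / 2 * (n ^ 3 + n ^ 4) \<le> 50 * (1 + n ^ 4)"
    proof -
      have "5 / 8 * A + 5 / 32 * B + 45 / 2 * (A + B) \<le> 50 * (1 + B)" if "A \<le> 1 + B" "0 \<le> B" for A B :: real
        using that by argo
      from this[OF n34 zero_le_power[OF n0]] show ?thesis .
    qed
  qed (use s1 w0 in auto)
  also have "q / 4 = (2 * a + n\<^sup>2) / (4 * s)" by (simp add: q_def)
  finally show ?thesis unfolding eq a_def n_def w_def
    by (intro mult_left_mono) (use pot_pos[OF K, of z] in auto)
qed

lemma norm_powers_integrable:
  fixes \<mu> :: "'a::euclidean_space measure"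
  assumes "prob_space \<mu>" "sets \<mu> = sets borel" "integrable \<mu> (\<lambda>v. norm v ^ 4)"
  shows "integrable \<mu> (\<lambda>v. (norm v)\<^sup>2)" "integrable \<mu> norm" "integrable \<mu> (\<lambda>v. z \<bullet> v)"
    "integrable \<mu> (\<lambda>v. (z \<bullet> v)\<^sup>2)"
proof -
  interpret prob_space \<mu> by fact
  note [measurable_cong] = assms(2)
  show 2: "integrable \<mu> (\<lambda>v. (norm v)\<^sup>2)"
    by (rule square_integrable_imp_integrable) (use assms(3) in \<open>auto simp flip: power_mult\<close>)
  show 1: "integrable \<mu> norm" by (rule square_integrable_imp_integrable) (use 2 in auto)
  show "integrable \<mu> (\<lambda>v. z \<bullet> v)"
    by (rule Bochner_Integration.integrable_bound[OF integrable_mult_right[OF 1, of "norm z"]])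
      (auto simp: Cauchy_Schwarz_ineq2)
  show "integrable \<mu> (\<lambda>v. (z \<bullet> v)\<^sup>2)"
  proof (rule Bochner_Integration.integrable_bound[OF integrable_mult_right[OF 2, of "(norm z)\<^sup>2"]])
    have "norm ((z \<bullet> v)\<^sup>2) \<le> norm ((norm z)\<^sup>2 * (norm v)\<^sup>2)" for v
      using power_mono[OF Cauchy_Schwarz_ineq2[of z v], of 2] by (simp add: power_mult_distrib)
    then show "AE v in \<mu>. norm ((z \<bullet> v)\<^sup>2) \<le> norm ((norm z)\<^sup>2 * (norm v)\<^sup>2)" by simp
  qed measurable
qed

lemma pot_integral_le:
  fixes \<mu> :: "'a::euclidean_space measure" and z :: 'a
  assumes "prob_space \<mu>" "sets \<mu> = sets borel" "integrable \<mu> (\<lambda>v. norm v ^ 4)" and K: "K \<ge> 1"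
    and B: "(\<integral>v. norm v ^ 4 \<partial>\<mu>) \<le> B"
  defines "s \<equiv> K + (norm z)\<^sup>2"
  shows "(\<integral>v. pot K (z + v) \<partial>\<mu>) \<le> pot K z * (1 - (2 * (\<integral>v. z \<bullet> v \<partial>\<mu>) + (\<integral>v. (norm v)\<^sup>2 \<partial>\<mu>)
    - 5 / 2 * (\<integral>v. (z \<bullet> v)\<^sup>2 \<partial>\<mu>) / s - 200 * (1 + B) / sqrt s) / (4 * s))"
proof -
  interpret prob_space \<mu> by fact
  note [measurable_cong] = assms(2)
  note i = norm_powers_integrable[OF assms(1-3)]
  have s: "s > 0" unfolding s_def using K by (simp add: add_pos_nonneg)
  let ?g = "\<lambda>v. pot K z * (1 - (2 * (z \<bullet> v) + (norm v)\<^sup>2) / (4 * s)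
    + 5 / 8 * (z \<bullet> v)\<^sup>2 / s\<^sup>2 + 50 * (1 + norm v ^ 4) / (s * sqrt s))"
  have "(\<integral>v. pot K (z + v) \<partial>\<mu>) \<le> (\<integral>v. ?g v \<partial>\<mu>)"
  proof (rule integral_mono)
    show "integrable \<mu> (\<lambda>v. pot K (z + v))"
      by (rule integrable_const_bound[where B=1]) (simp_all add: abs_of_pos[OF pot_pos[OF K]] pot_le_1[OF K])
    show "integrable \<mu> ?g" using i assms(3) by auto
    show "pot K (z + v) \<le> ?g v" for v using pot_step[OF K, of z v] by (simp add: s_def)
  qed
  also have "(\<integral>v. ?g v \<partial>\<mu>) = pot K z * (1 - (2 * (\<integral>v. z \<bullet> v \<partial>\<mu>) + (\<integral>v. (norm v)\<^sup>2 \<partial>\<mu>)) / (4 * s)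
      + 5 / 8 * (\<integral>v. (z \<bullet> v)\<^sup>2 \<partial>\<mu>) / s\<^sup>2 + 50 * (1 + (\<integral>v. norm v ^ 4 \<partial>\<mu>)) / (s * sqrt s))"
    using i assms(3) by (simp add: prob_space)
  also have "\<dots> \<le> pot K z * (1 - (2 * (\<integral>v. z \<bullet> v \<partial>\<mu>) + (\<integral>v. (norm v)\<^sup>2 \<partial>\<mu>)) / (4 * s)
      + 5 / 8 * (\<integral>v. (z \<bullet> v)\<^sup>2 \<partial>\<mu>) / s\<^sup>2 + 50 * (1 + B) / (s * sqrt s))"
    using B s pot_pos[OF K, of z] by (intro mult_left_mono add_left_mono divide_right_mono) auto
  also have "\<dots> = pot K z * (1 - (2 * (\<integral>v. z \<bullet> v \<partial>\<mu>) + (\<integral>v. (norm v)\<^sup>2 \<partial>\<mu>)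
    - 5 / 2 * (\<integral>v. (z \<bullet> v)\<^sup>2 \<partial>\<mu>) / s - 200 * (1 + B) / sqrt s) / (4 * s))"
  proof -
    have *: "1 - X / (4 * s) + 5 / 8 * Y / s\<^sup>2 + 50 * C / (s * w) = 1 - (X - 5 / 2 * Y / s - 200 * C / w) / (4 * s)"
      if "w > 0" for X Y C w
      using s that by (simp add: diff_divide_distrib power2_eq_square)
    show ?thesis by (subst *) (use s in auto)
  qed
  finally show ?thesis .
qed

text \<open>Up to errors, \<open>4 * s\<close> times the relative decrease is
  \<open>V - 5 / 2 * Y / s\<close>, where V is the second moment of the step and
  \<open>Y \<le> (norm z)^2 * V\<close>. Near the origin \<open>(norm z)^2 / s\<close> is small and
  a lower bound on V suffices. Far away V is nearly 6 or more, with 6 = \<open>2 * d\<close> for d =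
  3, and \<open>Y / s\<close> is nearly 2 or less, so the main term is about
  \<open>6 - 5 = 1\<close>; in lower dimension it would not be positive.\<close>

lemma pot_drift:
  fixes \<mu> :: "'a::euclidean_space measure"
  assumes "prob_space \<mu>" "sets \<mu> = sets borel" "integrable \<mu> (\<lambda>v. norm v ^ 4)" and K: "K \<ge> 1"
    and B: "(\<integral>v. norm v ^ 4 \<partial>\<mu>) \<le> B"
    and drift: "- \<eta> \<le> 2 * (\<integral>v. z \<bullet> v \<partial>\<mu>)"
    and near: "(norm z)\<^sup>2 \<le> K / 5 \<Longrightarrow> 2 * \<kappa> \<le> (\<integral>v. (norm v)\<^sup>2 \<partial>\<mu>)"
    and far: "(norm z)\<^sup>2 > K / 5 \<Longrightarrow> 6 - 1 / 7 \<le> (\<integral>v. (norm v)\<^sup>2 \<partial>\<mu>)"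
       "(norm z)\<^sup>2 > K / 5 \<Longrightarrow> (\<integral>v. (z \<bullet> v)\<^sup>2 \<partial>\<mu>) \<le> (norm z)\<^sup>2 * (2 + 1 / 7)"
    and c: "4 * c + \<eta> + 200 * (1 + B) / sqrt K \<le> \<kappa>" "4 * c + \<eta> + 200 * (1 + B) / sqrt K \<le> 1 / 2"
    and \<kappa>: "0 \<le> \<kappa>"
  shows "(\<integral>v. pot K (z + v) \<partial>\<mu>) \<le> pot K z - c * pot K z ^ 5"
proof -
  interpret prob_space \<mu> by fact
  note i = norm_powers_integrable[OF assms(1-3)]
  define s where "s = K + (norm z)\<^sup>2"
  have s: "s > 0" "K \<le> s" "(norm z)\<^sup>2 \<le> s" unfolding s_def using K by (auto simp: add_pos_nonneg)
  have B0: "0 \<le> B" using B by (rule order_trans[rotated]) simp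
  define V where "V = (\<integral>v. (norm v)\<^sup>2 \<partial>\<mu>)"
  define Y where "Y = (\<integral>v. (z \<bullet> v)\<^sup>2 \<partial>\<mu>)"
  have V0: "0 \<le> V" by (simp add: V_def)
  have YV: "Y \<le> (norm z)\<^sup>2 * V"
  proof -
    have "Y \<le> (\<integral>v. (norm z)\<^sup>2 * (norm v)\<^sup>2 \<partial>\<mu>)" unfolding Y_def
    proof (rule integral_mono)
      show "(z \<bullet> v)\<^sup>2 \<le> (norm z)\<^sup>2 * (norm v)\<^sup>2" for v
        using power_mono[OF Cauchy_Schwarz_ineq2[of z v], of 2] by (simp add: power_mult_distrib)
    qed (use i in auto)
    then show ?thesis by (simp add: V_def)
  qed
  have r: "200 * (1 + B) / sqrt s \<le> 200 * (1 + B) / sqrt K"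
    using s B0 K by (intro divide_left_mono) auto
  have "4 * c \<le> - \<eta> + V - 5 / 2 * Y / s - 200 * (1 + B) / sqrt K"
  \<comment> \<open>The threshold gives \<open>(norm z)^2 / s \<le> 1 / 6\<close>, hence a loss of
    at most \<open>5 / 12 * V\<close>, less than half of V. In the other case
    \<open>41 / 7 - 75 / 14 = 1 / 2\<close>: the tolerance 1/7 for the moments is tuned to the bound
    1/2 in the assumptions.\<close>
  proof (cases "(norm z)\<^sup>2 \<le> K / 5")
    case True
    have "Y / s \<le> (norm z)\<^sup>2 * V / s" using YV s by (intro divide_right_mono) auto
    also have "\<dots> \<le> V / 6"
    proof -
      have "(norm z)\<^sup>2 * 6 \<le> s" using True by (simp add: s_def)
      then have "(norm z)\<^sup>2 * 6 * V \<le> s * V" using V0 by (rule mult_right_mono)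
      then show ?thesis using s by (simp add: pos_divide_le_eq mult_ac)
    qed
    finally have "5 / 2 * Y / s \<le> 5 / 12 * V" by simp
    then show ?thesis using near[OF True] c(1) \<kappa> unfolding V_def[symmetric] by linarith
  next
    case False
    then have "Y / s \<le> (norm z)\<^sup>2 * (2 + 1 / 7) / s" unfolding Y_def using far(2) s by (intro divide_right_mono) auto
    also have "\<dots> \<le> 2 + 1 / 7" using s by (simp add: pos_divide_le_eq mult_right_mono)
    finally have "5 / 2 * Y / s \<le> 75 / 14" by simp
    moreover have "41 / 7 \<le> V" unfolding V_def using far(1) False by simp
    ultimately show ?thesis using c(2) by argo
  qed
  then have "4 * c \<le> 2 * (\<integral>v. z \<bullet> v \<partial>\<mu>) + V - 5 / 2 * Y / s - 200 * (1 + B) / sqrt s"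
    using r drift by linarith
  then have "4 * c / (4 * s) \<le> (2 * (\<integral>v. z \<bullet> v \<partial>\<mu>) + V - 5 / 2 * Y / s - 200 * (1 + B) / sqrt s) / (4 * s)"
    using s by (intro divide_right_mono) auto
  then have "pot K z * (1 - (2 * (\<integral>v. z \<bullet> v \<partial>\<mu>) + V - 5 / 2 * Y / s - 200 * (1 + B) / sqrt s) / (4 * s))
      \<le> pot K z * (1 - c / s)"
    using pot_pos[OF K, of z] by (intro mult_left_mono) auto
  also have "\<dots> = pot K z - c * pot K z ^ 5" unfolding pot_power5[OF K] s_def by (simp add: right_diff_distrib)
  finally show ?thesis
    using pot_integral_le[OF assms(1-3) K B, of z] unfolding V_def Y_def s_def by linarith
qed

section \<open>Green-type bounds and uniform smallness of late contributions\<close>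

section \<open>Tails of multiple sums along a chain with a Lyapunov function\<close>

text \<open>Only c and the bounds on u enter the estimates below, never the details of the kernel,
  so they are uniform over all kernels b_N that share c.\<close>

locale lyapunov_chain =
  fixes S :: "'a measure" and K :: "'a \<Rightarrow> 'a measure" and u :: "'a \<Rightarrow> real" and c :: real
  assumes K: "markov_kernel S K" and u_meas: "u \<in> borel_measurable S"
    and u_pos: "\<And>x. x \<in> space S \<Longrightarrow> 0 < u x" and u_le_1: "\<And>x. x \<in> space S \<Longrightarrow> u x \<le> 1"
    and c_pos: "0 < c" and c_le_1: "c \<le> 1"
    and drift: "\<And>x. x \<in> space S \<Longrightarrow> (\<integral>y. u y \<partial>K x) \<le> u x - c * u x ^ 5"
begin

text \<open>With these factors \<open>chain_prod\<close> is the expected product of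
  \<open>u ^ 5\<close> over the times in A.\<close>

definition wt :: "nat set \<Rightarrow> nat \<Rightarrow> 'a \<Rightarrow> real" where
  "wt A k x = (if k \<in> A then u x ^ 5 else 1)"

text \<open>For \<open>m = 0\<close> the family is empty unless \<open>t = 0\<close>; this makes the recursion below uniform in \<open>m\<close>.\<close>

definition late_sets :: "nat \<Rightarrow> nat \<Rightarrow> nat \<Rightarrow> nat set set" where
  "late_sets m n t = {A. A \<subseteq> {..<n} \<and> card A = m \<and> (t = 0 \<or> (\<exists>j\<in>A. t \<le> j))}"

definition late_sum :: "nat \<Rightarrow> nat \<Rightarrow> nat \<Rightarrow> 'a \<Rightarrow> real" where
  "late_sum m n t x = (\<Sum>A\<in>late_sets m n t. chain_prod K n (wt A) x)"

lemma u_int: "x \<in> space S \<Longrightarrow> integrable (K x) u"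
  by (rule markov_kernel_integrable[OF K _ u_meas, where C=1]) (auto simp: u_le_1 abs_of_pos u_pos)

lemma wt_meas: "wt A k \<in> borel_measurable S"
  unfolding wt_def[abs_def] using u_meas by (cases "k \<in> A") auto

lemma wt_bounds: "x \<in> space S \<Longrightarrow> 0 \<le> wt A k x \<and> wt A k x \<le> 1"
  unfolding wt_def using u_pos[of x] u_le_1[of x] by (auto simp: less_imp_le power_le_one)

lemma wt_abs: "x \<in> space S \<Longrightarrow> \<bar>wt A k x\<bar> \<le> 1"
  using wt_bounds[of x A k] by auto

lemma finite_late_sets: "finite (late_sets m n t)"
  by (rule finite_subset[of _ "Pow {..<n}"]) (auto simp: late_sets_def)

lemma chain_prod_wt_nonneg: "x \<in> space S \<Longrightarrow> 0 \<le> chain_prod K n (wt A) x"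
  by (rule chain_prod_nonneg[OF K]) (use wt_bounds in auto)

lemma chain_prod_wt_int: "x \<in> space S \<Longrightarrow> integrable (K x) (chain_prod K n (wt A))"
  by (rule chain_prod_integrable[OF K wt_meas wt_abs]) auto

lemma late_sum_int: "x \<in> space S \<Longrightarrow> integrable (K x) (late_sum m n t)"
  unfolding late_sum_def[abs_def] by (intro Bochner_Integration.integrable_sum chain_prod_wt_int)

lemma chain_prod_wt_le_1: "x \<in> space S \<Longrightarrow> chain_prod K n (wt A) x \<le> 1"
  using chain_prod_bound[where h="wt A" and n=n, OF K wt_meas wt_abs] by fastforce

lemma late_sets_0: "late_sets 0 n t = (if t = 0 then {{}} else {})"
  by (auto simp: late_sets_def card_eq_0_iff dest: finite_subset)

lemma late_sum_0_le:
  assumes "x \<in> space S"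
  shows "late_sum 0 n t x \<le> (if t = 0 then 1 else 0)"
  using chain_prod_wt_le_1[OF assms] by (simp add: late_sum_def late_sets_0)

lemma late_sum_Suc_0: "late_sum (Suc m) 0 t x = 0"
  by (simp add: late_sum_def late_sets_def)

text \<open>Split by whether time 0 belongs to the set and shift the other times by one. Truncated
  subtraction is right here: for t <= 1 the shifted sets carry no lateness condition. The inclusion
  may then be strict, which is harmless for sums of nonnegative terms.\<close>

lemma late_sets_Suc_subset:
  "late_sets (Suc m) (Suc n) t \<subseteq>
    (\<lambda>A. insert 0 (Suc ` A)) ` late_sets m n (t - 1) \<union> (\<lambda>A. Suc ` A) ` late_sets (Suc m) n (t - 1)"
proof
  fix A assume A: "A \<in> late_sets (Suc m) (Suc n) t"
  define B where "B = {k. Suc k \<in> A}"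
  have AB: "A = (if 0 \<in> A then insert 0 (Suc ` B) else Suc ` B)"
  proof -
    have "Suc ` B = A - {0}"
    proof (rule set_eqI)
      show "k \<in> Suc ` B \<longleftrightarrow> k \<in> A - {0}" for k by (cases k) (auto simp: B_def)
    qed
    then show ?thesis by auto
  qed
  have B: "B \<subseteq> {..<n}" using A by (auto simp: B_def late_sets_def)
  then have fB: "finite B" by (rule finite_subset) simp
  have late: "t - 1 = 0 \<or> (\<exists>j\<in>B. t - 1 \<le> j)"
  proof (cases "t \<le> 1")
    case False
    then obtain j where "j \<in> A" "t \<le> j" using A by (auto simp: late_sets_def)
    moreover then obtain i where "j = Suc i" using False by (cases j) auto
    ultimately show ?thesis by (auto simp: B_def)
  qed simp
  have cA: "card A = Suc m" using A by (simp add: late_sets_def)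
  show "A \<in> (\<lambda>A. insert 0 (Suc ` A)) ` late_sets m n (t - 1) \<union> (\<lambda>A. Suc ` A) ` late_sets (Suc m) n (t - 1)"
  proof (cases "0 \<in> A")
    case True
    then have "A = insert 0 (Suc ` B)" using AB by simp
    moreover then have "card B = m" using cA fB by (simp add: card_image)
    ultimately show ?thesis using B late by (auto simp: late_sets_def)
  next
    case False
    then have "A = Suc ` B" using AB by simp
    moreover then have "card B = Suc m" using cA by (simp add: card_image)
    ultimately show ?thesis using B late by (auto simp: late_sets_def)
  qed
qed

lemma late_sum_Suc_Suc:
  assumes x: "x \<in> space S"
  shows "late_sum (Suc m) (Suc n) t x \<le>
    u x ^ 5 * (\<integral>y. late_sum m n (t - 1) y \<partial>K x) + (\<integral>y. late_sum (Suc m) n (t - 1) y \<partial>K x)"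
proof -
  let ?F = "\<lambda>A. chain_prod K (Suc n) (wt A) x"
  have "(\<lambda>k. wt (insert 0 (Suc ` A)) (Suc k)) = wt A" "(\<lambda>k. wt (Suc ` A) (Suc k)) = wt A" for A
    by (auto simp: wt_def fun_eq_iff)
  then have F: "?F (insert 0 (Suc ` A)) = u x ^ 5 * (\<integral>y. chain_prod K n (wt A) y \<partial>K x)"
    "?F (Suc ` A) = (\<integral>y. chain_prod K n (wt A) y \<partial>K x)" for A
    by (simp_all add: wt_def)
  let ?A = "(\<lambda>A. insert 0 (Suc ` A)) ` late_sets m n (t - 1)"
  let ?B = "(\<lambda>A. Suc ` A) ` late_sets (Suc m) n (t - 1)"
  have F0: "0 \<le> ?F A" for A by (rule chain_prod_wt_nonneg[OF x])
  have inj: "inj_on (\<lambda>A. insert 0 (Suc ` A)) X" "inj_on (\<lambda>A. Suc ` A) X" for X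
    by (auto intro!: inj_onI simp: inj_image_eq_iff dest!: insert_ident[THEN iffD1, rotated -1])
  have "late_sum (Suc m) (Suc n) t x \<le> (\<Sum>A\<in>?A \<union> ?B. ?F A)"
    unfolding late_sum_def using finite_late_sets F0
    by (intro sum_mono2 late_sets_Suc_subset) auto
  also have "\<dots> \<le> (\<Sum>A\<in>?A. ?F A) + (\<Sum>A\<in>?B. ?F A)"
    using finite_late_sets sum_nonneg[of "?A \<inter> ?B" ?F] F0 by (subst sum_Un) auto
  also have "(\<Sum>A\<in>?A. ?F A) = u x ^ 5 * (\<integral>y. late_sum m n (t - 1) y \<partial>K x)"
    unfolding late_sum_def sum.reindex[OF inj(1)]
    by (simp add: F chain_prod_wt_int[OF x] sum_distrib_left del: chain_prod.simps)
  also have "(\<Sum>A\<in>?B. ?F A) = (\<integral>y. late_sum (Suc m) n (t - 1) y \<partial>K x)"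
    unfolding late_sum_def sum.reindex[OF inj(2)]
    by (simp add: F chain_prod_wt_int[OF x] del: chain_prod.simps)
  finally show ?thesis .
qed

lemma integral_le_affine_u:
  assumes x: "x \<in> space S" and f: "integrable (K x) f" and "\<And>y. y \<in> space S \<Longrightarrow> f y \<le> a + b * u y" "0 \<le> b"
  shows "(\<integral>y. f y \<partial>K x) \<le> a + b * (u x - c * u x ^ 5)"
proof -
  interpret prob_space "K x" by (rule markov_kernelD[OF K x])
  have "(\<integral>y. f y \<partial>K x) \<le> (\<integral>y. a + b * u y \<partial>K x)"
    using assms u_int[OF x] markov_kernelD(3)[OF K x] by (intro integral_mono) auto
  also have "\<dots> = a + b * (\<integral>y. u y \<partial>K x)" using u_int[OF x] by (simp add: prob_space)
  also have "\<dots> \<le> a + b * (u x - c * u x ^ 5)" using drift[OF x] assms(4) by (intro add_left_mono mult_left_mono)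
  finally show ?thesis .
qed

text \<open>A Green function bound: u dominates c times the expected sum of \<open>u ^ 5\<close>
  along the chain, and m-fold sums iterate this. In the induction, a visit at time 0 contributes
  \<open>u x ^ 5 * (1 / c) ^ m\<close>, which is exactly what the drift removes from
  \<open>(1 / c) ^ Suc m * u x\<close>.\<close>

lemma late_sum_le:
  assumes "x \<in> space S"
  shows "late_sum m n t x \<le> (1 / c) ^ m" and "late_sum (Suc m) n t x \<le> (1 / c) ^ Suc m * u x"
proof -
  have B: "1 / c \<ge> 1" using c_pos c_le_1 by simp
  have S: "late_sum (Suc m) n t x \<le> (1 / c) ^ Suc m * u x" if "x \<in> space S"
    "\<And>n t x. x \<in> space S \<Longrightarrow> late_sum m n t x \<le> (1 / c) ^ m" for m n t x
    using that(1)
  proof (induction n arbitrary: t x)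
    case 0
    then show ?case using u_pos[OF 0] c_pos by (simp add: late_sum_Suc_0 less_imp_le)
  next
    case (Suc n)
    have "late_sum (Suc m) (Suc n) t x \<le>
      u x ^ 5 * (\<integral>y. late_sum m n (t - 1) y \<partial>K x) + (\<integral>y. late_sum (Suc m) n (t - 1) y \<partial>K x)"
      by (rule late_sum_Suc_Suc[OF Suc.prems])
    also have "\<dots> \<le> u x ^ 5 * ((1 / c) ^ m + 0 * (u x - c * u x ^ 5)) + (0 + (1 / c) ^ Suc m * (u x - c * u x ^ 5))"
      using u_pos[OF Suc.prems] B that(2) Suc.IH c_pos
      by (intro add_mono mult_left_mono integral_le_affine_u late_sum_int Suc.prems) auto
    also have "\<dots> = (1 / c) ^ Suc m * u x" using c_pos by (simp add: field_simps)
    finally show ?case .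
  qed
  have 1: "late_sum m n t x \<le> (1 / c) ^ m" if "x \<in> space S" for m n t x
    using that
  proof (induction m arbitrary: n t x)
    case 0
    then show ?case using late_sum_0_le[OF 0, of n t] by (auto split: if_splits)
  next
    case (Suc m)
    have "late_sum (Suc m) n t x \<le> (1 / c) ^ Suc m * u x" by (rule S[OF Suc.prems Suc.IH])
    also have "\<dots> \<le> (1 / c) ^ Suc m" using u_le_1[OF Suc.prems] B c_pos by (intro mult_left_le) auto
    finally show ?case .
  qed
  show "late_sum m n t x \<le> (1 / c) ^ m" by (rule 1[OF assms])
  show "late_sum (Suc m) n t x \<le> (1 / c) ^ Suc m * u x" by (rule S[OF assms 1])
qed

text \<open>\<open>u ^ 5\<close> lies above an affine function of u that vanishes at \<eta>. This
  linearises the drift into a contraction towards \<eta>; since u can be arbitrarily close to 0, no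
  fixed rate of contraction towards 0 itself is available.\<close>

lemma drift_affine:
  assumes x: "x \<in> space S" and \<eta>: "0 \<le> \<eta>" "\<eta> \<le> 1"
  shows "u x - c * u x ^ 5 \<le> \<eta> + (1 - c * \<eta> ^ 4) * (u x - \<eta>)"
proof -
  have "\<eta> ^ 4 * (u x - \<eta>) \<le> u x ^ 5"
  proof (cases "u x \<le> \<eta>")
    case True
    then have "\<eta> ^ 4 * (u x - \<eta>) \<le> 0" using \<eta> by (intro mult_nonneg_nonpos) auto
    also have "0 \<le> u x ^ 5" using u_pos[OF x] by simp
    finally show ?thesis .
  next
    case False
    then have "\<eta> ^ 4 * (u x - \<eta>) \<le> u x ^ 4 * u x" using \<eta> by (intro mult_mono power_mono) auto
    then show ?thesis by (simp add: eval_nat_numeral mult_ac)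
  qed
  then have "c * (\<eta> ^ 4 * (u x - \<eta>)) \<le> c * u x ^ 5" using c_pos by (intro mult_left_mono) auto
  then show ?thesis by (simp add: algebra_simps)
qed

text \<open>
  The drift gives \<open>E u(X\<^sub>1) - \<eta>1 \<le> \<rho> (u - \<eta>1)\<close> with \<open>\<rho> = 1 - c \<eta>1 ^ 4\<close>, so the potential becomes
  uniformly small; the drift also absorbs the terms produced by the first visited time.
\<close>

lemma late_sum_step:
  assumes \<eta>1: "0 \<le> \<eta>1" "\<eta>1 \<le> 1" and \<eta>: "0 \<le> \<eta>"
    and T: "\<And>t n x. t \<ge> T \<Longrightarrow> x \<in> space S \<Longrightarrow> late_sum m n t x \<le> c * \<eta>"
    and "x \<in> space S"
  defines "\<rho> \<equiv> 1 - c * \<eta>1 ^ 4"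
  shows "late_sum (Suc m) n (Suc (T + k)) x \<le> (1 / c) ^ Suc m * (\<eta>1 + \<rho> ^ k * (u x - \<eta>1)) + \<eta> * u x"
proof -
  define B where "B = (1 / c) ^ Suc m"
  have B0: "B > 0" using c_pos by (simp add: B_def)
  have "c * \<eta>1 ^ 4 \<le> 1 * 1" using c_pos c_le_1 \<eta>1 by (intro mult_mono power_le_one) auto
  then have \<rho>: "0 \<le> \<rho>" "\<rho> \<le> 1" using c_pos \<eta>1 by (auto simp: \<rho>_def)
  have "late_sum (Suc m) n (Suc (T + k)) x \<le> B * (\<eta>1 + \<rho> ^ k * (u x - \<eta>1)) + \<eta> * u x"
    using assms(5)
  proof (induction n arbitrary: k x)
    case 0
    have "\<rho> ^ k \<le> 1" using \<rho> by (intro power_le_one) auto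
    then have "0 \<le> (1 - \<rho> ^ k) * \<eta>1 + \<rho> ^ k * u x" using \<rho> \<eta>1 u_pos[OF 0] by auto
    then have "0 \<le> \<eta>1 + \<rho> ^ k * (u x - \<eta>1)" by (simp add: algebra_simps)
    then have "0 \<le> B * (\<eta>1 + \<rho> ^ k * (u x - \<eta>1))" using B0 by (intro mult_nonneg_nonneg) auto
    then show ?case using u_pos[OF 0] \<eta> by (simp add: late_sum_Suc_0)
  next
    case (Suc n)
    note x = \<open>x \<in> space S\<close>
    show ?case
    proof (cases k)
      \<comment> \<open>For k = 0 the affine term is \<open>u x\<close>, and the bound that ignores
        lateness is enough.\<close>
      case 0
      have "0 \<le> \<eta> * u x" using u_pos[OF x] \<eta> by simp
      then show ?thesis using late_sum_le(2)[OF x, of m "Suc n" "Suc (T + k)"] unfolding 0 B_def by simp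
    next
      case (Suc l)
      have "late_sum (Suc m) (Suc n) (Suc (T + k)) x \<le>
        u x ^ 5 * (\<integral>y. late_sum m n (T + k) y \<partial>K x) + (\<integral>y. late_sum (Suc m) n (Suc (T + l)) y \<partial>K x)"
        using late_sum_Suc_Suc[OF x, of m n "Suc (T + k)"] Suc by simp
      also have "\<dots> \<le> u x ^ 5 * (c * \<eta> + 0 * (u x - c * u x ^ 5)) +
          ((B * \<eta>1 - B * \<rho> ^ l * \<eta>1) + (B * \<rho> ^ l + \<eta>) * (u x - c * u x ^ 5))"
      proof (intro add_mono mult_left_mono integral_le_affine_u late_sum_int x)
        show "late_sum m n (T + k) y \<le> c * \<eta> + 0 * u y" if "y \<in> space S" for y using T[OF _ that] by simp
        show "late_sum (Suc m) n (Suc (T + l)) y \<le> (B * \<eta>1 - B * \<rho> ^ l * \<eta>1) + (B * \<rho> ^ l + \<eta>) * u y"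
          if "y \<in> space S" for y
          using Suc.IH[OF that, of l] by (simp add: algebra_simps)
      qed (use u_pos[OF x] B0 \<rho> \<eta> in auto)
      also have "\<dots> = B * \<eta>1 - B * \<rho> ^ l * \<eta>1 + B * \<rho> ^ l * (u x - c * u x ^ 5) + \<eta> * u x"
        by (simp add: algebra_simps)
      also have "\<dots> \<le> B * \<eta>1 - B * \<rho> ^ l * \<eta>1 + B * \<rho> ^ l * (\<eta>1 + \<rho> * (u x - \<eta>1)) + \<eta> * u x"
        using drift_affine[OF x, of \<eta>1] \<eta>1 B0 \<rho> unfolding \<rho>_def[symmetric]
        by (intro add_right_mono add_left_mono mult_left_mono) auto
      also have "\<dots> = B * (\<eta>1 + \<rho> ^ k * (u x - \<eta>1)) + \<eta> * u x"
        by (simp add: Suc algebra_simps)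
      finally show ?thesis .
    qed
  qed
  then show ?thesis by (simp only: B_def)
qed

end

text \<open>T has to be chosen before the chain, hence the formulation outside the locale. Induction
  on m: if the first visit is early, the later ones still contain a late time and are small by the
  case m; if it is late, the mean of u has contracted to order \<open>\<eta>1\<close> by then, and
  the Green bound applies from there.\<close>

lemma late_sum_uniformly_small:
  assumes c: "0 < c" "c \<le> 1"
  shows "\<eta> > 0 \<Longrightarrow> \<exists>T. \<forall>(S :: 'a measure) K u. lyapunov_chain S K u c \<longrightarrow>
    (\<forall>t\<ge>T. \<forall>n. \<forall>x\<in>space S. lyapunov_chain.late_sum K u m n t x \<le> \<eta>)"
proof (induction m arbitrary: \<eta>)
  case 0
  show ?case
  proof (intro exI[of _ 1] allI ballI impI)
    fix S :: "'a measure" and K u n x and t :: nat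
    assume "lyapunov_chain S K u c" and *: "1 \<le> t" "x \<in> space S"
    then interpret lyapunov_chain S K u c by simp
    show "late_sum 0 n t x \<le> \<eta>" using late_sum_0_le[OF *(2), of n t] * 0 by simp
  qed
next
  case (Suc m)
  define B where "B = (1 / c) ^ Suc m"
  have B0: "B > 0" using c by (simp add: B_def)
  \<comment> \<open>The final bound consists of \<open>B * \<eta>1\<close> twice, each at most
    \<open>\<eta> / 4\<close>, and of \<open>\<eta> / 4 * u x\<close> from the induction
    hypothesis.\<close>
  define \<eta>1 where "\<eta>1 = min 1 (\<eta> / (4 * B))"
  have \<eta>1: "0 < \<eta>1" "\<eta>1 \<le> 1" using Suc.prems B0 by (auto simp: \<eta>1_def)
  have "\<eta>1 \<le> \<eta> / (4 * B)" by (simp add: \<eta>1_def)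
  then have B\<eta>1: "B * \<eta>1 \<le> \<eta> / 4" using B0 by (simp add: field_simps)
  define \<rho> where "\<rho> = 1 - c * \<eta>1 ^ 4"
  have "c * \<eta>1 ^ 4 \<le> 1 * 1" using c \<eta>1 by (intro mult_mono power_le_one) auto
  then have \<rho>: "0 \<le> \<rho>" "\<rho> < 1" using c \<eta>1 by (auto simp: \<rho>_def)
  obtain T where T: "\<And>(S :: 'a measure) K u t n x. lyapunov_chain S K u c \<Longrightarrow> t \<ge> T \<Longrightarrow> x \<in> space S \<Longrightarrow>
      lyapunov_chain.late_sum K u m n t x \<le> c * (\<eta> / 4)"
  proof -
    have "c * (\<eta> / 4) > 0" using Suc.prems c by simp
    from Suc.IH[OF this] show ?thesis using that by meson
  qed
  have "(\<lambda>k. \<rho> ^ k) \<longlonglongrightarrow> 0" using \<rho> by (intro LIMSEQ_realpow_zero) auto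
  then have "\<forall>\<^sub>F k in sequentially. \<rho> ^ k < \<eta>1" using \<eta>1 by (intro order_tendstoD) auto
  then obtain k0 where k0: "\<And>k. k \<ge> k0 \<Longrightarrow> \<rho> ^ k < \<eta>1" by (auto simp: eventually_sequentially)
  show ?case
  proof (intro exI[of _ "Suc (T + k0)"] allI impI ballI)
    fix S :: "'a measure" and K u n x t
    assume l: "lyapunov_chain S K u c" and t: "Suc (T + k0) \<le> t" and x: "x \<in> space S"
    interpret lyapunov_chain S K u c by fact
    define k where "k = t - Suc T"
    have k: "t = Suc (T + k)" "k \<ge> k0" using t by (auto simp: k_def)
    have "\<rho> ^ k * (u x - \<eta>1) \<le> \<rho> ^ k * 1" using \<rho> u_le_1[OF x] \<eta>1 by (intro mult_left_mono) auto
    then have "\<rho> ^ k * (u x - \<eta>1) \<le> \<eta>1" using k0[OF k(2)] by linarith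
    then have "B * (\<eta>1 + \<rho> ^ k * (u x - \<eta>1)) \<le> B * (\<eta>1 + \<eta>1)" using B0 by (intro mult_left_mono) auto
    then have "B * (\<eta>1 + \<rho> ^ k * (u x - \<eta>1)) \<le> \<eta> / 4 + \<eta> / 4" using B\<eta>1 by (simp add: distrib_left)
    moreover have "\<eta> / 4 * u x \<le> \<eta> / 4" using u_le_1[OF x] Suc.prems by (intro mult_left_le) auto
    moreover have "late_sum (Suc m) n t x \<le> B * (\<eta>1 + \<rho> ^ k * (u x - \<eta>1)) + \<eta> / 4 * u x"
      unfolding k(1) B_def \<rho>_def
      by (rule late_sum_step) (use \<eta>1 Suc.prems T[OF l] x in auto)
    ultimately show "late_sum (Suc m) n t x \<le> \<eta>" using Suc.prems by linarith
  qed
qed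

section \<open>The step of the difference, and its reference law for independent steps\<close>

section \<open>Increments of the difference of the two coordinates\<close>

definition dif_increment :: "('a::euclidean_space \<times> 'a \<Rightarrow> ('a \<times> 'a) measure) \<Rightarrow> 'a \<times> 'a \<Rightarrow> 'a measure" where
  "dif_increment b x = distr (b x) borel (\<lambda>y. fst y - snd y - (fst x - snd x))"

text \<open>The step of the difference when both coordinates move independently with law \<nu>,
  whatever their position; chains approach it as the coordinates separate.\<close>

definition dif_law :: "'a::euclidean_space measure \<Rightarrow> 'a measure" where
  "dif_law \<nu> = distr (\<nu> \<Otimes>\<^sub>M \<nu>) borel (\<lambda>u. fst u - snd u)"

lemma fst_snd_measurable_borel_on:
  fixes A :: "('a::euclidean_space \<times> 'a) set"
  shows "fst \<in> borel_on A \<rightarrow>\<^sub>M borel" "snd \<in> borel_on A \<rightarrow>\<^sub>M borel"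
  by (rule measurable_restrict_space1, intro borel_measurable_continuous_onI continuous_intros)+

lemma dif_increment_map_measurable:
  fixes a :: "'a::euclidean_space"
  assumes "sets P = sets (borel_on (I \<times> I))"
  shows "(\<lambda>y. fst y - snd y - a) \<in> P \<rightarrow>\<^sub>M borel"
  by (subst measurable_cong_sets[OF assms refl])
    (intro borel_measurable_diff fst_snd_measurable_borel_on borel_measurable_const)

lemma sets_dif_increment [simp, measurable_cong]: "sets (dif_increment b x) = sets borel"
  by (simp add: dif_increment_def)

lemma sets_dif_law [simp, measurable_cong]: "sets (dif_law \<nu>) = sets borel"
  by (simp add: dif_law_def)

lemma space_borel_on [simp]: "space (borel_on A) = A"
  by (simp add: space_restrict_space)

lemma prob_space_dif_increment:
  assumes "markov_kernel (borel_on (I \<times> I)) b" "x \<in> I \<times> I"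
  shows "prob_space (dif_increment b x)"
  unfolding dif_increment_def
  by (rule prob_space.prob_space_distr) (use markov_kernelD[OF assms(1)] assms(2) in \<open>auto intro!: dif_increment_map_measurable\<close>)

lemma prob_algebra_borel_onD:
  assumes "\<nu> \<in> space (prob_algebra (borel_on I))"
  shows "prob_space \<nu>" "sets \<nu> = sets (borel_on I)" "space \<nu> = I" "(\<lambda>u. u) \<in> \<nu> \<rightarrow>\<^sub>M borel"
proof -
  show 1: "prob_space \<nu>" "sets \<nu> = sets (borel_on I)" using assms by (auto simp: space_prob_algebra)
  show "space \<nu> = I" using sets_eq_imp_space_eq[OF 1(2)] by simp
  show "(\<lambda>u. u) \<in> \<nu> \<rightarrow>\<^sub>M borel"
    by (subst measurable_cong_sets[OF 1(2) refl], rule measurable_restrict_space1) measurable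
qed

lemma fst_snd_measurable_pair:
  fixes \<nu> :: "'a::euclidean_space measure"
  assumes "\<nu> \<in> space (prob_algebra (borel_on I))"
  shows "fst \<in> \<nu> \<Otimes>\<^sub>M \<nu> \<rightarrow>\<^sub>M borel" "snd \<in> \<nu> \<Otimes>\<^sub>M \<nu> \<rightarrow>\<^sub>M borel"
  using measurable_compose[OF measurable_fst prob_algebra_borel_onD(4)[OF assms]]
    measurable_compose[OF measurable_snd prob_algebra_borel_onD(4)[OF assms]] by auto

lemma prob_space_pair:
  assumes "\<nu> \<in> space (prob_algebra (borel_on I))"
  shows "prob_space (\<nu> \<Otimes>\<^sub>M \<nu>)"
proof -
  interpret prob_space \<nu> by (rule prob_algebra_borel_onD[OF assms])
  interpret pair_prob_space \<nu> \<nu> ..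
  show ?thesis by (rule P.prob_space_axioms)
qed

lemma prob_space_dif_law:
  assumes "\<nu> \<in> space (prob_algebra (borel_on I))"
  shows "prob_space (dif_law \<nu>)"
  unfolding dif_law_def
  by (rule prob_space.prob_space_distr[OF prob_space_pair[OF assms]])
    (intro borel_measurable_diff fst_snd_measurable_pair[OF assms])

lemma shift_measurable:
  fixes x :: "'a::euclidean_space \<times> 'a"
  assumes "\<forall>x\<in>I. \<forall>y\<in>I. x + y \<in> I" "\<nu> \<in> space (prob_algebra (borel_on I))" "x \<in> I \<times> I"
  shows "(\<lambda>u. x + u) \<in> \<nu> \<Otimes>\<^sub>M \<nu> \<rightarrow>\<^sub>M borel_on (I \<times> I)"
proof (rule measurable_restrict_space2)
  show "(\<lambda>u. x + u) \<in> space (\<nu> \<Otimes>\<^sub>M \<nu>) \<rightarrow> I \<times> I"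
    using assms by (auto simp: space_pair_measure prob_algebra_borel_onD(3)[OF assms(2)])
  have "(\<lambda>u. (fst x + fst u, snd x + snd u)) \<in> \<nu> \<Otimes>\<^sub>M \<nu> \<rightarrow>\<^sub>M borel"
    by (intro borel_measurable_Pair borel_measurable_add borel_measurable_const fst_snd_measurable_pair[OF assms(2)])
  moreover have "(\<lambda>u. (fst x + fst u, snd x + snd u)) = (\<lambda>u. x + u)" by (auto simp: plus_prod_def)
  ultimately show "(\<lambda>u. x + u) \<in> \<nu> \<Otimes>\<^sub>M \<nu> \<rightarrow>\<^sub>M borel" by simp
qed

lemma tv_dist_dif_increment_le:
  assumes "markov_kernel (borel_on (I \<times> I)) b" "markov_kernel (borel_on (I \<times> I)) b'" "x \<in> I \<times> I"
  shows "tv_dist (dif_increment b x) (dif_increment b' x) \<le> tv_dist (b x) (b' x)"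
  unfolding dif_increment_def using markov_kernelD[OF assms(1)] markov_kernelD[OF assms(2)] assms(3)
  by (intro tv_dist_distr_le dif_increment_map_measurable[of _ I]) auto

text \<open>Total variation does not increase under a measurable map, and the starting point x
  cancels in the image of the shifted product measure.\<close>

lemma tv_dist_dif_law_le:
  assumes I: "\<forall>x\<in>I. \<forall>y\<in>I. x + y \<in> I" and \<nu>: "\<nu> \<in> space (prob_algebra (borel_on I))"
    and b: "markov_kernel (borel_on (I \<times> I)) b" and x: "x \<in> I \<times> I"
  shows "tv_dist (dif_increment b x) (dif_law \<nu>)
    \<le> tv_dist (b x) (distr (\<nu> \<Otimes>\<^sub>M \<nu>) (borel_on (I \<times> I)) (\<lambda>u. x + u))"
proof -
  let ?D = "distr (\<nu> \<Otimes>\<^sub>M \<nu>) (borel_on (I \<times> I)) (\<lambda>u. x + u)"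
  note bx = markov_kernelD[OF b, of x]
  have "tv_dist (dif_increment b x) (distr ?D borel (\<lambda>y. fst y - snd y - (fst x - snd x))) \<le> tv_dist (b x) ?D"
    unfolding dif_increment_def using bx x
    by (intro tv_dist_distr_le dif_increment_map_measurable[of _ I] prob_space.prob_space_distr
        prob_space_pair[OF \<nu>] shift_measurable[OF I \<nu> x]) auto
  also have "distr ?D borel (\<lambda>y. fst y - snd y - (fst x - snd x)) = dif_law \<nu>"
    unfolding dif_law_def
    by (subst distr_distr[OF dif_increment_map_measurable[of _ I] shift_measurable[OF I \<nu> x]])
      (auto simp: comp_def algebra_simps)
  finally show ?thesis .
qed

section \<open>Fourth moments of steps, their transfer to base measures, and covariances\<close>

section \<open>Moments\<close>

lemma power4_le_exp:
  fixes t \<sigma> :: real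
  assumes "\<sigma> > 0" "t \<ge> 0"
  shows "t ^ 4 \<le> 256 / \<sigma> ^ 4 * exp (\<sigma> * t)"
proof -
  have "\<sigma> * t / 4 \<le> exp (\<sigma> * t / 4)" using exp_ge_add_one_self[of "\<sigma> * t / 4"] by linarith
  then have "(\<sigma> * t / 4) ^ 4 \<le> exp (\<sigma> * t / 4) ^ 4" using assms by (intro power_mono) auto
  then have "\<sigma> ^ 4 * t ^ 4 / 256 \<le> exp (\<sigma> * t)"
    by (simp add: power_divide power_mult_distrib flip: exp_of_nat_mult)
  then show ?thesis using assms by (simp add: field_simps)
qed

lemma power4_sum_le:
  fixes a b :: real
  shows "(a + b) ^ 4 \<le> 8 * (a ^ 4 + b ^ 4)"
proof -
  have "8 * (a ^ 4 + b ^ 4) - (a + b) ^ 4 = (a - b)\<^sup>2 * (7 * a\<^sup>2 + 10 * (a * b) + 7 * b\<^sup>2)" by algebra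
  also have "7 * a\<^sup>2 + 10 * (a * b) + 7 * b\<^sup>2 = 5 * (a + b)\<^sup>2 + 2 * a\<^sup>2 + 2 * b\<^sup>2" by algebra
  also have "(a - b)\<^sup>2 * (5 * (a + b)\<^sup>2 + 2 * a\<^sup>2 + 2 * b\<^sup>2) \<ge> 0" by (intro mult_nonneg_nonneg add_nonneg_nonneg) auto
  finally show ?thesis by simp
qed

text \<open>4096 is 2 * 8 * 256: two coordinates, the constant of \<open>power4_sum_le\<close>, and
  the constant of \<open>power4_le_exp\<close>.\<close>

definition moment_bound :: "real \<Rightarrow> real \<Rightarrow> real" where
  "moment_bound \<sigma> M = 1 + 4096 / \<sigma> ^ 4 * M"

lemma dif_increment_moments:
  fixes x :: "'a::euclidean_space \<times> 'a"
  assumes \<sigma>: "\<sigma> > 0" and M: "M > 0" and b: "b \<in> sri_class I \<sigma> M F" and x: "x \<in> I \<times> I"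
  shows "integrable (dif_increment b x) (\<lambda>v. norm v ^ 4)"
    "(\<integral>v. norm v ^ 4 \<partial>dif_increment b x) \<le> moment_bound \<sigma> M"
    "integrable (b x) (\<lambda>y. norm (fst y - fst x) ^ 4)" "integrable (b x) (\<lambda>y. norm (snd y - snd x) ^ 4)"
proof -
  have bk: "markov_kernel (borel_on (I \<times> I)) b" using b by (auto simp: sri_class_def sri_chain_def)
  interpret prob_space "b x" by (rule markov_kernelD[OF bk]) (use x in simp)
  have bs [measurable_cong]: "sets (b x) = sets (borel_on (I \<times> I))" by (rule markov_kernelD[OF bk]) (use x in simp)
  note [measurable] = fst_snd_measurable_borel_on[of "I \<times> I"]
  have E: "(\<integral>\<^sup>+y. ennreal (exp (\<sigma> * norm (fst y - fst x))) \<partial>b x) \<le> ennreal M"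
    "(\<integral>\<^sup>+y. ennreal (exp (\<sigma> * norm (snd y - snd x))) \<partial>b x) \<le> ennreal M"
    using b x by (auto simp: sri_class_def)
  have I: "integrable (b x) (\<lambda>y. exp (\<sigma> * norm (fst y - fst x)))" "integrable (b x) (\<lambda>y. exp (\<sigma> * norm (snd y - snd x)))"
    using E by (auto intro!: integrableI_nonneg order_le_less_trans[OF E(1)] order_le_less_trans[OF E(2)])
  have J: "(\<integral>y. exp (\<sigma> * norm (fst y - fst x)) \<partial>b x) \<le> M" "(\<integral>y. exp (\<sigma> * norm (snd y - snd x)) \<partial>b x) \<le> M"
    using E M nn_integral_eq_integral[OF I(1)] nn_integral_eq_integral[OF I(2)] by auto
  let ?g = "\<lambda>y. 2048 / \<sigma> ^ 4 * exp (\<sigma> * norm (fst y - fst x)) + 2048 / \<sigma> ^ 4 * exp (\<sigma> * norm (snd y - snd x))"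
  have gi: "integrable (b x) ?g" using I by auto
  have pw: "norm (fst y - snd y - (fst x - snd x)) ^ 4 \<le> ?g y" for y
  proof -
    have "norm (fst y - snd y - (fst x - snd x)) \<le> norm (fst y - fst x) + norm (snd y - snd x)"
      using norm_triangle_ineq4[of "fst y - fst x" "snd y - snd x"] by (simp add: algebra_simps)
    then have "norm (fst y - snd y - (fst x - snd x)) ^ 4 \<le> (norm (fst y - fst x) + norm (snd y - snd x)) ^ 4"
      by (intro power_mono) auto
    also have "\<dots> \<le> 8 * (norm (fst y - fst x) ^ 4 + norm (snd y - snd x) ^ 4)" by (rule power4_sum_le)
    also have "\<dots> \<le> 8 * (256 / \<sigma> ^ 4 * exp (\<sigma> * norm (fst y - fst x)) + 256 / \<sigma> ^ 4 * exp (\<sigma> * norm (snd y - snd x)))"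
      using \<sigma> by (intro mult_left_mono add_mono power4_le_exp) auto
    finally show ?thesis by simp
  qed
  have bi: "integrable (b x) (\<lambda>y. norm (fst y - snd y - (fst x - snd x)) ^ 4)"
    by (rule Bochner_Integration.integrable_bound[OF gi]) (use pw in \<open>auto intro!: order_trans[OF pw abs_ge_self]\<close>)
  show "integrable (dif_increment b x) (\<lambda>v. norm v ^ 4)"
    unfolding dif_increment_def by (subst integrable_distr_eq) (use bi in auto)
  have "(\<integral>v. norm v ^ 4 \<partial>dif_increment b x) = (\<integral>y. norm (fst y - snd y - (fst x - snd x)) ^ 4 \<partial>b x)"
    unfolding dif_increment_def by (subst integral_distr) auto
  also have "\<dots> \<le> (\<integral>y. ?g y \<partial>b x)" by (rule integral_mono[OF bi gi pw])
  also have "\<dots> = 2048 / \<sigma> ^ 4 * (\<integral>y. exp (\<sigma> * norm (fst y - fst x)) \<partial>b x)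
      + 2048 / \<sigma> ^ 4 * (\<integral>y. exp (\<sigma> * norm (snd y - snd x)) \<partial>b x)" using I by simp
  also have "\<dots> \<le> 2048 / \<sigma> ^ 4 * M + 2048 / \<sigma> ^ 4 * M"
    using J \<sigma> by (intro add_mono mult_left_mono) auto
  also have "\<dots> \<le> moment_bound \<sigma> M" by (simp add: moment_bound_def)
  finally show "(\<integral>v. norm v ^ 4 \<partial>dif_increment b x) \<le> moment_bound \<sigma> M" .
  have "norm (fst y - fst x) ^ 4 \<le> 256 / \<sigma> ^ 4 * exp (\<sigma> * norm (fst y - fst x))" for y
    using \<sigma> by (intro power4_le_exp) auto
  then show "integrable (b x) (\<lambda>y. norm (fst y - fst x) ^ 4)"
    by (intro Bochner_Integration.integrable_bound[OF integrable_mult_right[OF I(1), of "256 / \<sigma> ^ 4"]])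
      (auto intro: order_trans[OF _ abs_ge_self])
  have "norm (snd y - snd x) ^ 4 \<le> 256 / \<sigma> ^ 4 * exp (\<sigma> * norm (snd y - snd x))" for y
    using \<sigma> by (intro power4_le_exp) auto
  then show "integrable (b x) (\<lambda>y. norm (snd y - snd x) ^ 4)"
    by (intro Bochner_Integration.integrable_bound[OF integrable_mult_right[OF I(2), of "256 / \<sigma> ^ 4"]])
      (auto intro: order_trans[OF _ abs_ge_self])
qed

text \<open>Fourth moments are lower semicontinuous in total variation: truncations are bounded and
  pass to the limit, then monotone convergence removes the truncation. Base measures obtain their
  moments in this way, since the definition of an SRI chain contains no integrability.\<close>

lemma moments_tv_limit:
  fixes \<mu> :: "'a::euclidean_space measure"
  assumes "prob_space \<mu>" "sets \<mu> = sets borel"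
    and approx: "\<And>\<eta>. \<eta> > 0 \<Longrightarrow> \<exists>P. prob_space P \<and> sets P = sets borel \<and> integrable P (\<lambda>v. norm v ^ 4) \<and>
      (\<integral>v. norm v ^ 4 \<partial>P) \<le> B \<and> tv_dist P \<mu> \<le> \<eta>"
  shows "integrable \<mu> (\<lambda>v. norm v ^ 4)" "(\<integral>v. norm v ^ 4 \<partial>\<mu>) \<le> B"
proof -
  interpret prob_space \<mu> by fact
  note [measurable_cong] = assms(2)
  \<comment> \<open>\<open>Suc n\<close> keeps the truncation level positive, as the comparison of
    bounded integrals demands.\<close>
  have trunc: "(\<integral>v. min (real (Suc n)) (norm v ^ 4) \<partial>\<mu>) \<le> B" for n
  proof (rule field_le_epsilon)
    fix e :: real assume "e > 0"
    define L where "L = real (Suc n)"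
    have L: "L > 0" by (simp add: L_def)
    obtain P where P: "prob_space P" "sets P = sets borel" "integrable P (\<lambda>v. norm v ^ 4)"
      "(\<integral>v. norm v ^ 4 \<partial>P) \<le> B" "tv_dist P \<mu> \<le> e / (2 * L)"
      using approx[of "e / (2 * L)"] \<open>e > 0\<close> L by auto
    interpret P: prob_space P by fact
    note [measurable_cong] = P(2)
    have "\<bar>(\<integral>v. min L (norm v ^ 4) \<partial>P) - (\<integral>v. min L (norm v ^ 4) \<partial>\<mu>)\<bar> \<le> 2 * L * tv_dist P \<mu>"
      using L P assms by (intro integral_diff_le_tv_dist) auto
    also have "\<dots> \<le> 2 * L * (e / (2 * L))" using P L by (intro mult_left_mono) auto
    also have "\<dots> = e" using L by simp
    finally have 1: "\<bar>(\<integral>v. min L (norm v ^ 4) \<partial>P) - (\<integral>v. min L (norm v ^ 4) \<partial>\<mu>)\<bar> \<le> e" .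
    have "(\<integral>v. min L (norm v ^ 4) \<partial>P) \<le> (\<integral>v. norm v ^ 4 \<partial>P)"
      by (rule integral_mono[OF P.integrable_const_bound[where B=L] P(3)]) (use L in auto)
    with 1 P(4) show "(\<integral>v. min (real (Suc n)) (norm v ^ 4) \<partial>\<mu>) \<le> B + e" unfolding L_def by linarith
  qed
  have B0: "0 \<le> B" by (rule order_trans[OF _ trunc[of 0]]) simp
  have "(\<integral>\<^sup>+v. ennreal (norm v ^ 4) \<partial>\<mu>) = (\<integral>\<^sup>+v. (SUP n. ennreal (min (real (Suc n)) (norm v ^ 4))) \<partial>\<mu>)"
  proof (rule nn_integral_cong)
    fix v :: 'a
    show "ennreal (norm v ^ 4) = (SUP n. ennreal (min (real (Suc n)) (norm v ^ 4)))"
    proof (rule antisym)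
      obtain n where "norm v ^ 4 \<le> real n" using real_arch_simple by blast
      then have "ennreal (norm v ^ 4) \<le> ennreal (min (real (Suc n)) (norm v ^ 4))" by (intro ennreal_leI) auto
      then show "ennreal (norm v ^ 4) \<le> (SUP n. ennreal (min (real (Suc n)) (norm v ^ 4)))"
        by (rule order_trans[OF _ SUP_upper]) simp
    qed (auto intro!: SUP_least ennreal_leI)
  qed
  also have "\<dots> = (SUP n. \<integral>\<^sup>+v. ennreal (min (real (Suc n)) (norm v ^ 4)) \<partial>\<mu>)"
    by (rule nn_integral_monotone_convergence_SUP) (auto intro!: incseq_SucI le_funI ennreal_leI)
  also have "\<dots> \<le> ennreal B"
  proof (rule SUP_least)
    fix n
    have "(\<integral>\<^sup>+v. ennreal (min (real (Suc n)) (norm v ^ 4)) \<partial>\<mu>) = ennreal (\<integral>v. min (real (Suc n)) (norm v ^ 4) \<partial>\<mu>)"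
      by (rule nn_integral_eq_integral[OF integrable_const_bound[where B="real (Suc n)"]]) auto
    then show "(\<integral>\<^sup>+v. ennreal (min (real (Suc n)) (norm v ^ 4)) \<partial>\<mu>) \<le> ennreal B" using trunc[of n] by (simp add: ennreal_leI)
  qed
  finally have *: "(\<integral>\<^sup>+v. ennreal (norm v ^ 4) \<partial>\<mu>) \<le> ennreal B" .
  show i: "integrable \<mu> (\<lambda>v. norm v ^ 4)"
    by (rule integrableI_nonneg) (use * in \<open>auto intro: order_le_less_trans\<close>)
  show "(\<integral>v. norm v ^ 4 \<partial>\<mu>) \<le> B" using * B0 nn_integral_eq_integral[OF i] by simp
qed

text \<open>Swapping the two independent copies changes the sign. The convention that a non-existing
  integral is 0 agrees with the claim.\<close>

lemma integral_dif_law_inner_eq_0: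
  fixes e :: "'a::euclidean_space"
  assumes \<nu>: "\<nu> \<in> space (prob_algebra (borel_on I))"
  shows "(\<integral>v. e \<bullet> v \<partial>dif_law \<nu>) = 0"
proof -
  interpret prob_space \<nu> by (rule prob_algebra_borel_onD[OF \<nu>])
  interpret pair_prob_space \<nu> \<nu> ..
  note [measurable] = fst_snd_measurable_pair[OF \<nu>]
  have "(\<integral>v. e \<bullet> v \<partial>dif_law \<nu>) = (\<integral>u. e \<bullet> (fst u - snd u) \<partial>(\<nu> \<Otimes>\<^sub>M \<nu>))"
    unfolding dif_law_def by (rule integral_distr) measurable
  also have "\<dots> = (\<integral>u. e \<bullet> (snd u - fst u) \<partial>(\<nu> \<Otimes>\<^sub>M \<nu>))"
    using integral_product_swap[of "\<lambda>u. e \<bullet> (fst u - snd u)"] by (simp add: case_prod_beta')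
  also have "\<dots> = - (\<integral>u. e \<bullet> (fst u - snd u) \<partial>(\<nu> \<Otimes>\<^sub>M \<nu>))"
    unfolding Bochner_Integration.integral_minus[symmetric] by (simp flip: inner_minus_right)
  finally have *: "(\<integral>v. e \<bullet> v \<partial>dif_law \<nu>) = - (\<integral>u. e \<bullet> (fst u - snd u) \<partial>(\<nu> \<Otimes>\<^sub>M \<nu>))" .
  have "(\<integral>v. e \<bullet> v \<partial>dif_law \<nu>) = (\<integral>u. e \<bullet> (fst u - snd u) \<partial>(\<nu> \<Otimes>\<^sub>M \<nu>))"
    unfolding dif_law_def by (rule integral_distr) measurable
  with * show ?thesis by simp
qed

text \<open>The form in which \<open>integral_diff_le_sqrt_tv\<close> is applied. The functions f
  are \<open>norm v\<close>, its square, and a linear form in a direction of norm at most 1 and its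
  square; all have squares below \<open>1 + norm v ^ 4\<close>.\<close>

lemma integral_diff_le_tv_moments:
  fixes P Q :: "'a::euclidean_space measure" and f :: "'a \<Rightarrow> real"
  assumes P: "prob_space P" "sets P = sets borel" "integrable P (\<lambda>v. norm v ^ 4)" "(\<integral>v. norm v ^ 4 \<partial>P) \<le> B"
    and Q: "prob_space Q" "sets Q = sets borel" "integrable Q (\<lambda>v. norm v ^ 4)" "(\<integral>v. norm v ^ 4 \<partial>Q) \<le> B"
    and f: "f \<in> borel_measurable borel" "\<And>v. (f v)\<^sup>2 \<le> 1 + norm v ^ 4" and t: "tv_dist P Q \<le> t"
  shows "\<bar>(\<integral>v. f v \<partial>P) - (\<integral>v. f v \<partial>Q)\<bar> \<le> 2 * (2 + B) * sqrt t"
proof -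
  have *: "integrable R (\<lambda>v. (f v)\<^sup>2) \<and> (\<integral>v. (f v)\<^sup>2 \<partial>R) \<le> 1 + B"
    if R: "prob_space R" "sets R = sets borel" "integrable R (\<lambda>v. norm v ^ 4)" "(\<integral>v. norm v ^ 4 \<partial>R) \<le> B" for R
  proof -
    interpret prob_space R by fact
    have fm: "f \<in> borel_measurable R" using f(1) R(2) by (simp cong: measurable_cong_sets)
    have g: "integrable R (\<lambda>v. 1 + norm v ^ 4)" using R(3) by simp
    have i: "integrable R (\<lambda>v. (f v)\<^sup>2)"
      by (rule Bochner_Integration.integrable_bound[OF g]) (use fm f(2) in \<open>auto intro!: order_trans[OF f(2) abs_ge_self]\<close>)
    have "(\<integral>v. (f v)\<^sup>2 \<partial>R) \<le> (\<integral>v. 1 + norm v ^ 4 \<partial>R)" by (rule integral_mono[OF i g f(2)])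
    also have "\<dots> = 1 + (\<integral>v. norm v ^ 4 \<partial>R)" using R(3) by (simp add: prob_space)
    finally show ?thesis using i R(4) by auto
  qed
  have "f \<in> borel_measurable P" using f(1) P(2) by (simp cong: measurable_cong_sets)
  then have "\<bar>(\<integral>v. f v \<partial>P) - (\<integral>v. f v \<partial>Q)\<bar> \<le> 2 * (1 + (1 + B)) * sqrt t"
    using *[OF P] *[OF Q] P Q t by (intro integral_diff_le_sqrt_tv) auto
  then show ?thesis by simp
qed

lemma square_le_1_power4:
  fixes r :: real
  shows "r\<^sup>2 \<le> 1 + r ^ 4"
proof -
  have "0 \<le> (r\<^sup>2 - 1)\<^sup>2 + r\<^sup>2" by simp
  also have "\<dots> = 1 + r ^ 4 - r\<^sup>2" by algebra
  finally show ?thesis by simp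
qed

lemma inner_bounds:
  fixes e v :: "'a::real_inner"
  assumes "norm e \<le> 1"
  shows "(e \<bullet> v)\<^sup>2 \<le> 1 + norm v ^ 4" "((e \<bullet> v)\<^sup>2)\<^sup>2 \<le> 1 + norm v ^ 4"
proof -
  have "\<bar>e \<bullet> v\<bar> \<le> norm v"
    using Cauchy_Schwarz_ineq2[of e v] mult_right_mono[OF assms, of "norm v"] by simp
  then have 1: "(e \<bullet> v)\<^sup>2 \<le> (norm v)\<^sup>2" using power_mono[of "\<bar>e \<bullet> v\<bar>" "norm v" 2] by simp
  then show "(e \<bullet> v)\<^sup>2 \<le> 1 + norm v ^ 4" using square_le_1_power4[of "norm v"] by linarith
  have "((e \<bullet> v)\<^sup>2)\<^sup>2 \<le> ((norm v)\<^sup>2)\<^sup>2" by (rule power_mono[OF 1]) simp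
  also have "((norm v)\<^sup>2)\<^sup>2 = norm v ^ 4" by (simp flip: power_mult)
  finally show "((e \<bullet> v)\<^sup>2)\<^sup>2 \<le> 1 + norm v ^ 4" by linarith
qed

lemma abs_mult_le_squares: "\<bar>a * b\<bar> \<le> a\<^sup>2 + (b::real)\<^sup>2"
proof -
  have "2 * \<bar>a * b\<bar> \<le> a\<^sup>2 + b\<^sup>2" using sum_squares_bound[of "\<bar>a\<bar>" "\<bar>b\<bar>"] by (simp add: abs_mult)
  moreover have "0 \<le> \<bar>a * b\<bar>" by simp
  ultimately show ?thesis by linarith
qed

text \<open>Independence doubles the variance of the centred projection Y; the mixed term is a
  product of two vanishing means.\<close>

lemma dif_law_covariance:
  fixes \<nu> :: "(real^'n) measure" and e :: "real^'n"
  assumes \<nu>: "\<nu> \<in> space (prob_algebra (borel_on I))" and cov: "covariance_matrix \<nu> = mat 1"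
  shows "integrable (dif_law \<nu>) (\<lambda>v. (e \<bullet> v)\<^sup>2)" "(\<integral>v. (e \<bullet> v)\<^sup>2 \<partial>dif_law \<nu>) = 2 * (norm e)\<^sup>2"
proof -
  interpret prob_space \<nu> by (rule prob_algebra_borel_onD[OF \<nu>])
  interpret P: pair_prob_space \<nu> \<nu> ..
  have id [measurable]: "(\<lambda>u. u) \<in> borel_measurable \<nu>" by (rule prob_algebra_borel_onD[OF \<nu>])
  note [measurable] = fst_snd_measurable_pair[OF \<nu>]
  define X where "X i u = u $ i - (\<integral>v. v $ i \<partial>\<nu>)" for i and u :: "real^'n"
  have [measurable]: "X i \<in> borel_measurable \<nu>" for i
    unfolding X_def by (intro borel_measurable_diff borel_measurable_const measurable_compose[OF id]) simp
  have C: "(\<integral>u. X i u * X j u \<partial>\<nu>) = (if i = j then 1 else 0)" for i j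
  proof -
    have "(\<integral>u. X i u * X j u \<partial>\<nu>) = covariance_matrix \<nu> $ i $ j" by (simp add: covariance_matrix_def X_def)
    then show ?thesis by (simp add: cov mat_def)
  qed
  \<comment> \<open>The diagonal covariances are 1, whereas a non-integrable function has integral
    0. The value of the matrix thus forces square integrability.\<close>
  have X2: "integrable \<nu> (\<lambda>u. (X i u)\<^sup>2)" for i
    using C[of i i] not_integrable_integral_eq[of \<nu> "\<lambda>u. X i u * X i u"] by (auto simp: power2_eq_square)
  have XX: "integrable \<nu> (\<lambda>u. X i u * X j u)" for i j
  proof (rule Bochner_Integration.integrable_bound[OF Bochner_Integration.integrable_add[OF X2[of i] X2[of j]]])
    show "AE u in \<nu>. norm (X i u * X j u) \<le> norm ((X i u)\<^sup>2 + (X j u)\<^sup>2)"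
      using abs_mult_le_squares by (intro AE_I2) simp
  qed measurable
  have Xi: "integrable \<nu> (X i)" for i by (rule square_integrable_imp_integrable[OF _ X2]) measurable
  \<comment> \<open>Integrability of the coordinate is recovered from that of its centred version,
    so the subtracted constant is the true mean.\<close>
  have X0: "(\<integral>u. X i u \<partial>\<nu>) = 0" for i
  proof -
    have "integrable \<nu> (\<lambda>u. u $ i)" using Bochner_Integration.integrable_add[OF Xi[of i] integrable_const[of "\<integral>v. v $ i \<partial>\<nu>"]] by (simp add: X_def)
    then show ?thesis by (simp add: X_def prob_space)
  qed
  define Y where "Y u = (\<Sum>i\<in>UNIV. e $ i * X i u)" for u
  have [measurable]: "Y \<in> borel_measurable \<nu>" unfolding Y_def by measurable
  have Yeq: "Y u = e \<bullet> u - e \<bullet> (\<chi> i. \<integral>v. v $ i \<partial>\<nu>)" for u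
    by (simp add: Y_def X_def inner_vec_def sum_subtractf right_diff_distrib)
  have Y2eq: "(Y u)\<^sup>2 = (\<Sum>i\<in>UNIV. \<Sum>j\<in>UNIV. e $ i * e $ j * (X i u * X j u))" for u
    by (simp add: Y_def power2_eq_square sum_product mult_ac)
  have Y2: "integrable \<nu> (\<lambda>u. (Y u)\<^sup>2)" unfolding Y2eq by (intro Bochner_Integration.integrable_sum integrable_mult_right XX)
  have "(\<integral>u. (Y u)\<^sup>2 \<partial>\<nu>) = (\<Sum>i\<in>UNIV. \<Sum>j\<in>UNIV. e $ i * e $ j * (if i = j then 1 else 0))"
    unfolding Y2eq by (subst Bochner_Integration.integral_sum, intro Bochner_Integration.integrable_sum integrable_mult_right XX)+
      (simp add: XX C)
  also have "\<dots> = (norm e)\<^sup>2"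
    by (simp add: power2_norm_eq_inner inner_vec_def if_distrib cong: if_cong)
  finally have Y2v: "(\<integral>u. (Y u)\<^sup>2 \<partial>\<nu>) = (norm e)\<^sup>2" .
  have Y0: "(\<integral>u. Y u \<partial>\<nu>) = 0" unfolding Y_def by (simp add: Xi X0)
  have dfst: "distr (\<nu> \<Otimes>\<^sub>M \<nu>) \<nu> fst = \<nu>" by (rule distr_pair_fst)
  have dsnd: "distr (\<nu> \<Otimes>\<^sub>M \<nu>) \<nu> snd = \<nu>"
  proof -
    have "distr (\<nu> \<Otimes>\<^sub>M \<nu>) \<nu> snd = distr (distr (\<nu> \<Otimes>\<^sub>M \<nu>) (\<nu> \<Otimes>\<^sub>M \<nu>) (\<lambda>(x, y). (y, x))) \<nu> snd"
      by (simp flip: P.distr_pair_swap)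
    also have "\<dots> = distr (\<nu> \<Otimes>\<^sub>M \<nu>) \<nu> fst" by (subst distr_distr) (auto simp: comp_def case_prod_beta)
    finally show ?thesis using dfst by simp
  qed
  have i1: "integrable (\<nu> \<Otimes>\<^sub>M \<nu>) (\<lambda>u. (Y (fst u))\<^sup>2)" "(\<integral>u. (Y (fst u))\<^sup>2 \<partial>(\<nu> \<Otimes>\<^sub>M \<nu>)) = (norm e)\<^sup>2"
    using integrable_distr_eq[of fst "\<nu> \<Otimes>\<^sub>M \<nu>" \<nu> "\<lambda>u. (Y u)\<^sup>2"] integral_distr[of fst "\<nu> \<Otimes>\<^sub>M \<nu>" \<nu> "\<lambda>u. (Y u)\<^sup>2"]
      Y2 Y2v unfolding dfst by auto
  have i2: "integrable (\<nu> \<Otimes>\<^sub>M \<nu>) (\<lambda>u. (Y (snd u))\<^sup>2)" "(\<integral>u. (Y (snd u))\<^sup>2 \<partial>(\<nu> \<Otimes>\<^sub>M \<nu>)) = (norm e)\<^sup>2"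
    using integrable_distr_eq[of snd "\<nu> \<Otimes>\<^sub>M \<nu>" \<nu> "\<lambda>u. (Y u)\<^sup>2"] integral_distr[of snd "\<nu> \<Otimes>\<^sub>M \<nu>" \<nu> "\<lambda>u. (Y u)\<^sup>2"]
      Y2 Y2v unfolding dsnd by auto
  have i3: "integrable (\<nu> \<Otimes>\<^sub>M \<nu>) (\<lambda>u. Y (fst u) * Y (snd u))"
  proof (rule Bochner_Integration.integrable_bound[OF Bochner_Integration.integrable_add[OF i1(1) i2(1)]])
    show "AE u in \<nu> \<Otimes>\<^sub>M \<nu>. norm (Y (fst u) * Y (snd u)) \<le> norm ((Y (fst u))\<^sup>2 + (Y (snd u))\<^sup>2)"
      using abs_mult_le_squares by (intro AE_I2) simp
  qed measurable
  have i4: "(\<integral>u. Y (fst u) * Y (snd u) \<partial>(\<nu> \<Otimes>\<^sub>M \<nu>)) = 0"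
    using P.integral_fst'[OF i3] by (simp add: Y0)
  have eq: "(e \<bullet> (fst u - snd u))\<^sup>2 = (Y (fst u))\<^sup>2 + (Y (snd u))\<^sup>2 - 2 * (Y (fst u) * Y (snd u))" for u
    unfolding Yeq by (simp add: inner_diff_right power2_eq_square algebra_simps)
  have d: "(\<lambda>u. fst u - snd u) \<in> borel_measurable (\<nu> \<Otimes>\<^sub>M \<nu>)" by measurable
  show "integrable (dif_law \<nu>) (\<lambda>v. (e \<bullet> v)\<^sup>2)"
    unfolding dif_law_def by (subst integrable_distr_eq[OF d]) (use i1 i2 i3 in \<open>auto simp: eq\<close>)
  show "(\<integral>v. (e \<bullet> v)\<^sup>2 \<partial>dif_law \<nu>) = 2 * (norm e)\<^sup>2"
    unfolding dif_law_def by (subst integral_distr[OF d]) (use i1 i2 i3 i4 in \<open>auto simp: eq\<close>)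
qed

lemma dif_law_variance:
  fixes \<nu> :: "(real^'n) measure"
  assumes \<nu>: "\<nu> \<in> space (prob_algebra (borel_on I))" and cov: "covariance_matrix \<nu> = mat 1"
  shows "(\<integral>v. (norm v)\<^sup>2 \<partial>dif_law \<nu>) = 2 * real CARD('n)"
proof -
  have "(norm v)\<^sup>2 = (\<Sum>i\<in>UNIV. (axis i 1 \<bullet> v)\<^sup>2)" for v :: "real^'n"
    unfolding power2_norm_eq_inner inner_vec_def[of v v] by (simp add: inner_axis' power2_eq_square)
  then have "(\<integral>v. (norm v)\<^sup>2 \<partial>dif_law \<nu>) = (\<Sum>i\<in>UNIV. \<integral>v. (axis i 1 \<bullet> v)\<^sup>2 \<partial>dif_law \<nu>)"
    using dif_law_covariance(1)[OF \<nu> cov] by simp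
  then show ?thesis by (simp add: dif_law_covariance(2)[OF \<nu> cov] norm_axis_1)
qed

text \<open>The covariance excludes the trivial group, and the multiples of a nonzero element are
  unbounded. Pairs at arbitrarily large distance are what reveals the base measure of a
  chain.\<close>

lemma subgroup_unbounded:
  fixes \<nu> :: "(real^'n) measure"
  assumes I: "0 \<in> I" "\<forall>x\<in>I. \<forall>y\<in>I. x + y \<in> I"
    and \<nu>: "\<nu> \<in> space (prob_algebra (borel_on I))" and cov: "covariance_matrix \<nu> = mat 1"
  shows "\<exists>z\<in>I. norm z \<ge> R"
proof -
  have "\<exists>a\<in>I. a \<noteq> 0"
  proof (rule ccontr)
    assume "\<not> (\<exists>a\<in>I. a \<noteq> 0)"
    then have I0: "u = 0" if "u \<in> space \<nu>" for u using that prob_algebra_borel_onD(3)[OF \<nu>] by auto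
    have 1: "(\<integral>v. v $ i \<partial>\<nu>) = (\<integral>v. 0 \<partial>\<nu>)" for i
      by (rule Bochner_Integration.integral_cong) (auto dest: I0)
    have "covariance_matrix \<nu> $ i $ i = (\<integral>v. 0 \<partial>\<nu>)" for i
      unfolding covariance_matrix_def vec_lambda_beta
      by (rule Bochner_Integration.integral_cong) (use 1 in \<open>auto dest: I0\<close>)
    then show False using cov by (simp add: mat_def)
  qed
  then obtain a where a: "a \<in> I" "a \<noteq> 0" by blast
  have "real n *\<^sub>R a \<in> I" for n
  proof (induction n)
    case (Suc n)
    have "real (Suc n) *\<^sub>R a = a + real n *\<^sub>R a" by (simp add: algebra_simps)
    then show ?case using Suc a I(2) by metis
  qed (use I in simp)
  moreover obtain n where "R / norm a \<le> real n" using real_arch_simple by blast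
  then have "R \<le> norm (real n *\<^sub>R a)" using a by (simp add: pos_divide_le_eq)
  ultimately show ?thesis by blast
qed

section \<open>The Lyapunov inequality for chains close to a repulsive centered chain\<close>

section \<open>Drift of the potential along SRI chains\<close>

lemma le_1_power4:
  fixes r :: real
  shows "r \<le> 1 + r ^ 4"
proof (cases "r \<le> 1")
  case True
  have "0 \<le> r ^ 4" by simp
  then show ?thesis using True by linarith
next
  case False
  then show ?thesis using power_increasing[of 1 4 r] by simp
qed

text \<open>Both coordinates have the same mean step, so the means cancel in the difference.\<close>

lemma dif_increment_inner_eq_0:
  fixes x :: "'a::euclidean_space \<times> 'a"
  assumes "\<sigma> > 0" "M > 0" and b: "b \<in> sri_class I \<sigma> M F" and "centered I \<nu> b" and x: "x \<in> I \<times> I"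
  shows "(\<integral>v. e \<bullet> v \<partial>dif_increment b x) = 0"
proof -
  have bk: "markov_kernel (borel_on (I \<times> I)) b" using b by (auto simp: sri_class_def sri_chain_def)
  interpret prob_space "b x" by (rule markov_kernelD[OF bk]) (use x in simp)
  have bs [measurable_cong]: "sets (b x) = sets (borel_on (I \<times> I))" by (rule markov_kernelD[OF bk]) (use x in simp)
  note [measurable] = fst_snd_measurable_borel_on[of "I \<times> I"]
  note m = dif_increment_moments(3,4)[OF assms(1,2) b x]
  have i: "integrable (b x) (\<lambda>y. fst y - fst x)" "integrable (b x) (\<lambda>y. snd y - snd x)"
    by (rule Bochner_Integration.integrable_bound[OF Bochner_Integration.integrable_add[OF integrable_const[of 1] m(1)]],
        measurable, use le_1_power4 in simp)
       (rule Bochner_Integration.integrable_bound[OF Bochner_Integration.integrable_add[OF integrable_const[of 1] m(2)]],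
        measurable, use le_1_power4 in simp)
  have "(\<integral>v. e \<bullet> v \<partial>dif_increment b x) = (\<integral>y. e \<bullet> (fst y - snd y - (fst x - snd x)) \<partial>b x)"
    unfolding dif_increment_def by (rule integral_distr) measurable
  also have "\<dots> = (\<integral>y. e \<bullet> (fst y - fst x) - e \<bullet> (snd y - snd x) \<partial>b x)"
    by (simp add: inner_diff_right algebra_simps)
  also have "\<dots> = e \<bullet> (\<integral>y. fst y - fst x \<partial>b x) - e \<bullet> (\<integral>y. snd y - snd x \<partial>b x)"
    using i by (subst Bochner_Integration.integral_diff) auto
  also have "\<dots> = 0" using assms(4) x by (auto simp: centered_def)
  finally show ?thesis .
qed

text \<open>Passing to the unit direction \<open>sgn z\<close> keeps the moment bound independent of
  z; the size of z enters as a linear factor only.\<close>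

lemma integral_inner_le_sqrt_tv:
  fixes P Q :: "'a::euclidean_space measure"
  assumes P: "prob_space P" "sets P = sets borel" "integrable P (\<lambda>v. norm v ^ 4)" "(\<integral>v. norm v ^ 4 \<partial>P) \<le> B"
    and Q: "prob_space Q" "sets Q = sets borel" "integrable Q (\<lambda>v. norm v ^ 4)" "(\<integral>v. norm v ^ 4 \<partial>Q) \<le> B"
    and 0: "(\<integral>v. sgn z \<bullet> v \<partial>Q) = 0" and t: "tv_dist P Q \<le> t"
  shows "\<bar>\<integral>v. z \<bullet> v \<partial>P\<bar> \<le> norm z * (2 * (2 + B) * sqrt t)"
proof -
  have "\<bar>(\<integral>v. sgn z \<bullet> v \<partial>P) - (\<integral>v. sgn z \<bullet> v \<partial>Q)\<bar> \<le> 2 * (2 + B) * sqrt t"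
    by (rule integral_diff_le_tv_moments[OF P Q _ inner_bounds(1) t]) (auto simp: norm_sgn)
  then have "norm z * \<bar>\<integral>v. sgn z \<bullet> v \<partial>P\<bar> \<le> norm z * (2 * (2 + B) * sqrt t)"
    unfolding 0 by (intro mult_left_mono) auto
  moreover have "z \<bullet> v = norm z * (sgn z \<bullet> v)" for v
    by (cases "z = 0") (auto simp: sgn_div_norm)
  ultimately show ?thesis by (simp add: abs_mult)
qed

lemma mult_exp_le:
  fixes a r :: real
  assumes "a > 0"
  shows "r * exp (- a * r / 4) \<le> 4 / a"
proof -
  have "a * r / 4 \<le> exp (a * r / 4)" using exp_ge_add_one_self[of "a * r / 4"] by linarith
  then have "r \<le> 4 / a * exp (a * r / 4)" using assms by (simp add: field_simps)
  then have "r * exp (- a * r / 4) \<le> 4 / a * exp (a * r / 4) * exp (- a * r / 4)" by (intro mult_right_mono) auto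
  then show ?thesis by (simp add: exp_minus mult.assoc)
qed

lemma sri_chain_tv:
  assumes "sri_chain I \<nu> F b" "\<forall>x\<in>I. \<forall>y\<in>I. x + y \<in> I" "x \<in> I \<times> I"
  shows "tv_dist (dif_increment b x) (dif_law \<nu>) \<le> F (norm (fst x - snd x))"
  using assms tv_dist_dif_law_le[of I \<nu> b x] by (force simp: sri_chain_def)

text \<open>
  The drift of the difference vanishes both for \<open>b0\<close>, which is close to \<open>b\<close> everywhere, and for independent steps,
  which are close to those of \<open>b\<close> when the two coordinates are far apart. Interpolating the two estimates makes
  \<open>z \<bullet> E v\<close> small uniformly in \<open>z\<close>.
\<close>

lemma sri_drift:
  fixes I :: "(real^'n) set"
  assumes card: "CARD('n) \<ge> 3" and Iadd: "\<forall>x\<in>I. \<forall>y\<in>I. x + y \<in> I" and \<sigma>: "\<sigma> > 0" and M: "M > 0"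
    and b0: "b0 \<in> sri_class I \<sigma> M F" "centered I \<nu>0 b0" "repulsive I \<delta> b0" "\<delta> > 0"
    and F: "\<And>r. r \<ge> 0 \<Longrightarrow> F r \<le> A * exp (- a * r)" "A > 0" "a > 0"
    and b: "b \<in> sri_class I \<sigma> M F" "sri_chain I \<nu>' F b"
    and \<nu>': "integrable (dif_law \<nu>') (\<lambda>v. norm v ^ 4)" "(\<integral>v. norm v ^ 4 \<partial>dif_law \<nu>') \<le> moment_bound \<sigma> M"
    and \<nu>: "\<nu> \<in> space (prob_algebra (borel_on I))" "covariance_matrix \<nu> = mat 1"
    and \<nu>m: "integrable (dif_law \<nu>) (\<lambda>v. norm v ^ 4)" "(\<integral>v. norm v ^ 4 \<partial>dif_law \<nu>) \<le> moment_bound \<sigma> M"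
    and close: "tv_dist (b x) (b0 x) \<le> \<epsilon>"
    and far: "(norm (fst x - snd x))\<^sup>2 > K / 5 \<Longrightarrow> tv_dist (dif_increment b x) (dif_law \<nu>) \<le> \<tau>"
    and K: "K \<ge> 1" and x: "x \<in> I \<times> I"
  defines "D \<equiv> 2 * (2 + moment_bound \<sigma> M)"
  assumes \<epsilon>: "D * sqrt \<epsilon> \<le> \<delta> / 2" and \<tau>: "D * sqrt \<tau> \<le> 1 / 7"
    and c: "4 * c + 2 * D * sqrt (sqrt \<epsilon>) * sqrt (sqrt A) * (4 / a) + 200 * (1 + moment_bound \<sigma> M) / sqrt K \<le> min (\<delta>\<^sup>2 / 8) (1 / 2)"
  shows "(\<integral>y. pot K (fst y - snd y) \<partial>b x) \<le> pot K (fst x - snd x) - c * pot K (fst x - snd x) ^ 5"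
proof -
  define z where "z = fst x - snd x"
  define P where "P = dif_increment b x"
  define B where "B = moment_bound \<sigma> M"
  have D: "D = 2 * (2 + B)" by (simp add: D_def B_def)
  have B0: "B \<ge> 0" using \<sigma> M by (simp add: B_def moment_bound_def)
  have D0: "D \<ge> 0" using B0 by (simp add: D)
  have bk: "markov_kernel (borel_on (I \<times> I)) b" using b by (auto simp: sri_class_def sri_chain_def)
  have b0k: "markov_kernel (borel_on (I \<times> I)) b0" using b0 by (auto simp: sri_class_def sri_chain_def)
  have bs [measurable_cong]: "sets (b x) = sets (borel_on (I \<times> I))" by (rule markov_kernelD[OF bk]) (use x in simp)
  have b0s: "sets (b0 x) = sets (borel_on (I \<times> I))" by (rule markov_kernelD[OF b0k]) (use x in simp)
  note [measurable] = fst_snd_measurable_borel_on[of "I \<times> I"]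
  have P: "prob_space P" "sets P = sets borel" "integrable P (\<lambda>v. norm v ^ 4)" "(\<integral>v. norm v ^ 4 \<partial>P) \<le> B"
    using prob_space_dif_increment[OF bk x] dif_increment_moments(1,2)[OF \<sigma> M b(1) x] by (auto simp: P_def B_def)
  define P0 where "P0 = dif_increment b0 x"
  have P0: "prob_space P0" "sets P0 = sets borel" "integrable P0 (\<lambda>v. norm v ^ 4)" "(\<integral>v. norm v ^ 4 \<partial>P0) \<le> B"
    using prob_space_dif_increment[OF b0k x] dif_increment_moments(1,2)[OF \<sigma> M b0(1) x] by (auto simp: P0_def B_def)
  have \<nu>'a: "\<nu>' \<in> space (prob_algebra (borel_on I))" using b(2) by (simp add: sri_chain_def)
  have L': "prob_space (dif_law \<nu>')" "sets (dif_law \<nu>') = sets borel"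
    using prob_space_dif_law[OF \<nu>'a] by auto
  have L: "prob_space (dif_law \<nu>)" "sets (dif_law \<nu>) = sets borel"
    using prob_space_dif_law[OF \<nu>(1)] by auto
  have tP0: "tv_dist P P0 \<le> \<epsilon>"
    using tv_dist_dif_increment_le[OF bk b0k x] close by (simp add: P_def P0_def)
  have \<epsilon>0: "0 \<le> \<epsilon>" using tv_dist_nonneg[OF P(1) P0(1)] tP0 by simp
  note mf = integral_diff_le_tv_moments[OF P]
  have near: "2 * (\<delta>\<^sup>2 / 8) \<le> (\<integral>v. (norm v)\<^sup>2 \<partial>P)"
  proof -
    have "\<bar>(\<integral>v. norm v \<partial>P) - (\<integral>v. norm v \<partial>P0)\<bar> \<le> D * sqrt \<epsilon>"
      unfolding D by (rule mf[OF P0 _ square_le_1_power4 tP0]) simp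
    moreover have "\<delta> < (\<integral>v. norm v \<partial>P0)"
    proof -
      interpret prob_space P0 by fact
      have i: "integrable P0 norm" by (rule norm_powers_integrable[OF P0(1-3)])
      have "ennreal \<delta> < (\<integral>\<^sup>+y. ennreal (norm (fst y - snd y - (fst x - snd x))) \<partial>b0 x)"
        using b0(3) x by (auto simp: repulsive_def)
      also have "\<dots> = (\<integral>\<^sup>+v. ennreal (norm v) \<partial>P0)"
        unfolding P0_def dif_increment_def
        by (rule nn_integral_distr[symmetric]) (auto intro: dif_increment_map_measurable[OF b0s])
      also have "\<dots> = ennreal (\<integral>v. norm v \<partial>P0)" by (rule nn_integral_eq_integral[OF i]) simp
      finally show ?thesis using b0(4) by (simp add: ennreal_less_iff)
    qed
    ultimately have "\<delta> / 2 \<le> (\<integral>v. norm v \<partial>P)" using \<epsilon> by linarith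
    \<comment> \<open>Repulsion bounds the first moment under b0, and closeness loses at most half
      of it. Jensen's inequality turns this into \<open>\<delta>^2 / 4\<close> for the second
      moment, the value \<open>2 * (\<delta>^2 / 8)\<close> requested by
      \<open>pot_drift\<close>.\<close>
    then have "(\<delta> / 2)\<^sup>2 \<le> (\<integral>v. norm v \<partial>P)\<^sup>2" using b0(4) by (intro power_mono) auto
    also have "\<dots> \<le> (\<integral>v. (norm v)\<^sup>2 \<partial>P)"
    proof -
      interpret prob_space P by fact
      note n = norm_powers_integrable[OF P(1-3)]
      show ?thesis using variance_eq[OF n(2,1)] variance_positive[of norm] by simp
    qed
    finally show ?thesis by (simp add: power_divide)
  qed
  \<comment> \<open>Far from the origin the step is compared with \<open>dif_law \<nu>\<close>,
    whose covariance is 2 Id: its total variance is twice the dimension, hence at least 6, and its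
    variance in the direction of z is at most 2.\<close>
  have farQ: "6 - 1 / 7 \<le> (\<integral>v. (norm v)\<^sup>2 \<partial>P)" "(\<integral>v. (z \<bullet> v)\<^sup>2 \<partial>P) \<le> (norm z)\<^sup>2 * (2 + 1 / 7)"
    if "(norm z)\<^sup>2 > K / 5"
  proof -
    have t: "tv_dist P (dif_law \<nu>) \<le> \<tau>" using far that by (simp add: P_def z_def)
    have "\<bar>(\<integral>v. (norm v)\<^sup>2 \<partial>P) - (\<integral>v. (norm v)\<^sup>2 \<partial>dif_law \<nu>)\<bar> \<le> D * sqrt \<tau>"
      unfolding D by (rule mf[OF L \<nu>m[folded B_def] _ _ t]) (auto simp flip: power_mult)
    moreover have "6 \<le> (\<integral>v. (norm v)\<^sup>2 \<partial>dif_law \<nu>)" using dif_law_variance[OF \<nu>] card by simp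
    ultimately show "6 - 1 / 7 \<le> (\<integral>v. (norm v)\<^sup>2 \<partial>P)" using \<tau> by linarith
    have "\<bar>(\<integral>v. (sgn z \<bullet> v)\<^sup>2 \<partial>P) - (\<integral>v. (sgn z \<bullet> v)\<^sup>2 \<partial>dif_law \<nu>)\<bar> \<le> D * sqrt \<tau>"
      unfolding D by (rule mf[OF L \<nu>m[folded B_def] _ inner_bounds(2) t]) (auto simp: norm_sgn)
    moreover have "(\<integral>v. (sgn z \<bullet> v)\<^sup>2 \<partial>dif_law \<nu>) \<le> 2"
      unfolding dif_law_covariance(2)[OF \<nu>] by (simp add: norm_sgn)
    ultimately have "(\<integral>v. (sgn z \<bullet> v)\<^sup>2 \<partial>P) \<le> 2 + 1 / 7" using \<tau> by linarith
    then have "(norm z)\<^sup>2 * (\<integral>v. (sgn z \<bullet> v)\<^sup>2 \<partial>P) \<le> (norm z)\<^sup>2 * (2 + 1 / 7)" by (intro mult_left_mono) auto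
    moreover have "z \<bullet> v = norm z * (sgn z \<bullet> v)" for v
      by (cases "z = 0") (auto simp: sgn_div_norm)
    then have "(z \<bullet> v)\<^sup>2 = (norm z)\<^sup>2 * (sgn z \<bullet> v)\<^sup>2" for v by (metis power_mult_distrib)
    ultimately show "(\<integral>v. (z \<bullet> v)\<^sup>2 \<partial>P) \<le> (norm z)\<^sup>2 * (2 + 1 / 7)" by simp
  qed
  define \<eta> where "\<eta> = 2 * D * sqrt (sqrt \<epsilon>) * sqrt (sqrt A) * (4 / a)"
  have drift: "- \<eta> \<le> 2 * (\<integral>v. z \<bullet> v \<partial>P)"
  proof -
    define f where "f = A * exp (- a * norm z)"
    have f0: "0 \<le> f" using F by (simp add: f_def)
    have 1: "\<bar>\<integral>v. z \<bullet> v \<partial>P\<bar> \<le> norm z * (D * sqrt \<epsilon>)"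
      unfolding D by (rule integral_inner_le_sqrt_tv[OF P P0 _ tP0])
        (unfold P0_def, rule dif_increment_inner_eq_0[OF \<sigma> M b0(1,2) x])
    \<comment> \<open>Here \<nu>' is the base measure of b itself, approached at the exponential
      rate of F; \<nu> supplies the covariance.\<close>
    have "tv_dist P (dif_law \<nu>') \<le> f"
      using sri_chain_tv[OF b(2) Iadd x] F(1)[of "norm z"] by (simp add: P_def f_def z_def)
    then have 2: "\<bar>\<integral>v. z \<bullet> v \<partial>P\<bar> \<le> norm z * (D * sqrt f)"
      unfolding D by (intro integral_inner_le_sqrt_tv[OF P L' \<nu>'[folded B_def]] integral_dif_law_inner_eq_0[OF \<nu>'a])
    \<comment> \<open>The smaller of two nonnegative numbers is at most their geometric mean. The
      result keeps a fourth root of \<epsilon> and decays like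
      \<open>exp (- a * norm z / 4)\<close>, which beats the factor \<open>norm z\<close>.\<close>
    have "min (sqrt \<epsilon>) (sqrt f) \<le> sqrt (sqrt \<epsilon> * sqrt f)"
    proof (rule real_le_rsqrt)
      have "min (sqrt \<epsilon>) (sqrt f) * min (sqrt \<epsilon>) (sqrt f) \<le> sqrt \<epsilon> * sqrt f"
        using \<epsilon>0 f0 by (intro mult_mono) auto
      then show "(min (sqrt \<epsilon>) (sqrt f))\<^sup>2 \<le> sqrt \<epsilon> * sqrt f" by (simp add: power2_eq_square)
    qed
    moreover have "\<bar>\<integral>v. z \<bullet> v \<partial>P\<bar> \<le> norm z * (D * min (sqrt \<epsilon>) (sqrt f))"
      using 1 2 by (simp add: min_def)
    ultimately have "\<bar>\<integral>v. z \<bullet> v \<partial>P\<bar> \<le> norm z * (D * sqrt (sqrt \<epsilon> * sqrt f))"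
      using D0 by (meson mult_left_mono norm_ge_zero order_trans)
    also have "sqrt (sqrt f) = sqrt (sqrt A) * exp (- a * norm z / 4)"
    proof -
      have "exp (- a * norm z) = (exp (- a * norm z / 4)) ^ 4" by (simp flip: exp_of_nat_mult)
      also have "\<dots> = ((exp (- a * norm z / 4))\<^sup>2)\<^sup>2" by (simp flip: power_mult)
      finally have eq: "exp (- a * norm z) = ((exp (- a * norm z / 4))\<^sup>2)\<^sup>2" .
      show ?thesis unfolding f_def real_sqrt_mult eq real_sqrt_abs abs_power2 abs_exp_cancel ..
    qed
    then have "norm z * (D * sqrt (sqrt \<epsilon> * sqrt f)) = D * sqrt (sqrt \<epsilon>) * sqrt (sqrt A) * (norm z * exp (- a * norm z / 4))"
      by (simp add: real_sqrt_mult)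
    also have "\<dots> \<le> D * sqrt (sqrt \<epsilon>) * sqrt (sqrt A) * (4 / a)"
      using D0 \<epsilon>0 F mult_exp_le[OF F(3), of "norm z"] by (intro mult_left_mono) auto
    finally show ?thesis unfolding \<eta>_def by (simp add: abs_le_iff)
  qed
  have "(\<integral>v. pot K (z + v) \<partial>P) \<le> pot K z - c * pot K z ^ 5"
    by (rule pot_drift[OF P(1-3) K P(4) drift near farQ]) (use c in \<open>auto simp: \<eta>_def B_def\<close>)
  moreover have "(\<integral>v. pot K (z + v) \<partial>P) = (\<integral>y. pot K (z + (fst y - snd y - (fst x - snd x))) \<partial>b x)"
    unfolding P_def dif_increment_def by (rule integral_distr) (auto intro: dif_increment_map_measurable[OF bs])
  ultimately show ?thesis by (simp add: z_def)
qed

lemma tv_dist_le_d_sri: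
  assumes "markov_kernel (borel_on (I \<times> I)) b" "markov_kernel (borel_on (I \<times> I)) b'" "x \<in> I \<times> I"
  shows "tv_dist (b x) (b' x) \<le> d_sri I b b'"
  unfolding d_sri_def
proof (rule cSUP_upper[OF assms(3)], rule bdd_aboveI2[where M=1])
  fix y assume "y \<in> I \<times> I"
  then show "tv_dist (b y) (b' y) \<le> 1"
    using markov_kernelD[OF assms(1), of y] markov_kernelD[OF assms(2), of y] by (intro tv_dist_le_1) auto
qed

lemma exp_decay_onD:
  assumes "exp_decay_on {0..} F"
  obtains A a where "A > 0" "a > 0" "\<And>r. r \<ge> 0 \<Longrightarrow> F r \<le> A * exp (- a * r)"
proof -
  obtain A c where *: "A > 0" "c > 0" "\<forall>x\<in>{0..}. \<bar>F x\<bar> \<le> A * exp (- c * norm x)"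
    using assms unfolding exp_decay_on_def by blast
  have "F r \<le> A * exp (- c * r)" if "r \<ge> 0" for r
    using *(3) that by (force simp: abs_le_iff)
  then show ?thesis using that * by blast
qed

lemma exp_decay_tendsto_0:
  fixes F :: "real \<Rightarrow> real"
  assumes "a > 0" and F: "\<And>r. r \<ge> 0 \<Longrightarrow> F r \<le> A * exp (- a * r)" and "\<eta> > 0"
  shows "\<exists>R. \<forall>r\<ge>R. F r \<le> \<eta>"
proof -
  have "((\<lambda>r. A * exp (- a * r)) \<longlongrightarrow> A * 0) at_top"
    using assms(1) by (intro tendsto_mult_left filterlim_compose[OF exp_at_bot] filterlim_tendsto_neg_mult_at_bot[OF tendsto_const])
      (auto simp: filterlim_ident)
  then have "\<forall>\<^sub>F r in at_top. A * exp (- a * r) < \<eta>" using \<open>\<eta> > 0\<close> by (auto dest: order_tendstoD(2))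
  then obtain R where R: "\<And>r. r \<ge> R \<Longrightarrow> A * exp (- a * r) < \<eta>" by (auto simp: eventually_at_top_linorder)
  have "F r \<le> \<eta>" if "r \<ge> max 0 R" for r using F[of r] R[of r] that by auto
  then show ?thesis by blast
qed

lemma dif_law_moments:
  fixes I :: "(real^'n) set"
  assumes I0: "0 \<in> I" and Iadd: "\<forall>x\<in>I. \<forall>y\<in>I. x + y \<in> I" and \<sigma>: "\<sigma> > 0" and M: "M > 0"
    and unbounded: "\<And>R. \<exists>z\<in>I. norm z \<ge> R"
    and \<nu>: "\<nu> \<in> space (prob_algebra (borel_on I))"
    and approx: "\<And>\<eta>. \<eta> > 0 \<Longrightarrow> \<exists>b R. b \<in> sri_class I \<sigma> M F \<and>
      (\<forall>x\<in>I \<times> I. norm (fst x - snd x) \<ge> R \<longrightarrow> tv_dist (dif_increment b x) (dif_law \<nu>) \<le> \<eta>)"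
  shows "integrable (dif_law \<nu>) (\<lambda>v. norm v ^ 4)" "(\<integral>v. norm v ^ 4 \<partial>dif_law \<nu>) \<le> moment_bound \<sigma> M"
proof -
  have "\<exists>P. prob_space P \<and> sets P = sets borel \<and> integrable P (\<lambda>v. norm v ^ 4) \<and>
      (\<integral>v. norm v ^ 4 \<partial>P) \<le> moment_bound \<sigma> M \<and> tv_dist P (dif_law \<nu>) \<le> \<eta>" if \<eta>: "\<eta> > 0" for \<eta>
  proof -
    obtain b R where b: "b \<in> sri_class I \<sigma> M F"
      and R: "\<And>x. x \<in> I \<times> I \<Longrightarrow> norm (fst x - snd x) \<ge> R \<Longrightarrow> tv_dist (dif_increment b x) (dif_law \<nu>) \<le> \<eta>"
      using approx[OF \<eta>] by blast
    obtain z where z: "z \<in> I" "norm z \<ge> R" using unbounded by blast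
    have x: "(z, 0) \<in> I \<times> I" using z I0 by simp
    have bk: "markov_kernel (borel_on (I \<times> I)) b" using b by (auto simp: sri_class_def sri_chain_def)
    show ?thesis
      by (rule exI[of _ "dif_increment b (z, 0)"])
        (use prob_space_dif_increment[OF bk x] dif_increment_moments(1,2)[OF \<sigma> M b x] R[OF x] z in auto)
  qed
  from moments_tv_limit[OF prob_space_dif_law[OF \<nu>] sets_dif_law this]
  show "integrable (dif_law \<nu>) (\<lambda>v. norm v ^ 4)" "(\<integral>v. norm v ^ 4 \<partial>dif_law \<nu>) \<le> moment_bound \<sigma> M" by blast+
qed

text \<open>The order of choices matters: \<epsilon> depends on \<delta>, \<sigma>, M and F alone,
  while K needs the distance beyond which b has nearly independent steps and comes after b. This is
  possible because the bound on the residual drift in \<open>sri_drift\<close> is free of K.\<close>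

lemma sri_uniform_drift:
  fixes I :: "(real^'n) set"
  assumes card: "CARD('n) \<ge> 3" and I0: "0 \<in> I" and Iadd: "\<forall>x\<in>I. \<forall>y\<in>I. x + y \<in> I" and \<sigma>: "\<sigma> > 0" and M: "M > 0"
    and F: "exp_decay_on {0..} F"
    and b0: "b0 \<in> sri_class I \<sigma> M F" "centered I \<nu>0 b0" "repulsive I \<delta> b0" "\<delta> > 0"
  shows "\<exists>\<epsilon>>0. \<forall>bN \<nu>N b \<nu> G.
    (\<forall>N. bN N \<in> sri_class I \<sigma> M F \<and> sri_chain I (\<nu>N N) F (bN N)) \<and>
    (G \<longlongrightarrow> 0) at_top \<and> sri_chain I \<nu> G b \<and> (\<lambda>N. d_sri I (bN N) b) \<longlonglongrightarrow> 0 \<and>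
    d_sri I b b0 < \<epsilon> \<and> covariance_matrix \<nu> = mat 1 \<longrightarrow>
    (\<exists>K\<ge>1. \<exists>c>0. c \<le> 1 \<and> (\<forall>\<^sub>F N in sequentially.
      lyapunov_chain (borel_on (I \<times> I)) (bN N) (\<lambda>x. pot K (fst x - snd x)) c))"
proof -
  obtain A a where Aa: "A > 0" "a > 0" "\<And>r. r \<ge> 0 \<Longrightarrow> F r \<le> A * exp (- a * r)"
    using exp_decay_onD[OF F] by metis
  define B where "B = moment_bound \<sigma> M"
  define D where "D = 2 * (2 + B)"
  define m where "m = min (\<delta>\<^sup>2 / 8) (1 / 2)"
  have m: "m > 0" "m \<le> 1" using b0(4) by (auto simp: m_def)
  have B0: "B > 0" using \<sigma> M by (simp add: B_def moment_bound_def add_pos_nonneg)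
  have D0: "D > 0" using B0 by (simp add: D_def)
  \<comment> \<open>The factor 2 arises because b_N is within \<epsilon> of b for large N, and b
    within \<epsilon> of b0.\<close>
  have "((\<lambda>\<epsilon>. D * sqrt (2 * \<epsilon>)) \<longlongrightarrow> D * sqrt (2 * 0)) (at_right 0)"
    by (intro tendsto_intros)
  then have e1: "\<forall>\<^sub>F \<epsilon> in at_right 0. D * sqrt (2 * \<epsilon>) < \<delta> / 2"
    by (rule order_tendstoD(2)) (use b0(4) in simp)
  have "((\<lambda>\<epsilon>. 2 * D * sqrt (sqrt (2 * \<epsilon>)) * sqrt (sqrt A) * (4 / a)) \<longlongrightarrow>
      2 * D * sqrt (sqrt (2 * 0)) * sqrt (sqrt A) * (4 / a)) (at_right 0)"
    by (intro tendsto_intros)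
  then have e2: "\<forall>\<^sub>F \<epsilon> in at_right 0. 2 * D * sqrt (sqrt (2 * \<epsilon>)) * sqrt (sqrt A) * (4 / a) < m / 4"
    by (rule order_tendstoD(2)) (use m in simp)
  have "\<forall>\<^sub>F \<epsilon> in at_right (0::real). \<epsilon> > 0" by (rule eventually_at_right_less)
  from eventually_happens[OF eventually_conj[OF this eventually_conj[OF e1 e2]]]
  obtain \<epsilon> where \<epsilon>: "\<epsilon> > 0" "D * sqrt (2 * \<epsilon>) < \<delta> / 2" "2 * D * sqrt (sqrt (2 * \<epsilon>)) * sqrt (sqrt A) * (4 / a) < m / 4"
    by auto
  show ?thesis
  proof (rule exI[of _ \<epsilon>], intro conjI \<epsilon>(1) allI impI, elim conjE)
    fix bN \<nu>N b \<nu> G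
    assume bN: "\<forall>N. bN N \<in> sri_class I \<sigma> M F \<and> sri_chain I (\<nu>N N) F (bN N)"
      and G: "(G \<longlongrightarrow> 0) at_top" and b: "sri_chain I \<nu> G b" and lim: "(\<lambda>N. d_sri I (bN N) b) \<longlonglongrightarrow> 0"
      and d: "d_sri I b b0 < \<epsilon>" and cov: "covariance_matrix \<nu> = mat 1"
    have \<nu>: "\<nu> \<in> space (prob_algebra (borel_on I))" using b by (simp add: sri_chain_def)
    have \<nu>N: "\<nu>N N \<in> space (prob_algebra (borel_on I))" for N using bN by (simp add: sri_chain_def)
    have kN: "markov_kernel (borel_on (I \<times> I)) (bN N)" for N using bN by (auto simp: sri_chain_def)
    have k: "markov_kernel (borel_on (I \<times> I)) b" using b by (auto simp: sri_chain_def)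
    have k0: "markov_kernel (borel_on (I \<times> I)) b0" using b0 by (auto simp: sri_class_def sri_chain_def)
    note unb = subgroup_unbounded[OF I0 Iadd \<nu> cov]
    have tvN: "tv_dist (bN N x) (b x) \<le> d_sri I (bN N) b" if "x \<in> I \<times> I" for N x
      by (rule tv_dist_le_d_sri[OF kN k that])
    have tv\<nu>: "tv_dist (dif_increment (bN N) x) (dif_law \<nu>) \<le> d_sri I (bN N) b + G (norm (fst x - snd x))"
      if x: "x \<in> I \<times> I" for N x
    proof -
      have "tv_dist (dif_increment (bN N) x) (dif_law \<nu>) \<le>
          tv_dist (dif_increment (bN N) x) (dif_increment b x) + tv_dist (dif_increment b x) (dif_law \<nu>)"
        by (rule tv_dist_triangle) (auto intro: prob_space_dif_increment[OF kN x] prob_space_dif_increment[OF k x] prob_space_dif_law[OF \<nu>])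
      then show ?thesis
        using tv_dist_dif_increment_le[OF kN k x, of N] tvN[OF x, of N] sri_chain_tv[OF b Iadd x] by linarith
    qed
    have G_small: "\<exists>R. \<forall>r\<ge>R. G r \<le> \<eta>" if "\<eta> > 0" for \<eta>
      using order_tendstoD(2)[OF G that] by (auto simp: eventually_at_top_linorder intro: less_imp_le)
    have d_small: "\<forall>\<^sub>F N in sequentially. d_sri I (bN N) b < \<eta>" if "\<eta> > 0" for \<eta>
      by (rule order_tendstoD(2)[OF lim that])
    have mN: "integrable (dif_law (\<nu>N N)) (\<lambda>v. norm v ^ 4) \<and> (\<integral>v. norm v ^ 4 \<partial>dif_law (\<nu>N N)) \<le> moment_bound \<sigma> M" for N
    proof -
      have "\<exists>b R. b \<in> sri_class I \<sigma> M F \<and>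
        (\<forall>x\<in>I \<times> I. norm (fst x - snd x) \<ge> R \<longrightarrow> tv_dist (dif_increment b x) (dif_law (\<nu>N N)) \<le> \<eta>)" if \<eta>: "\<eta> > 0" for \<eta>
      proof -
        obtain R where R: "\<And>r. r \<ge> R \<Longrightarrow> F r \<le> \<eta>" using exp_decay_tendsto_0[OF Aa(2,3) \<eta>] by blast
        have "tv_dist (dif_increment (bN N) x) (dif_law (\<nu>N N)) \<le> \<eta>" if "x \<in> I \<times> I" "norm (fst x - snd x) \<ge> R" for x
          using sri_chain_tv[OF _ Iadd that(1), of "\<nu>N N" F "bN N"] R[OF that(2)] bN by force
        then show ?thesis using bN by blast
      qed
      then show ?thesis using dif_law_moments[OF I0 Iadd \<sigma> M unb \<nu>N, where F=F] by blast
    qed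
    \<comment> \<open>The limit b is not assumed to lie in the moment class, so \<nu> is
      approximated by the steps of some b_N close to b: half of \<eta> for the distance to b, half
      for the separation.\<close>
    have m\<nu>: "integrable (dif_law \<nu>) (\<lambda>v. norm v ^ 4) \<and> (\<integral>v. norm v ^ 4 \<partial>dif_law \<nu>) \<le> moment_bound \<sigma> M"
    proof -
      have "\<exists>b R. b \<in> sri_class I \<sigma> M F \<and>
        (\<forall>x\<in>I \<times> I. norm (fst x - snd x) \<ge> R \<longrightarrow> tv_dist (dif_increment b x) (dif_law \<nu>) \<le> \<eta>)" if \<eta>: "\<eta> > 0" for \<eta>
      proof -
        obtain R where R: "\<And>r. r \<ge> R \<Longrightarrow> G r \<le> \<eta> / 2" using G_small[of "\<eta> / 2"] \<eta> by auto
        obtain N where N: "d_sri I (bN N) b < \<eta> / 2"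
          using eventually_happens[OF d_small[of "\<eta> / 2"]] \<eta> by auto
        have "tv_dist (dif_increment (bN N) x) (dif_law \<nu>) \<le> \<eta>" if "x \<in> I \<times> I" "norm (fst x - snd x) \<ge> R" for x
          using tv\<nu>[OF that(1), of N] R[OF that(2)] N by linarith
        then show ?thesis using bN by blast
      qed
      then show ?thesis using dif_law_moments[OF I0 Iadd \<sigma> M unb \<nu>, where F=F] by blast
    qed
    \<comment> \<open>This makes \<open>D * sqrt \<tau>\<close> equal to 1/7, the tolerance of
      \<open>sri_drift\<close>.\<close>
    define \<tau> where "\<tau> = (1 / (7 * D))\<^sup>2"
    have \<tau>: "\<tau> > 0" "D * sqrt \<tau> \<le> 1 / 7" using D0 by (auto simp: \<tau>_def)
    obtain R where R: "\<And>r. r \<ge> R \<Longrightarrow> G r \<le> \<tau> / 2" using G_small[of "\<tau> / 2"] \<tau> by auto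
    \<comment> \<open>\<open>5 * R^2\<close> ensures that \<open>(norm z)^2 > K / 5\<close> implies
      \<open>norm z \<ge> R\<close>; the last entry brings the Taylor remainder
      \<open>200 * (1 + B) / sqrt K\<close> down to \<open>m / 4\<close>.\<close>
    define K where "K = max 1 (max (5 * R\<^sup>2) ((800 * (1 + B) / m)\<^sup>2))"
    have K: "K \<ge> 1" by (simp add: K_def)
    have K1: "200 * (1 + B) / sqrt K \<le> m / 4"
    proof -
      have "800 * (1 + B) / m \<le> sqrt K" by (rule real_le_rsqrt) (simp add: K_def)
      then show ?thesis using m K by (simp add: field_simps)
    qed
    have K2: "R \<le> r" if "K / 5 < r\<^sup>2" "r \<ge> 0" for r
    proof -
      have "R\<^sup>2 \<le> r\<^sup>2" using that by (simp add: K_def)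
      then show ?thesis using that(2) by (rule power2_le_imp_le)
    qed
    \<comment> \<open>\<open>4 * c\<close>, the residual drift and the Taylor remainder each take at
      most a quarter of m.\<close>
    define c where "c = m / 16"
    have c: "c > 0" "c \<le> 1" using m by (auto simp: c_def)
    have cc: "4 * c + 2 * D * sqrt (sqrt (2 * \<epsilon>)) * sqrt (sqrt A) * (4 / a) + 200 * (1 + B) / sqrt K \<le> min (\<delta>\<^sup>2 / 8) (1 / 2)"
      using \<epsilon>(3) K1 m unfolding m_def[symmetric] c_def by linarith
    have "\<forall>\<^sub>F N in sequentially. lyapunov_chain (borel_on (I \<times> I)) (bN N) (\<lambda>x. pot K (fst x - snd x)) c"
      using eventually_conj[OF d_small[of "\<tau> / 2"] d_small[OF \<epsilon>(1)]] \<tau>(1)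
    proof (simp, elim eventually_mono)
      fix N assume N: "d_sri I (bN N) b * 2 < \<tau> \<and> d_sri I (bN N) b < \<epsilon>"
      show "lyapunov_chain (borel_on (I \<times> I)) (bN N) (\<lambda>x. pot K (fst x - snd x)) c"
      proof
        show "markov_kernel (borel_on (I \<times> I)) (bN N)" by (rule kN)
        show "(\<lambda>x. pot K (fst x - snd x)) \<in> borel_measurable (borel_on (I \<times> I))"
          by (rule measurable_compose[OF borel_measurable_diff[OF fst_snd_measurable_borel_on] pot_measurable])
        fix x assume "x \<in> space (borel_on (I \<times> I))"
        then have x: "x \<in> I \<times> I" by simp
        show "(\<integral>y. pot K (fst y - snd y) \<partial>bN N x) \<le> pot K (fst x - snd x) - c * pot K (fst x - snd x) ^ 5"
        proof (rule sri_drift[where F=F and \<nu>'="\<nu>N N" and \<nu>=\<nu> and A=A and a=a and \<epsilon>="2 * \<epsilon>" and \<tau>=\<tau>, OF card Iadd \<sigma> M b0 Aa(3,1,2)])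
          have "tv_dist (bN N x) (b0 x) \<le> tv_dist (bN N x) (b x) + tv_dist (b x) (b0 x)"
            using markov_kernelD[OF kN, of x N] markov_kernelD[OF k, of x] markov_kernelD[OF k0, of x] x
            by (intro tv_dist_triangle) auto
          then show "tv_dist (bN N x) (b0 x) \<le> 2 * \<epsilon>"
            using tvN[OF x, of N] tv_dist_le_d_sri[OF k k0 x] N d by linarith
          show "tv_dist (dif_increment (bN N) x) (dif_law \<nu>) \<le> \<tau>" if "K / 5 < (norm (fst x - snd x))\<^sup>2"
            using tv\<nu>[OF x, of N] R[OF K2[OF that norm_ge_zero]] N by linarith
        qed (use bN mN m\<nu> \<nu> cov K x \<epsilon>(2) \<tau> cc in \<open>auto simp: D_def B_def\<close>)
      qed (use K c pot_pos[OF K] pot_le_1[OF K] in auto)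
    qed
    then show "\<exists>K\<ge>1. \<exists>c>0. c \<le> 1 \<and> (\<forall>\<^sub>F N in sequentially.
        lyapunov_chain (borel_on (I \<times> I)) (bN N) (\<lambda>x. pot K (fst x - snd x)) c)"
      using K c by blast
  qed
qed

section \<open>Reduction to the difference chain and stability of its path functionals\<close>

section \<open>The difference chain\<close>

lemma dif_map_measurable:
  assumes "\<forall>x\<in>I. \<forall>y\<in>I. x + y \<in> I" "\<forall>x\<in>I. - x \<in> I"
  shows "(\<lambda>y. fst y - snd y) \<in> borel_on (I \<times> I) \<rightarrow>\<^sub>M borel_on (I :: 'a::euclidean_space set)"
proof (rule measurable_restrict_space2)
  show "(\<lambda>y. fst y - snd y) \<in> space (borel_on (I \<times> I)) \<rightarrow> I"
    using assms by (force simp: diff_conv_add_uminus simp del: add_uminus_conv_diff)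
  show "(\<lambda>y. fst y - snd y) \<in> borel_on (I \<times> I) \<rightarrow>\<^sub>M borel"
    by (intro borel_measurable_diff fst_snd_measurable_borel_on)
qed

lemma markov_kernel_dif_kernel:
  fixes I :: "'a::euclidean_space set"
  assumes I: "0 \<in> I" "\<forall>x\<in>I. \<forall>y\<in>I. x + y \<in> I" "\<forall>x\<in>I. - x \<in> I" and b: "markov_kernel (borel_on (I \<times> I)) b"
  shows "markov_kernel (borel_on I) (dif_kernel I b)"
proof -
  have "(\<lambda>x. (x, 0)) \<in> borel_on I \<rightarrow>\<^sub>M borel_on (I \<times> I)"
  proof (rule measurable_restrict_space2)
    show "(\<lambda>x. (x, 0)) \<in> borel_on I \<rightarrow>\<^sub>M borel"
      by (rule measurable_restrict_space1) (intro borel_measurable_continuous_onI continuous_intros)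
  qed (use I in auto)
  from measurable_compose[OF measurable_compose[OF this b] measurable_distr_prob_space[OF dif_map_measurable[OF I(2,3)]]]
  show ?thesis unfolding dif_kernel_def[abs_def] .
qed

text \<open>A diagonal shift brings the starting point to the form \<open>(z, 0)\<close>, and
  preimages of sets under the difference map are invariant under this shift.\<close>

lemma distr_dif_eq_dif_kernel:
  fixes I :: "'a::euclidean_space set"
  assumes I: "0 \<in> I" "\<forall>x\<in>I. \<forall>y\<in>I. x + y \<in> I" "\<forall>x\<in>I. - x \<in> I" and b: "markov_kernel (borel_on (I \<times> I)) b"
    and inv: "diag_trans_inv I b" and x: "x \<in> I \<times> I"
  shows "distr (b x) (borel_on I) (\<lambda>y. fst y - snd y) = dif_kernel I b (fst x - snd x)"
proof (rule measure_eqI)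
  define z where "z = fst x - snd x"
  have sub: "p - q \<in> I" if "p \<in> I" "q \<in> I" for p q
    using I that by (metis add_uminus_conv_diff)
  have z0: "(z, 0) \<in> I \<times> I" using x sub I by (auto simp: z_def)
  fix A assume "A \<in> sets (distr (b x) (borel_on I) (\<lambda>y. fst y - snd y))"
  then have A: "A \<in> sets (borel_on I)" by simp
  define D where "D = (\<lambda>y. fst y - snd y) -` A \<inter> I \<times> I"
  note m = dif_map_measurable[OF I(2,3)]
  have D: "D \<in> sets (borel_on (I \<times> I))" using measurable_sets[OF m A] by (simp add: D_def)
  define s where "s = snd x"
  have s: "s \<in> I" using x by (auto simp: s_def)
  have "(\<lambda>w. w + (s, s)) ` D = D"
  proof
    show "(\<lambda>w. w + (s, s)) ` D \<subseteq> D" using I s by (auto simp: D_def)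
    show "D \<subseteq> (\<lambda>w. w + (s, s)) ` D"
    proof
      fix w assume "w \<in> D"
      then have "w - (s, s) \<in> D" using sub s by (auto simp: D_def)
      moreover have "w = (w - (s, s)) + (s, s)" by simp
      ultimately show "w \<in> (\<lambda>w. w + (s, s)) ` D" by (rule rev_image_eqI)
    qed
  qed
  moreover have "emeasure (b ((z, 0) + (s, s))) ((\<lambda>w. w + (s, s)) ` D) = emeasure (b (z, 0)) D"
    using inv z0 s D unfolding diag_trans_inv_def by blast
  moreover have "(z, 0) + (s, s) = x" by (simp add: z_def s_def prod_eq_iff)
  ultimately have eq: "emeasure (b x) D = emeasure (b (z, 0)) D" by simp
  have *: "(\<lambda>y. fst y - snd y) \<in> b w \<rightarrow>\<^sub>M borel_on I \<and> space (b w) = I \<times> I" if "w \<in> I \<times> I" for w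
    using m markov_kernelD[OF b, of w] that by (simp cong: measurable_cong_sets)
  show "emeasure (distr (b x) (borel_on I) (\<lambda>y. fst y - snd y)) A = emeasure (dif_kernel I b (fst x - snd x)) A"
    using *[OF x] *[OF z0] eq A unfolding dif_kernel_def z_def[symmetric] by (simp add: emeasure_distr D_def)
qed (simp add: dif_kernel_def)

lemma chain_prod_dif:
  fixes I :: "'a::euclidean_space set"
  assumes I: "0 \<in> I" "\<forall>x\<in>I. \<forall>y\<in>I. x + y \<in> I" "\<forall>x\<in>I. - x \<in> I" and b: "markov_kernel (borel_on (I \<times> I)) b"
    and inv: "diag_trans_inv I b" and x: "x \<in> I \<times> I" and h: "\<And>k. h k \<in> borel_measurable (borel_on I)"
  shows "chain_prod b n (\<lambda>k x. h k (fst x - snd x)) x = chain_prod (dif_kernel I b) n h (fst x - snd x)"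
  using x h
proof (induction n arbitrary: x h)
  case (Suc n)
  note x = Suc.prems(1)
  have "(\<integral>y. chain_prod b n (\<lambda>k x. h (Suc k) (fst x - snd x)) y \<partial>b x)
      = (\<integral>y. chain_prod (dif_kernel I b) n (\<lambda>k. h (Suc k)) (fst y - snd y) \<partial>b x)"
    by (rule Bochner_Integration.integral_cong[OF refl], rule Suc.IH)
      (use markov_kernelD(3)[OF b, of x] x Suc.prems(2) in auto)
  also have "\<dots> = (\<integral>v. chain_prod (dif_kernel I b) n (\<lambda>k. h (Suc k)) v \<partial>distr (b x) (borel_on I) (\<lambda>y. fst y - snd y))"
  proof (rule integral_distr[symmetric])
    show "(\<lambda>y. fst y - snd y) \<in> b x \<rightarrow>\<^sub>M borel_on I"
      using dif_map_measurable[OF I(2,3)] markov_kernelD(2)[OF b, of x] x by (simp cong: measurable_cong_sets)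
    show "chain_prod (dif_kernel I b) n (\<lambda>k. h (Suc k)) \<in> borel_measurable (borel_on I)"
      by (rule chain_prod_measurable[OF markov_kernel_dif_kernel[OF I b]]) (rule Suc.prems(2))
  qed
  finally show ?case unfolding distr_dif_eq_dif_kernel[OF I b inv x] by simp
qed simp

lemma tv_dist_dif_kernel_le:
  fixes I :: "'a::euclidean_space set"
  assumes I: "0 \<in> I" "\<forall>x\<in>I. \<forall>y\<in>I. x + y \<in> I" "\<forall>x\<in>I. - x \<in> I"
    and b: "markov_kernel (borel_on (I \<times> I)) b" "markov_kernel (borel_on (I \<times> I)) b'" and z: "z \<in> I"
  shows "tv_dist (dif_kernel I b z) (dif_kernel I b' z) \<le> d_sri I b b'"
proof -
  have x: "(z, 0) \<in> space (borel_on (I \<times> I))" using I z by simp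
  have "tv_dist (dif_kernel I b z) (dif_kernel I b' z) \<le> tv_dist (b (z, 0)) (b' (z, 0))"
    unfolding dif_kernel_def
    using markov_kernelD[OF b(1) x] markov_kernelD[OF b(2) x] dif_map_measurable[OF I(2,3)]
    by (intro tv_dist_distr_le) (auto cong: measurable_cong_sets)
  also have "\<dots> \<le> d_sri I b b'" using tv_dist_le_d_sri[OF b] x by simp
  finally show ?thesis .
qed

text \<open>Total variation is uniform over bounded integrands, so the integrand may change with N:
  the kernel is first replaced by its limit, and dominated convergence under the fixed measure
  \<open>K z\<close> does the rest. Inside the recursion the induction hypothesis is used along
  constant sequences only; moving points enter through the outermost kernel and factor.\<close>

lemma chain_prod_tendsto:
  fixes I :: "'a::euclidean_space set"
  assumes KN: "\<And>N. markov_kernel (borel_on I) (KN N)" and K: "markov_kernel (borel_on I) K"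
    and tv: "\<And>zN z. (\<And>N. zN N \<in> I) \<Longrightarrow> z \<in> I \<Longrightarrow> zN \<longlonglongrightarrow> z \<Longrightarrow> (\<lambda>N. tv_dist (KN N (zN N)) (K z)) \<longlonglongrightarrow> 0"
    and hN: "\<And>N k. hN N k \<in> borel_measurable (borel_on I)"
    and C: "\<And>N k z. z \<in> I \<Longrightarrow> \<bar>hN N k z\<bar> \<le> C" "C > 0"
    and lim: "\<And>k zN z. (\<And>N. zN N \<in> I) \<Longrightarrow> z \<in> I \<Longrightarrow> zN \<longlonglongrightarrow> z \<Longrightarrow> (\<lambda>N. hN N k (zN N)) \<longlonglongrightarrow> h k z"
    and z: "\<And>N. zN N \<in> I" "z \<in> I" "zN \<longlonglongrightarrow> z"
  shows "(\<lambda>N. chain_prod (KN N) n (hN N) (zN N)) \<longlonglongrightarrow> chain_prod K n h z"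
  using hN C(1) lim z
proof (induction n arbitrary: hN h zN z)
  case 0
  then show ?case by simp
next
  case (Suc n)
  let ?g = "\<lambda>N. chain_prod (KN N) n (\<lambda>k. hN N (Suc k))"
  let ?g' = "chain_prod K n (\<lambda>k. h (Suc k))"
  have zs: "z \<in> space (borel_on I)" "zN N \<in> space (borel_on I)" for N using Suc.prems by auto
  have gm: "?g N \<in> borel_measurable (borel_on I)" for N
    by (rule chain_prod_measurable[OF KN]) (rule Suc.prems(1))
  have gb: "\<bar>?g N y\<bar> \<le> C ^ n" if "y \<in> I" for N y
    by (rule chain_prod_bound[OF KN]) (use Suc.prems(1,2) C(2) that in auto)
  have glim: "(\<lambda>N. ?g N y) \<longlonglongrightarrow> ?g' y" if "y \<in> I" for y
    by (rule Suc.IH[OF Suc.prems(1,2)]) (use that Suc.prems(3) in auto)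
  have pw: "(\<lambda>N. \<integral>y. ?g N y \<partial>K z) \<longlonglongrightarrow> (\<integral>y. ?g' y \<partial>K z)"
  proof (rule integral_dominated_convergence[where w="\<lambda>_. C ^ n"])
    interpret prob_space "K z" by (rule markov_kernelD[OF K zs(1)])
    note s = markov_kernelD(2,3)[OF K zs(1)]
    show gmz: "?g N \<in> borel_measurable (K z)" for N using gm s by (simp cong: measurable_cong_sets)
    show "?g' \<in> borel_measurable (K z)"
      by (rule borel_measurable_LIMSEQ_real[OF _ gmz]) (use glim s in auto)
    show "integrable (K z) (\<lambda>_. C ^ n)" by simp
    show "AE y in K z. (\<lambda>N. ?g N y) \<longlonglongrightarrow> ?g' y" using glim s by (intro AE_I2) auto
    show "AE y in K z. norm (?g N y) \<le> C ^ n" for N using gb s by (intro AE_I2) auto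
  qed
  have df: "(\<lambda>N. (\<integral>y. ?g N y \<partial>KN N (zN N)) - (\<integral>y. ?g N y \<partial>K z)) \<longlonglongrightarrow> 0"
  proof (rule tendsto_rabs_zero_cancel, rule tendsto_sandwich[OF always_eventually always_eventually tendsto_const])
    show "\<forall>N. \<bar>(\<integral>y. ?g N y \<partial>KN N (zN N)) - (\<integral>y. ?g N y \<partial>K z)\<bar> \<le> 2 * C ^ n * tv_dist (KN N (zN N)) (K z)"
    proof
      fix N
      note s = markov_kernelD[OF KN zs(2), of N N]
      show "\<bar>(\<integral>y. ?g N y \<partial>KN N (zN N)) - (\<integral>y. ?g N y \<partial>K z)\<bar> \<le> 2 * C ^ n * tv_dist (KN N (zN N)) (K z)"
        using markov_kernelD[OF K zs(1)] s gm[of N] gb C(2)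
        by (intro integral_diff_le_tv_dist) (auto cong: measurable_cong_sets)
    qed
    show "(\<lambda>N. 2 * C ^ n * tv_dist (KN N (zN N)) (K z)) \<longlonglongrightarrow> 0"
      by (rule tendsto_mult_right_zero, rule tv) (use Suc.prems in auto)
  qed simp
  have "(\<lambda>N. \<integral>y. ?g N y \<partial>KN N (zN N)) \<longlonglongrightarrow> (\<integral>y. ?g' y \<partial>K z)"
    using tendsto_add[OF df pw] by simp
  moreover have "(\<lambda>N. hN N 0 (zN N)) \<longlonglongrightarrow> h 0 z" by (rule Suc.prems(3)) (use Suc.prems in auto)
  ultimately show ?case by (simp add: tendsto_mult)
qed

section \<open>Time sequences as finite sets, and limits of sums with uniform tails\<close>

section \<open>Increasing times\<close>

lemma increasing_timesD:
  assumes "r \<in> increasing_times m"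
  shows "inj_on r {1..m}" "card (r ` {1..m}) = m" "strict_mono_on {1..m} r"
proof -
  show s: "strict_mono_on {1..m} r" using assms by (simp add: increasing_times_def)
  then show i: "inj_on r {1..m}" by (rule strict_mono_on_imp_inj_on)
  show "card (r ` {1..m}) = m" using card_image[OF i] by simp
qed

text \<open>A strictly increasing sequence is the sorted enumeration of its range. Sums over
  sequences thereby become sums over the sets in \<open>late_sets\<close>.\<close>

lemma inj_on_increasing_times_image: "inj_on (\<lambda>r. r ` {1..m}) (increasing_times m)"
proof (rule inj_onI)
  fix r r' assume r: "r \<in> increasing_times m" and r': "r' \<in> increasing_times m" and eq: "r ` {1..m} = r' ` {1..m}"
  have *: "map q [1..<Suc m] = sorted_list_of_set (q ` {1..m})" if "q \<in> increasing_times m" for q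
  proof (rule sorted_distinct_set_unique)
    show "sorted (map q [1..<Suc m])"
      using increasing_timesD(3)[OF that]
      by (auto simp: sorted_iff_nth_mono strict_mono_on_leD simp del: upt_Suc)
    show "distinct (map q [1..<Suc m])" "set (map q [1..<Suc m]) = set (sorted_list_of_set (q ` {1..m}))"
      using increasing_timesD(1)[OF that] by (auto simp: distinct_map atLeastLessThanSuc_atLeastAtMost simp del: upt_Suc)
  qed auto
  have "map r [1..<Suc m] = map r' [1..<Suc m]" using *[OF r] *[OF r'] eq by simp
  then have "r l = r' l" if "l \<in> {1..m}" for l using that by (auto simp del: upt_Suc)
  then show "r = r'" using r r' by (intro PiE_ext[of r "{1..m}" "\<lambda>_. UNIV"]) (auto simp: increasing_times_def)
qed

lemma finite_increasing_times_bounded: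
  "finite {r \<in> increasing_times m. \<forall>l\<in>{1..m}. r l < n}"
proof (rule finite_subset)
  show "{r \<in> increasing_times m. \<forall>l\<in>{1..m}. r l < n} \<subseteq> {1..m} \<rightarrow>\<^sub>E {..<n}"
  proof
    fix r assume "r \<in> {r \<in> increasing_times m. \<forall>l\<in>{1..m}. r l < n}"
    then have r: "r \<in> {1..m} \<rightarrow>\<^sub>E UNIV" "\<forall>l\<in>{1..m}. r l < n" by (simp_all add: increasing_times_def)
    show "r \<in> {1..m} \<rightarrow>\<^sub>E {..<n}" using r(2) PiE_arb[OF r(1)] by (intro PiE_I) blast+
  qed
  show "finite ({1..m} \<rightarrow>\<^sub>E {..<n})" by (intro finite_PiE) simp_all
qed

text \<open>A product over visits becomes a product over all times below n with factor 1 at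
  unvisited ones, the shape required by \<open>chain_prod\<close>; \<open>inv_into\<close> recovers
  which factor belongs to a visited time.\<close>

lemma prod_increasing_times:
  fixes g :: "nat \<Rightarrow> nat \<Rightarrow> real"
  assumes r: "r \<in> increasing_times m" and n: "\<forall>l\<in>{1..m}. r l < n"
  shows "(\<Prod>l\<in>{1..m}. g l (r l)) = (\<Prod>k<n. if k \<in> r ` {1..m} then g (inv_into {1..m} r k) k else 1)"
proof -
  have "(\<Prod>k<n. if k \<in> r ` {1..m} then g (inv_into {1..m} r k) k else 1)
      = (\<Prod>k\<in>{..<n} \<inter> r ` {1..m}. g (inv_into {1..m} r k) k)"
    by (rule prod.inter_restrict[symmetric]) simp
  also have "{..<n} \<inter> r ` {1..m} = r ` {1..m}" using n by auto
  also have "(\<Prod>k\<in>r ` {1..m}. g (inv_into {1..m} r k) k) = (\<Prod>l\<in>{1..m}. g l (r l))"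
    using increasing_timesD(1)[OF r] by (simp add: prod.reindex)
  finally show ?thesis by simp
qed

lemma (in lyapunov_chain) sum_increasing_times_le_late_sum:
  assumes D: "finite D" "D \<subseteq> increasing_times m" and late: "\<And>r. r \<in> D \<Longrightarrow> \<exists>l\<in>{1..m}. t \<le> r l"
    and n: "\<And>r l. r \<in> D \<Longrightarrow> l \<in> {1..m} \<Longrightarrow> r l < n" and x: "x \<in> space S"
  shows "(\<Sum>r\<in>D. chain_prod K n (wt (r ` {1..m})) x) \<le> late_sum m n t x"
proof -
  have "(\<Sum>r\<in>D. chain_prod K n (wt (r ` {1..m})) x) = (\<Sum>A\<in>(\<lambda>r. r ` {1..m}) ` D. chain_prod K n (wt A) x)"
    by (rule sum.reindex_cong[symmetric, OF inj_on_subset[OF inj_on_increasing_times_image D(2)]]) auto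
  also have "\<dots> \<le> late_sum m n t x"
    unfolding late_sum_def
  proof (rule sum_mono2[OF finite_late_sets])
    show "(\<lambda>r. r ` {1..m}) ` D \<subseteq> late_sets m n t"
      using D(2) late n increasing_timesD(2) by (fastforce simp: late_sets_def)
  qed (rule chain_prod_wt_nonneg[OF x])
  finally show ?thesis .
qed

text \<open>A variant of Tannery's theorem with uniform tails in place of a dominating summable
  family. Finite parts of the tail of a inherit the bound in the limit, which yields absolute
  summability.\<close>

lemma infsum_tendsto_of_uniform_tails:
  fixes a :: "'b \<Rightarrow> real" and aN :: "nat \<Rightarrow> 'b \<Rightarrow> real"
  assumes lim: "\<And>r. r \<in> X \<Longrightarrow> (\<lambda>N. aN N r) \<longlonglongrightarrow> a r"
    and D: "\<And>N. finite (D N)" "\<And>N. D N \<subseteq> X" "\<And>r. r \<in> X \<Longrightarrow> \<forall>\<^sub>F N in sequentially. r \<in> D N"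
    and tails: "\<And>\<eta>. \<eta> > 0 \<Longrightarrow> \<exists>Y. finite Y \<and> Y \<subseteq> X \<and>
      (\<forall>\<^sub>F N in sequentially. \<forall>Z. finite Z \<and> Z \<subseteq> X - Y \<longrightarrow> (\<Sum>r\<in>Z. \<bar>aN N r\<bar>) \<le> \<eta>)"
  shows "a summable_on X" "(\<lambda>N. \<Sum>r\<in>D N. aN N r) \<longlonglongrightarrow> (\<Sum>\<^sub>\<infinity>r\<in>X. a r)"
proof -
  have tail_a: "(\<Sum>r\<in>Z. \<bar>a r\<bar>) \<le> \<eta>"
    if "\<forall>\<^sub>F N in sequentially. \<forall>Z. finite Z \<and> Z \<subseteq> X - Y \<longrightarrow> (\<Sum>r\<in>Z. \<bar>aN N r\<bar>) \<le> \<eta>" "finite Z" "Z \<subseteq> X - Y"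
    for Y Z \<eta>
  proof (rule tendsto_upperbound)
    show "(\<lambda>N. \<Sum>r\<in>Z. \<bar>aN N r\<bar>) \<longlonglongrightarrow> (\<Sum>r\<in>Z. \<bar>a r\<bar>)"
      by (intro tendsto_sum tendsto_rabs lim) (use that in auto)
    show "\<forall>\<^sub>F N in sequentially. (\<Sum>r\<in>Z. \<bar>aN N r\<bar>) \<le> \<eta>" using that(1) by eventually_elim (use that in auto)
  qed simp
  have abs: "(\<lambda>r. \<bar>a r\<bar>) summable_on X"
  proof -
    obtain Y where Y: "finite Y" "Y \<subseteq> X"
      "\<forall>\<^sub>F N in sequentially. \<forall>Z. finite Z \<and> Z \<subseteq> X - Y \<longrightarrow> (\<Sum>r\<in>Z. \<bar>aN N r\<bar>) \<le> 1"
      using tails[of 1] by auto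
    show ?thesis
    proof (rule nonneg_bdd_above_summable_on)
      show "bdd_above (sum (\<lambda>r. \<bar>a r\<bar>) ` {F. F \<subseteq> X \<and> finite F})"
      proof (rule bdd_aboveI2)
        fix F assume "F \<in> {F. F \<subseteq> X \<and> finite F}"
        then have F: "F \<subseteq> X" "finite F" by auto
        have "(\<Sum>r\<in>F. \<bar>a r\<bar>) = (\<Sum>r\<in>F \<inter> Y. \<bar>a r\<bar>) + (\<Sum>r\<in>F - Y. \<bar>a r\<bar>)"
          using F by (simp add: sum.Int_Diff)
        also have "\<dots> \<le> (\<Sum>r\<in>Y. \<bar>a r\<bar>) + 1"
          using F Y by (intro add_mono sum_mono2 tail_a[OF Y(3)]) auto
        finally show "(\<Sum>r\<in>F. \<bar>a r\<bar>) \<le> (\<Sum>r\<in>Y. \<bar>a r\<bar>) + 1" .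
      qed
    qed simp
  qed
  show sa: "a summable_on X" by (rule abs_summable_summable) (use abs in simp)
  show "(\<lambda>N. \<Sum>r\<in>D N. aN N r) \<longlonglongrightarrow> (\<Sum>\<^sub>\<infinity>r\<in>X. a r)"
  proof (rule tendstoI)
    fix e :: real assume e: "e > 0"
    obtain Y where Y: "finite Y" "Y \<subseteq> X"
      "\<forall>\<^sub>F N in sequentially. \<forall>Z. finite Z \<and> Z \<subseteq> X - Y \<longrightarrow> (\<Sum>r\<in>Z. \<bar>aN N r\<bar>) \<le> e / 4"
      using tails[of "e / 4"] e by auto
    have inf: "\<bar>(\<Sum>\<^sub>\<infinity>r\<in>X. a r) - (\<Sum>r\<in>Y. a r)\<bar> \<le> e / 4"
    proof (rule tendsto_upperbound)
      show "((\<lambda>F. \<bar>sum a F - sum a Y\<bar>) \<longlongrightarrow> \<bar>(\<Sum>\<^sub>\<infinity>r\<in>X. a r) - (\<Sum>r\<in>Y. a r)\<bar>) (finite_subsets_at_top X)"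
        by (intro tendsto_intros infsum_tendsto sa)
      show "\<forall>\<^sub>F F in finite_subsets_at_top X. \<bar>sum a F - sum a Y\<bar> \<le> e / 4"
      proof -
        have "\<forall>\<^sub>F F in finite_subsets_at_top X. Y \<subseteq> F \<and> F \<subseteq> X \<and> finite F"
          unfolding eventually_finite_subsets_at_top using Y by (intro exI[of _ Y]) auto
        then show ?thesis
        proof eventually_elim
          case (elim F)
          then have "sum a F - sum a Y = sum a (F - Y)" by (subst sum_diff) auto
          also have "\<bar>sum a (F - Y)\<bar> \<le> (\<Sum>r\<in>F - Y. \<bar>a r\<bar>)" by (rule sum_abs)
          also have "\<dots> \<le> e / 4" using elim by (intro tail_a[OF Y(3)]) auto
          finally show ?case .
        qed
      qed
    qed simp
    have "(\<lambda>N. \<Sum>r\<in>Y. aN N r) \<longlonglongrightarrow> (\<Sum>r\<in>Y. a r)" by (intro tendsto_sum lim) (use Y in auto)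
    then have ev1: "\<forall>\<^sub>F N in sequentially. dist (\<Sum>r\<in>Y. aN N r) (\<Sum>r\<in>Y. a r) < e / 4"
      by (rule tendstoD) (use e in simp)
    have ev2: "\<forall>\<^sub>F N in sequentially. \<forall>r\<in>Y. r \<in> D N"
      using Y D(3) by (intro eventually_ball_finite) auto
    show "\<forall>\<^sub>F N in sequentially. dist (\<Sum>r\<in>D N. aN N r) (\<Sum>\<^sub>\<infinity>r\<in>X. a r) < e"
      using ev1 ev2 Y(3)
    proof eventually_elim
      case (elim N)
      have "(\<Sum>r\<in>D N. aN N r) - (\<Sum>r\<in>Y. aN N r) = (\<Sum>r\<in>D N - Y. aN N r)"
        using elim D(1) by (subst sum_diff) auto
      also have "\<bar>\<dots>\<bar> \<le> (\<Sum>r\<in>D N - Y. \<bar>aN N r\<bar>)" by (rule sum_abs)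
      also have "\<dots> \<le> e / 4" by (rule elim(3)[rule_format]) (use D(1,2) in auto)
      finally show ?case using elim(1) inf e unfolding dist_real_def by linarith
    qed
  qed
qed

section \<open>The first coordinate stays near its start at fixed times\<close>

section \<open>The first coordinate\<close>

definition fst_increment :: "('a::euclidean_space \<times> 'a \<Rightarrow> ('a \<times> 'a) measure) \<Rightarrow> 'a \<times> 'a \<Rightarrow> 'a measure" where
  "fst_increment b x = distr (b x) borel (\<lambda>y. fst y - fst x)"

lemma fst_increment_moments:
  fixes x :: "'a::euclidean_space \<times> 'a"
  assumes \<sigma>: "\<sigma> > 0" and M: "M > 0" and b: "b \<in> sri_class I \<sigma> M F" and x: "x \<in> I \<times> I"
  shows "prob_space (fst_increment b x)" "sets (fst_increment b x) = sets borel"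
    "integrable (fst_increment b x) (\<lambda>v. norm v ^ 4)"
    "(\<integral>v. norm v ^ 4 \<partial>fst_increment b x) \<le> moment_bound \<sigma> M"
    "integrable (b x) (\<lambda>y. norm (fst y - fst x))" "(\<integral>y. norm (fst y - fst x) \<partial>b x) \<le> 1 + moment_bound \<sigma> M"
proof -
  have bk: "markov_kernel (borel_on (I \<times> I)) b" using b by (auto simp: sri_class_def sri_chain_def)
  interpret prob_space "b x" by (rule markov_kernelD[OF bk]) (use x in simp)
  have bs [measurable_cong]: "sets (b x) = sets (borel_on (I \<times> I))" by (rule markov_kernelD[OF bk]) (use x in simp)
  note [measurable] = fst_snd_measurable_borel_on[of "I \<times> I"]
  note i4 = dif_increment_moments(3)[OF assms]
  have fm: "(\<lambda>y. fst y - fst x) \<in> b x \<rightarrow>\<^sub>M borel" by measurable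
  show "prob_space (fst_increment b x)" "sets (fst_increment b x) = sets borel"
    unfolding fst_increment_def using prob_space_distr[OF fm] by auto
  show "integrable (fst_increment b x) (\<lambda>v. norm v ^ 4)"
    unfolding fst_increment_def by (subst integrable_distr_eq[OF fm]) (use i4 in auto)
  have E: "(\<integral>\<^sup>+y. ennreal (exp (\<sigma> * norm (fst y - fst x))) \<partial>b x) \<le> ennreal M"
    using b x by (auto simp: sri_class_def)
  have I: "integrable (b x) (\<lambda>y. exp (\<sigma> * norm (fst y - fst x)))"
    using E by (auto intro!: integrableI_nonneg order_le_less_trans[OF E])
  have J: "(\<integral>y. exp (\<sigma> * norm (fst y - fst x)) \<partial>b x) \<le> M"
    using E M nn_integral_eq_integral[OF I] by auto
  have "(\<integral>v. norm v ^ 4 \<partial>fst_increment b x) = (\<integral>y. norm (fst y - fst x) ^ 4 \<partial>b x)"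
    unfolding fst_increment_def by (subst integral_distr[OF fm]) auto
  also have "\<dots> \<le> (\<integral>y. 256 / \<sigma> ^ 4 * exp (\<sigma> * norm (fst y - fst x)) \<partial>b x)"
    by (rule integral_mono) (use i4 I power4_le_exp[OF \<sigma>] in auto)
  also have "\<dots> = 256 / \<sigma> ^ 4 * (\<integral>y. exp (\<sigma> * norm (fst y - fst x)) \<partial>b x)" by simp
  also have "\<dots> \<le> 4096 / \<sigma> ^ 4 * M" using J \<sigma> by (intro mult_mono divide_right_mono) auto
  finally have 4: "(\<integral>v. norm v ^ 4 \<partial>fst_increment b x) \<le> 4096 / \<sigma> ^ 4 * M" .
  then show "(\<integral>v. norm v ^ 4 \<partial>fst_increment b x) \<le> moment_bound \<sigma> M" by (simp add: moment_bound_def)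
  show i: "integrable (b x) (\<lambda>y. norm (fst y - fst x))"
    by (rule Bochner_Integration.integrable_bound[OF Bochner_Integration.integrable_add[OF integrable_const[of 1] i4]])
      (use le_1_power4 in auto)
  have "(\<integral>y. norm (fst y - fst x) \<partial>b x) \<le> (\<integral>y. 1 + norm (fst y - fst x) ^ 4 \<partial>b x)"
    by (rule integral_mono[OF i _ le_1_power4]) (use i4 in auto)
  also have "\<dots> = 1 + (\<integral>v. norm v ^ 4 \<partial>fst_increment b x)"
    unfolding fst_increment_def by (subst integral_distr[OF fm]) (use i4 in \<open>auto simp: prob_space\<close>)
  finally show "(\<integral>y. norm (fst y - fst x) \<partial>b x) \<le> 1 + moment_bound \<sigma> M"
    using 4 by (simp add: moment_bound_def)
qed

lemma tv_dist_fst_increment_le: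
  assumes I: "\<forall>x\<in>I. \<forall>y\<in>I. x + y \<in> I" and b: "sri_chain I \<nu> F b" and x: "x \<in> I \<times> I"
  shows "tv_dist (fst_increment b x) (distr \<nu> borel (\<lambda>u. u)) \<le> F (norm (fst x - snd x))"
proof -
  have \<nu>: "\<nu> \<in> space (prob_algebra (borel_on I))" and bk: "markov_kernel (borel_on (I \<times> I)) b"
    using b by (auto simp: sri_chain_def)
  interpret N: prob_space \<nu> by (rule prob_algebra_borel_onD[OF \<nu>])
  note fs [measurable] = fst_snd_measurable_borel_on[of "I \<times> I"]
  let ?D = "distr (\<nu> \<Otimes>\<^sub>M \<nu>) (borel_on (I \<times> I)) (\<lambda>u. x + u)"
  note bx = markov_kernelD[OF bk, of x]
  have fm: "(\<lambda>y. fst y - fst x) \<in> borel_on (I \<times> I) \<rightarrow>\<^sub>M borel" by measurable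
  have "tv_dist (fst_increment b x) (distr ?D borel (\<lambda>y. fst y - fst x)) \<le> tv_dist (b x) ?D"
    unfolding fst_increment_def using bx x fm
    by (intro tv_dist_distr_le prob_space.prob_space_distr prob_space_pair[OF \<nu>] shift_measurable[OF I \<nu> x])
      (auto cong: measurable_cong_sets)
  also have "distr ?D borel (\<lambda>y. fst y - fst x) = distr (\<nu> \<Otimes>\<^sub>M \<nu>) borel fst"
    by (subst distr_distr[OF fm shift_measurable[OF I \<nu> x]]) (auto simp: comp_def)
  also have "\<dots> = distr (distr (\<nu> \<Otimes>\<^sub>M \<nu>) \<nu> fst) borel (\<lambda>u. u)"
    by (subst distr_distr[OF prob_algebra_borel_onD(4)[OF \<nu>] measurable_fst]) (simp add: comp_def)
  also have "\<dots> = distr \<nu> borel (\<lambda>u. u)" by (simp add: N.distr_pair_fst)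
  finally show ?thesis using b x by (auto simp: sri_chain_def intro: order_trans)
qed

text \<open>A bound on s_N uniform in N makes \<open>r * s_N / sqrt N\<close> vanish for a fixed
  time r. The base measure is the limit law of the first increment as the coordinates separate, and
  it inherits the moment bound from there.\<close>

lemma base_mean_bounded:
  fixes I :: "(real^'n) set"
  assumes I0: "0 \<in> I" and Iadd: "\<forall>x\<in>I. \<forall>y\<in>I. x + y \<in> I" and \<sigma>: "\<sigma> > 0" and M: "M > 0"
    and F: "exp_decay_on {0..} F" and unbounded: "\<And>R. \<exists>z\<in>I. norm z \<ge> R"
    and b: "b \<in> sri_class I \<sigma> M F" "sri_chain I \<nu> F b"
  shows "norm (\<integral>u. u \<partial>\<nu>) \<le> 1 + moment_bound \<sigma> M"
proof -
  have \<nu>: "\<nu> \<in> space (prob_algebra (borel_on I))" using b by (auto simp: sri_chain_def)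
  interpret N: prob_space \<nu> by (rule prob_algebra_borel_onD[OF \<nu>])
  note id = prob_algebra_borel_onD(4)[OF \<nu>]
  define \<mu> where "\<mu> = distr \<nu> borel (\<lambda>u. u)"
  interpret P: prob_space \<mu> unfolding \<mu>_def by (rule N.prob_space_distr[OF id])
  have "\<exists>P. prob_space P \<and> sets P = sets borel \<and> integrable P (\<lambda>v. norm v ^ 4) \<and>
      (\<integral>v. norm v ^ 4 \<partial>P) \<le> moment_bound \<sigma> M \<and> tv_dist P \<mu> \<le> \<eta>" if \<eta>: "\<eta> > 0" for \<eta>
  proof -
    obtain A a where Aa: "A > 0" "a > 0" "\<And>r. r \<ge> 0 \<Longrightarrow> F r \<le> A * exp (- a * r)"
      using exp_decay_onD[OF F] by metis
    obtain R where R: "\<And>r. r \<ge> R \<Longrightarrow> F r \<le> \<eta>" using exp_decay_tendsto_0[OF Aa(2,3) \<eta>] by blast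
    obtain z where z: "z \<in> I" "norm z \<ge> R" using unbounded by blast
    have x: "(z, 0) \<in> I \<times> I" using z I0 by simp
    have "tv_dist (fst_increment b (z, 0)) \<mu> \<le> \<eta>"
      using tv_dist_fst_increment_le[OF Iadd b(2) x] R[OF z(2)] by (simp add: \<mu>_def)
    then show ?thesis using fst_increment_moments[OF \<sigma> M b(1) x] by blast
  qed
  from moments_tv_limit[OF P.prob_space_axioms _ this]
  have m: "integrable \<mu> (\<lambda>v. norm v ^ 4)" "(\<integral>v. norm v ^ 4 \<partial>\<mu>) \<le> moment_bound \<sigma> M"
    by (auto simp: \<mu>_def)
  have s: "sets \<mu> = sets borel" by (simp add: \<mu>_def)
  have i: "integrable \<mu> norm" by (rule norm_powers_integrable[OF P.prob_space_axioms s m(1)])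
  have "norm (\<integral>u. u \<partial>\<nu>) \<le> (\<integral>u. norm u \<partial>\<nu>)" by (rule integral_norm_bound)
  also have "\<dots> = (\<integral>v. norm v \<partial>\<mu>)" unfolding \<mu>_def by (rule integral_distr[OF id, symmetric]) simp
  also have "\<dots> \<le> (\<integral>v. 1 + norm v ^ 4 \<partial>\<mu>)"
    by (rule integral_mono[OF i _ le_1_power4]) (use m in auto)
  also have "\<dots> = 1 + (\<integral>v. norm v ^ 4 \<partial>\<mu>)" using m by (simp add: P.prob_space)
  finally show ?thesis using m by linarith
qed

lemma integral_chain_law_component:
  fixes g :: "'a \<Rightarrow> real"
  assumes K: "markov_kernel S K" and x: "x \<in> space S" and g: "g \<in> borel_measurable S"
    and C: "\<And>y. y \<in> space S \<Longrightarrow> \<bar>g y\<bar> \<le> C"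
  shows "(\<integral>R. g (R k) \<partial>chain_law S K x) = chain_prod K (Suc k) (\<lambda>j y. if j = k then g y else 1) x"
proof -
  have "(\<integral>R. (\<Prod>j<Suc k. (if j = k then g (R j) else 1)) \<partial>chain_law S K x)
      = chain_prod K (Suc k) (\<lambda>j y. if j = k then g y else 1) x"
  proof (rule integral_chain_law_prod[OF K x, where C="max C 1"])
    show "(\<lambda>y. if j = k then g y else 1) \<in> borel_measurable S" for j using g by (cases "j = k") auto
    show "\<bar>if j = k then g y else 1\<bar> \<le> max C 1" if "y \<in> space S" for j y using C[OF that] by auto
  qed simp
  moreover have "(\<Prod>j<Suc k. (if j = k then g (R j) else 1)) = g (R k)" for R :: "nat \<Rightarrow> 'a"
    by simp
  ultimately show ?thesis by simp
qed

text \<open>One triangle inequality per step. The truncation at L keeps the functional bounded, as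
  the path formula requires, and the resulting estimate is free of L.\<close>

lemma expected_displacement_le:
  fixes x :: "'a::euclidean_space \<times> 'a"
  assumes \<sigma>: "\<sigma> > 0" and M: "M > 0" and b: "b \<in> sri_class I \<sigma> M F" and x: "x \<in> I \<times> I" and L: "L > 0"
  shows "(\<integral>R. min L (norm (fst (R k) - a)) \<partial>chain_law (borel_on (I \<times> I)) b x)
    \<le> norm (fst x - a) + real k * (1 + moment_bound \<sigma> M)"
proof -
  define C where "C = 1 + moment_bound \<sigma> M"
  define g where "g y = min L (norm (fst y - a))" for y :: "'a \<times> 'a"
  have bk: "markov_kernel (borel_on (I \<times> I)) b" using b by (auto simp: sri_class_def sri_chain_def)
  note [measurable] = fst_snd_measurable_borel_on[of "I \<times> I"]
  have gm: "g \<in> borel_measurable (borel_on (I \<times> I))" unfolding g_def by measurable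
  have gL: "\<bar>g y\<bar> \<le> L" for y using L by (simp add: g_def)
  have "chain_prod b (Suc k) (\<lambda>j y. if j = k then g y else 1) x \<le> g x + real k * C"
    using x
  proof (induction k arbitrary: x)
    case 0
    interpret prob_space "b x" by (rule markov_kernelD[OF bk]) (use 0 in simp)
    show ?case by (simp add: prob_space)
  next
    case (Suc k)
    have xs: "x \<in> space (borel_on (I \<times> I))" using Suc.prems by simp
    interpret prob_space "b x" by (rule markov_kernelD[OF bk xs])
    note m = fst_increment_moments(5,6)[OF \<sigma> M b Suc.prems]
    have sh: "(\<lambda>j y. if Suc j = Suc k then g y else 1) = (\<lambda>j y. if j = k then g y else 1)" by auto
    have hm: "(\<lambda>y. if j = k then g y else 1) \<in> borel_measurable (borel_on (I \<times> I))" for j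
      using gm by (cases "j = k") auto
    have hb: "\<bar>if j = k then g y else 1\<bar> \<le> max L 1" for j y using gL[of y] by auto
    have "(\<integral>y. chain_prod b (Suc k) (\<lambda>j y. if j = k then g y else 1) y \<partial>b x)
        \<le> (\<integral>y. (g x + real k * C) + norm (fst y - fst x) \<partial>b x)"
    proof (rule integral_mono)
      show "integrable (b x) (chain_prod b (Suc k) (\<lambda>j y. if j = k then g y else 1))"
        by (rule chain_prod_integrable[OF bk hm hb _ xs]) simp
      show "integrable (b x) (\<lambda>y. (g x + real k * C) + norm (fst y - fst x))" using m(1) by simp
      fix y assume "y \<in> space (b x)"
      then have y: "y \<in> I \<times> I" using markov_kernelD(3)[OF bk xs] by simp
      have "norm (fst y - a) \<le> norm (fst x - a) + norm (fst y - fst x)"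
        using norm_triangle_ineq[of "fst x - a" "fst y - fst x"] by simp
      then have "g y \<le> g x + norm (fst y - fst x)" using L norm_ge_zero[of "fst y - fst x"] unfolding g_def by linarith
      then show "chain_prod b (Suc k) (\<lambda>j y. if j = k then g y else 1) y \<le> (g x + real k * C) + norm (fst y - fst x)"
        using Suc.IH[OF y] by linarith
    qed
    also have "\<dots> = g x + real k * C + (\<integral>y. norm (fst y - fst x) \<partial>b x)" using m(1) by (simp add: prob_space)
    also have "\<dots> \<le> g x + real (Suc k) * C" using m(2) by (simp add: C_def algebra_simps)
    finally have "(\<integral>y. chain_prod b (Suc k) (\<lambda>j y. if j = k then g y else 1) y \<partial>b x) \<le> g x + real (Suc k) * C" .
    then show ?case
      unfolding chain_prod.simps(2)[of b "Suc k"] sh by (simp del: chain_prod.simps of_nat_Suc)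
  qed
  also have "g x \<le> norm (fst x - a)" by (simp add: g_def)
  finally show ?thesis
    using integral_chain_law_component[OF bk _ gm gL, of x k] x by (simp add: g_def C_def)
qed

text \<open>Factors are exchanged one at a time; \<open>C \<ge> 1\<close> allows a single power of C
  for all of them.\<close>

lemma abs_prod_diff_le:
  fixes p q :: "'b \<Rightarrow> real"
  assumes "finite A" "\<And>l. l \<in> A \<Longrightarrow> \<bar>p l\<bar> \<le> C" "\<And>l. l \<in> A \<Longrightarrow> \<bar>q l\<bar> \<le> C" "C \<ge> 1"
  shows "\<bar>(\<Prod>l\<in>A. p l) - (\<Prod>l\<in>A. q l)\<bar> \<le> C ^ card A * (\<Sum>l\<in>A. \<bar>p l - q l\<bar>)"
  using assms(1-3)
proof (induction A rule: finite_induct)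
  case (insert l A)
  let ?p = "\<Prod>l\<in>A. p l" and ?q = "\<Prod>l\<in>A. q l" and ?S = "\<Sum>l\<in>A. \<bar>p l - q l\<bar>"
  have P: "\<bar>?p\<bar> \<le> C ^ card A"
    unfolding abs_prod using prod_mono[of A "\<lambda>l. \<bar>p l\<bar>" "\<lambda>_. C"] insert.prems by simp
  have "p l * ?p - q l * ?q = (p l - q l) * ?p + q l * (?p - ?q)" by (simp add: algebra_simps)
  then have "\<bar>p l * ?p - q l * ?q\<bar> \<le> \<bar>p l - q l\<bar> * \<bar>?p\<bar> + \<bar>q l\<bar> * \<bar>?p - ?q\<bar>"
    by (metis abs_mult abs_triangle_ineq)
  also have "\<dots> \<le> \<bar>p l - q l\<bar> * C ^ card A + C * (C ^ card A * ?S)"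
    using P insert assms(4) by (intro add_mono mult_mono mult_left_mono) auto
  also have "\<dots> \<le> \<bar>p l - q l\<bar> * (C * C ^ card A) + C * (C ^ card A * ?S)"
    using assms(4) by (intro add_right_mono mult_left_mono) (auto simp: mult_le_cancel_right1)
  finally show ?case using insert by (simp add: algebra_simps)
qed simp

text \<open>At a fixed time k the rescaled position differs from x1 by the error of the rescaled
  start and a displacement of order \<open>k / sqrt N\<close>. The change of \<phi> is compared with
  a truncated distance, whose expectation is controlled by these two terms.\<close>

lemma test_function_replacement:
  fixes I :: "(real^'n) set" and \<phi> :: "real^'n \<Rightarrow> real"
  assumes \<sigma>: "\<sigma> > 0" and M: "M > 0" and bN: "\<And>N. bN N \<in> sri_class I \<sigma> M F" and xN: "\<And>N. xN N \<in> I \<times> I"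
    and sN: "\<And>N. norm (sN N) \<le> C1" and lim: "(\<lambda>N. (1 / sqrt (real N)) *\<^sub>R fst (xN N)) \<longlonglongrightarrow> x1"
    and \<phi>: "\<phi> \<in> borel_measurable borel" "\<And>w. \<bar>\<phi> w\<bar> \<le> C" "isCont \<phi> x1"
  shows "(\<lambda>N. \<integral>R. \<bar>\<phi> ((1 / sqrt (real N)) *\<^sub>R (fst (R k) - real k *\<^sub>R sN N)) - \<phi> x1\<bar>
    \<partial>chain_law (borel_on (I \<times> I)) (bN N) (xN N)) \<longlonglongrightarrow> 0"
proof (rule tendstoI)
  fix e :: real assume e: "e > 0"
  have bk: "markov_kernel (borel_on (I \<times> I)) (bN N)" for N using bN[of N] by (auto simp: sri_class_def sri_chain_def)
  obtain \<rho> where \<rho>: "\<rho> > 0" "\<And>w. dist w x1 < \<rho> \<Longrightarrow> dist (\<phi> w) (\<phi> x1) < e / 2"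
    using \<phi>(3) e unfolding continuous_at_eps_delta by (metis half_gt_zero)
  have C: "C \<ge> 0" using \<phi>(2)[of 0] by linarith
  \<comment> \<open>Within distance \<rho> continuity gives \<open>e / 2\<close>; beyond it the
    truncated distance equals \<rho>, and the second term is the trivial bound
    \<open>2 * C\<close>.\<close>
  have pw: "\<bar>\<phi> w - \<phi> x1\<bar> \<le> e / 2 + 2 * C / \<rho> * min \<rho> (norm (w - x1))" for w
  proof (cases "dist w x1 < \<rho>")
    case True
    have "0 \<le> 2 * C / \<rho> * min \<rho> (norm (w - x1))" using C \<rho> by (intro mult_nonneg_nonneg) auto
    then show ?thesis using \<rho>(2)[OF True] by (simp add: dist_real_def)
  next
    case False
    then have "2 * C / \<rho> * min \<rho> (norm (w - x1)) = 2 * C" using \<rho>(1) by (simp add: dist_norm min_def)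
    then show ?thesis using \<phi>(2)[of w] \<phi>(2)[of x1] e by linarith
  qed
  define C2 where "C2 = 1 + moment_bound \<sigma> M"
  define \<delta> where "\<delta> N = norm ((1 / sqrt (real N)) *\<^sub>R fst (xN N) - x1) + real k * (C1 + C2) * (1 / sqrt (real N))" for N
  have sq: "(\<lambda>N. 1 / sqrt (real N)) \<longlonglongrightarrow> 0"
    by (intro tendsto_divide_0[OF tendsto_const] filterlim_compose[OF _ filterlim_real_sequentially])
      (auto intro!: filterlim_at_top_imp_at_infinity sqrt_at_top)
  have "\<delta> \<longlonglongrightarrow> 0 + real k * (C1 + C2) * 0"
    unfolding \<delta>_def by (intro tendsto_add tendsto_mult tendsto_const sq tendsto_norm_zero) (use lim in \<open>simp add: LIM_zero\<close>)
  then have "(\<lambda>N. 2 * C / \<rho> * \<delta> N) \<longlonglongrightarrow> 2 * C / \<rho> * 0" by (intro tendsto_mult tendsto_const) simp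
  then have "\<forall>\<^sub>F N in sequentially. 2 * C / \<rho> * \<delta> N < e / 2" by (rule order_tendstoD(2)) (use e in simp)
  then show "\<forall>\<^sub>F N in sequentially. dist (\<integral>R. \<bar>\<phi> ((1 / sqrt (real N)) *\<^sub>R (fst (R k) - real k *\<^sub>R sN N)) - \<phi> x1\<bar>
    \<partial>chain_law (borel_on (I \<times> I)) (bN N) (xN N)) 0 < e"
    using eventually_gt_at_top[of 0]
  proof eventually_elim
    case (elim N)
    define q where "q = sqrt (real N)"
    have q: "q > 0" using elim by (simp add: q_def)
    have xs: "xN N \<in> space (borel_on (I \<times> I))" using xN by simp
    interpret L: prob_space "chain_law (borel_on (I \<times> I)) (bN N) (xN N)"
      by (rule prob_space_chain_law[OF bk xs])
    have comp [measurable]: "(\<lambda>R. fst (R k)) \<in> chain_law (borel_on (I \<times> I)) (bN N) (xN N) \<rightarrow>\<^sub>M borel"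
      by (rule measurable_compose[OF chain_law_component_measurable[OF bk xs] fst_snd_measurable_borel_on(1)])
    note [measurable] = \<phi>(1)
    let ?w = "\<lambda>R. (1 / q) *\<^sub>R (fst (R k) - real k *\<^sub>R sN N)"
    let ?a = "fst (xN N)"
    \<comment> \<open>Truncation at \<rho> after scaling by \<open>1 / q\<close> is truncation at
      \<open>\<rho> * q\<close> before it; that is the level passed to
      \<open>expected_displacement_le\<close>.\<close>
    have w: "min \<rho> (norm (?w R - x1)) \<le> 1 / q * min (\<rho> * q) (norm (fst (R k) - ?a)) + (norm ((1 / q) *\<^sub>R ?a - x1) + real k * C1 * (1 / q))" for R
    proof -
      have "?w R - x1 = (1 / q) *\<^sub>R (fst (R k) - ?a) + (((1 / q) *\<^sub>R ?a - x1) - (real k * (1 / q)) *\<^sub>R sN N)"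
        by (simp add: algebra_simps)
      then have "norm (?w R - x1) \<le> 1 / q * norm (fst (R k) - ?a) + (norm ((1 / q) *\<^sub>R ?a - x1) + real k * (1 / q) * norm (sN N))"
        using q by (simp only:) (rule order_trans[OF norm_triangle_ineq], rule add_mono, simp,
          rule order_trans[OF norm_triangle_ineq4], simp)
      moreover have "real k * (1 / q) * norm (sN N) \<le> real k * (1 / q) * C1" using q sN by (intro mult_left_mono) auto
      moreover have "1 / q * min (\<rho> * q) (norm (fst (R k) - ?a)) = min \<rho> (1 / q * norm (fst (R k) - ?a))"
        using q by (auto simp: min_def field_simps)
      moreover have "0 \<le> norm ((1 / q) *\<^sub>R ?a - x1) + real k * C1 * (1 / q)"
        using q order_trans[OF norm_ge_zero sN] by (intro add_nonneg_nonneg mult_nonneg_nonneg) auto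
      moreover have "min \<rho> p1 \<le> min \<rho> p2 + p3" if "p1 \<le> p2 + p3" "0 \<le> p3" for p1 p2 p3 :: real
        using that by (auto simp: min_def)
      ultimately show ?thesis by (simp add: mult_ac)
    qed
    have "(\<integral>R. \<bar>\<phi> (?w R) - \<phi> x1\<bar> \<partial>chain_law (borel_on (I \<times> I)) (bN N) (xN N))
      \<le> (\<integral>R. e / 2 + 2 * C / \<rho> * (1 / q * min (\<rho> * q) (norm (fst (R k) - ?a)) + (norm ((1 / q) *\<^sub>R ?a - x1) + real k * C1 * (1 / q)))
          \<partial>chain_law (borel_on (I \<times> I)) (bN N) (xN N))"
    proof (rule integral_mono)
      show "integrable (chain_law (borel_on (I \<times> I)) (bN N) (xN N)) (\<lambda>R. \<bar>\<phi> (?w R) - \<phi> x1\<bar>)"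
      proof (rule L.integrable_const_bound[where B="2 * C"])
        have "\<bar>\<phi> v - \<phi> x1\<bar> \<le> 2 * C" for v using \<phi>(2)[of v] \<phi>(2)[of x1] by linarith
        then show "AE R in chain_law (borel_on (I \<times> I)) (bN N) (xN N). norm \<bar>\<phi> (?w R) - \<phi> x1\<bar> \<le> 2 * C" by simp
      qed measurable
      show "integrable (chain_law (borel_on (I \<times> I)) (bN N) (xN N))
          (\<lambda>R. e / 2 + 2 * C / \<rho> * (1 / q * min (\<rho> * q) (norm (fst (R k) - ?a)) + (norm ((1 / q) *\<^sub>R ?a - x1) + real k * C1 * (1 / q))))"
        using \<rho> q by (intro Bochner_Integration.integrable_add integrable_mult_right L.integrable_const
            L.integrable_const_bound[where B="\<rho> * q" and f="\<lambda>R. min (\<rho> * q) (norm (fst (R k) - ?a))"]) auto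
      fix R
      have "\<bar>\<phi> (?w R) - \<phi> x1\<bar> \<le> e / 2 + 2 * C / \<rho> * min \<rho> (norm (?w R - x1))" by (rule pw)
      also have "\<dots> \<le> e / 2 + 2 * C / \<rho> * (1 / q * min (\<rho> * q) (norm (fst (R k) - ?a)) + (norm ((1 / q) *\<^sub>R ?a - x1) + real k * C1 * (1 / q)))"
        using C \<rho> by (intro add_left_mono mult_left_mono w) auto
      finally show "\<bar>\<phi> (?w R) - \<phi> x1\<bar> \<le> e / 2 + 2 * C / \<rho> * (1 / q * min (\<rho> * q) (norm (fst (R k) - ?a)) + (norm ((1 / q) *\<^sub>R ?a - x1) + real k * C1 * (1 / q)))" .
    qed
    also have "\<dots> = e / 2 + 2 * C / \<rho> * (1 / q * (\<integral>R. min (\<rho> * q) (norm (fst (R k) - ?a)) \<partial>chain_law (borel_on (I \<times> I)) (bN N) (xN N))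
        + (norm ((1 / q) *\<^sub>R ?a - x1) + real k * C1 * (1 / q)))"
    proof -
      have i: "integrable (chain_law (borel_on (I \<times> I)) (bN N) (xN N)) (\<lambda>R. min (\<rho> * q) (norm (fst (R k) - ?a)))"
        using \<rho> q by (intro L.integrable_const_bound[where B="\<rho> * q"]) auto
      have "(\<integral>R. c1 + c2 * (c3 * min (\<rho> * q) (norm (fst (R k) - ?a)) + c4) \<partial>chain_law (borel_on (I \<times> I)) (bN N) (xN N))
        = c1 + c2 * (c3 * (\<integral>R. min (\<rho> * q) (norm (fst (R k) - ?a)) \<partial>chain_law (borel_on (I \<times> I)) (bN N) (xN N)) + c4)" for c1 c2 c3 c4
        using i by (simp add: L.prob_space distrib_left)
      then show ?thesis .
    qed
    also have "\<dots> \<le> e / 2 + 2 * C / \<rho> * (1 / q * (real k * C2) + (norm ((1 / q) *\<^sub>R ?a - x1) + real k * C1 * (1 / q)))"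
      using expected_displacement_le[OF \<sigma> M bN xN, of "\<rho> * q" N N k ?a] C \<rho> q
      by (intro add_left_mono mult_left_mono add_right_mono) (auto simp: C2_def)
    also have "1 / q * (real k * C2) + (norm ((1 / q) *\<^sub>R ?a - x1) + real k * C1 * (1 / q)) = \<delta> N"
      by (simp add: \<delta>_def q_def algebra_simps)
    finally show ?case using elim(1) unfolding q_def dist_real_def by (simp add: Bochner_Integration.integral_nonneg)
  qed
qed

text \<open>\<open>pot K z ^ 5\<close> is \<open>s powr (-5/4)\<close> and hence at least
  \<open>1 / s^2\<close>; as \<open>s^2\<close> grows like a fourth power of \<open>norm z\<close>,
  \<open>power4_le_exp\<close> applies. This makes exponentially decaying functions comparable with
  the weights in \<open>late_sum\<close>.\<close>

lemma exp_le_pot_power5: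
  fixes c K :: real
  assumes "c > 0" "K \<ge> 1"
  shows "\<exists>C>0. \<forall>z::'a::real_normed_vector. exp (- c * norm z) \<le> C * pot K z ^ 5"
proof (intro exI[of _ "K\<^sup>2 * (256 / c ^ 4 * exp c)"] conjI allI)
  show "0 < K\<^sup>2 * (256 / c ^ 4 * exp c)" using assms by simp
  fix z :: 'a
  define s where "s = K + (norm z)\<^sup>2"
  have s1: "s \<ge> 1" using assms by (simp add: s_def add_increasing2)
  have "s powr (-1) \<le> s powr (-1/4)" using s1 by (intro powr_mono) auto
  then have "1 / s \<le> pot K z" using s1 by (simp add: pot_def s_def powr_minus_divide)
  then have "1 / s / s \<le> pot K z / s" using s1 by (intro divide_right_mono) auto
  then have p: "1 / s\<^sup>2 \<le> pot K z ^ 5" unfolding pot_power5[OF assms(2)] s_def[symmetric] by (simp add: power2_eq_square)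
  have "s \<le> K * (1 + norm z)\<^sup>2"
  proof -
    have "1 * (norm z)\<^sup>2 \<le> K * (norm z)\<^sup>2" using assms by (intro mult_right_mono) auto
    moreover have "0 \<le> K * (2 * norm z)" using assms by simp
    ultimately show ?thesis by (simp add: s_def power2_sum algebra_simps)
  qed
  then have "s\<^sup>2 \<le> (K * (1 + norm z)\<^sup>2)\<^sup>2" using s1 by (intro power_mono) auto
  also have "\<dots> = K\<^sup>2 * (1 + norm z) ^ 4" by (simp add: power_mult_distrib flip: power_mult)
  also have "\<dots> \<le> K\<^sup>2 * (256 / c ^ 4 * exp (c * (1 + norm z)))"
    using assms by (intro mult_left_mono power4_le_exp) auto
  finally have "exp (- c * norm z) * s\<^sup>2 \<le> exp (- c * norm z) * (K\<^sup>2 * (256 / c ^ 4 * exp (c * (1 + norm z))))"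
    by (intro mult_left_mono) auto
  also have "\<dots> = K\<^sup>2 * (256 / c ^ 4 * exp c)" by (simp add: exp_minus exp_add distrib_left field_simps)
  finally have "exp (- c * norm z) \<le> K\<^sup>2 * (256 / c ^ 4 * exp c) * (1 / s\<^sup>2)"
    using s1 by (simp only: times_divide_eq_right mult_1_right) (simp add: pos_le_divide_eq del: times_divide_eq_right times_divide_eq_left)
  also have "\<dots> \<le> K\<^sup>2 * (256 / c ^ 4 * exp c) * pot K z ^ 5" using p assms by (intro mult_left_mono) auto
  finally show "exp (- c * norm z) \<le> K\<^sup>2 * (256 / c ^ 4 * exp c) * pot K z ^ 5" .
qed

section \<open>Termwise limits combined with uniform tails\<close>

section \<open>Limits of multi-time functionals\<close>

lemma dif_kernel_tv_tendsto:
  fixes I :: "'a::euclidean_space set"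
  assumes I: "0 \<in> I" "\<forall>x\<in>I. \<forall>y\<in>I. x + y \<in> I" "\<forall>x\<in>I. - x \<in> I"
    and bN: "\<And>N. markov_kernel (borel_on (I \<times> I)) (bN N)" and b: "markov_kernel (borel_on (I \<times> I)) b"
    and lim: "(\<lambda>N. d_sri I (bN N) b) \<longlonglongrightarrow> 0"
    and cont: "\<forall>x\<in>I. ((\<lambda>x'. tv_dist (dif_kernel I b x') (dif_kernel I b x)) \<longlongrightarrow> 0) (at x within I)"
    and z: "\<And>N. zN N \<in> I" "z \<in> I" "zN \<longlonglongrightarrow> z"
  shows "(\<lambda>N. tv_dist (dif_kernel I (bN N) (zN N)) (dif_kernel I b z)) \<longlonglongrightarrow> 0"
proof -
  have k: "prob_space (dif_kernel I b' w)" "sets (dif_kernel I b' w) = sets (borel_on I)"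
    if "markov_kernel (borel_on (I \<times> I)) b'" "w \<in> I" for b' w
    using markov_kernelD[OF markov_kernel_dif_kernel[OF I that(1)], of w] that(2) by auto
  \<comment> \<open>The limit in condition (F) is punctured at z while the sequence may hit z; the
    value 0 at z itself turns it into continuity.\<close>
  have 0: "tv_dist (dif_kernel I b z) (dif_kernel I b z) = 0"
    unfolding tv_dist_def diff_self abs_zero by (rule cSUP_const) (use sets.empty_sets in blast)
  have "((\<lambda>x'. tv_dist (dif_kernel I b x') (dif_kernel I b z)) \<longlongrightarrow> 0) (at z within I)" using cont z(2) by blast
  then have c: "continuous (at z within I) (\<lambda>x'. tv_dist (dif_kernel I b x') (dif_kernel I b z))"
    by (simp add: continuous_within 0)
  have 1: "(\<lambda>N. tv_dist (dif_kernel I b (zN N)) (dif_kernel I b z)) \<longlonglongrightarrow> 0"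
    using continuous_within_tendsto_compose[OF c _ z(3)] z(1) 0 by (simp add: always_eventually)
  show ?thesis
  proof (rule tendsto_sandwich[OF always_eventually always_eventually tendsto_const])
    show "\<forall>N. 0 \<le> tv_dist (dif_kernel I (bN N) (zN N)) (dif_kernel I b z)"
      using k[OF bN z(1)] k[OF b z(2)] by (auto intro: tv_dist_nonneg)
    show "\<forall>N. tv_dist (dif_kernel I (bN N) (zN N)) (dif_kernel I b z)
        \<le> d_sri I (bN N) b + tv_dist (dif_kernel I b (zN N)) (dif_kernel I b z)"
    proof
      fix N
      have "tv_dist (dif_kernel I (bN N) (zN N)) (dif_kernel I b z)
        \<le> tv_dist (dif_kernel I (bN N) (zN N)) (dif_kernel I b (zN N)) + tv_dist (dif_kernel I b (zN N)) (dif_kernel I b z)"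
        using k[OF bN z(1)] k[OF b z(1)] k[OF b z(2)] by (intro tv_dist_triangle) auto
      then show "tv_dist (dif_kernel I (bN N) (zN N)) (dif_kernel I b z)
        \<le> d_sri I (bN N) b + tv_dist (dif_kernel I b (zN N)) (dif_kernel I b z)"
        using tv_dist_dif_kernel_le[OF I bN b z(1), of N N] by linarith
    qed
    show "(\<lambda>N. d_sri I (bN N) b + tv_dist (dif_kernel I b (zN N)) (dif_kernel I b z)) \<longlonglongrightarrow> 0"
      using tendsto_add[OF lim 1] by simp
  qed
qed

lemma integral_prod_increasing_times:
  fixes h :: "nat \<Rightarrow> 'a \<Rightarrow> real"
  assumes K: "markov_kernel S K" and x: "x \<in> space S" and r: "r \<in> increasing_times m" and n: "\<forall>l\<in>{1..m}. r l < n"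
    and h: "\<And>l. l \<in> {1..m} \<Longrightarrow> h l \<in> borel_measurable S" and C: "\<And>l y. l \<in> {1..m} \<Longrightarrow> y \<in> space S \<Longrightarrow> \<bar>h l y\<bar> \<le> C"
  shows "(\<integral>R. (\<Prod>l\<in>{1..m}. h l (R (r l))) \<partial>chain_law S K x)
    = chain_prod K n (\<lambda>k y. if k \<in> r ` {1..m} then h (inv_into {1..m} r k) y else 1) x"
proof -
  have inv: "inv_into {1..m} r k \<in> {1..m}" if "k \<in> r ` {1..m}" for k using that by (rule inv_into_into)
  have "(\<Prod>l\<in>{1..m}. h l (R (r l))) = (\<Prod>k<n. if k \<in> r ` {1..m} then h (inv_into {1..m} r k) (R k) else 1)" for R :: "nat \<Rightarrow> 'a"
    by (rule prod_increasing_times[OF r n, where g="\<lambda>l k. h l (R k)"])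
  moreover have "(\<integral>R. (\<Prod>k<n. if k \<in> r ` {1..m} then h (inv_into {1..m} r k) (R k) else 1) \<partial>chain_law S K x)
    = chain_prod K n (\<lambda>k y. if k \<in> r ` {1..m} then h (inv_into {1..m} r k) y else 1) x"
  proof (rule integral_chain_law_prod[OF K x, where C="max C 1"])
    show "(\<lambda>y. if k \<in> r ` {1..m} then h (inv_into {1..m} r k) y else 1) \<in> borel_measurable S" for k
      using h inv by (cases "k \<in> r ` {1..m}") simp_all
    show "\<bar>if k \<in> r ` {1..m} then h (inv_into {1..m} r k) y else 1\<bar> \<le> max C 1" if "y \<in> space S" for k y
    proof (cases "k \<in> r ` {1..m}")
      case True
      then show ?thesis using C[OF inv[OF True] that] by (simp only: if_True)
    qed simp
  qed simp
  ultimately show ?thesis by simp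
qed

text \<open>The analytic input is reduced to a common Lyapunov drift, continuity of the limit kernel
  and a bound on s_N. The functions f^l depend on N from the start and converge along convergent
  sequences of points; measurability and boundedness of the limit follow from this.\<close>

lemma multi_time_limit:
  fixes I :: "(real^'n) set" and \<phi> :: "nat \<Rightarrow> real^'n \<Rightarrow> real"
  assumes I: "0 \<in> I" "\<forall>x\<in>I. \<forall>y\<in>I. x + y \<in> I" "\<forall>x\<in>I. - x \<in> I" and \<sigma>: "\<sigma> > 0" and M: "M > 0"
    and bN: "\<And>N. bN N \<in> sri_class I \<sigma> M F" and inv: "\<And>N. diag_trans_inv I (bN N)"
    and b: "markov_kernel (borel_on (I \<times> I)) b" and lim: "(\<lambda>N. d_sri I (bN N) b) \<longlonglongrightarrow> 0"
    and cont: "\<forall>x\<in>I. ((\<lambda>x'. tv_dist (dif_kernel I b x') (dif_kernel I b x)) \<longlongrightarrow> 0) (at x within I)"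
    and lyap: "K \<ge> 1" "0 < c" "c \<le> 1" "\<forall>\<^sub>F N in sequentially. lyapunov_chain (borel_on (I \<times> I)) (bN N) (\<lambda>x. pot K (fst x - snd x)) c"
    and xN: "\<And>N. xN N \<in> I \<times> I" and x1: "(\<lambda>N. (1 / sqrt (real N)) *\<^sub>R fst (xN N)) \<longlonglongrightarrow> x1"
    and y: "y \<in> I" "(\<lambda>N. fst (xN N) - snd (xN N)) \<longlonglongrightarrow> y" and sN: "\<And>N. norm (sN N) \<le> C1"
    and \<phi>: "\<And>l. l \<in> {1..m} \<Longrightarrow> \<phi> l \<in> borel_measurable borel" "\<And>l w. l \<in> {1..m} \<Longrightarrow> \<bar>\<phi> l w\<bar> \<le> C\<phi>"
      "\<And>l. l \<in> {1..m} \<Longrightarrow> isCont (\<phi> l) x1" and C\<phi>: "C\<phi> \<ge> 1"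
    and fm: "\<And>N l. l \<in> {1..m} \<Longrightarrow> fN N l \<in> borel_measurable (borel_on I)"
    and fd: "\<And>N l z. l \<in> {1..m} \<Longrightarrow> z \<in> I \<Longrightarrow> \<bar>fN N l z\<bar> \<le> A * exp (- a * norm z)" and Aa: "A > 0" "a > 0"
    and flim: "\<And>l zN z. l \<in> {1..m} \<Longrightarrow> (\<And>N. zN N \<in> I) \<Longrightarrow> z \<in> I \<Longrightarrow> zN \<longlonglongrightarrow> z \<Longrightarrow> (\<lambda>N. fN N l (zN N)) \<longlonglongrightarrow> f l z"
    and t: "t > 0"
  shows "(\<lambda>r. (\<Prod>l\<in>{1..m}. \<phi> l x1) * dif_correlation I (dif_kernel I b) y m f r) summable_on (increasing_times m)"
    "(\<lambda>N. prelimit_functional I (bN N) (xN N) (sN N) N t m (fN N) \<phi>)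
      \<longlonglongrightarrow> (\<Sum>\<^sub>\<infinity>r\<in>increasing_times m. (\<Prod>l\<in>{1..m}. \<phi> l x1) * dif_correlation I (dif_kernel I b) y m f r)"
proof -
  let ?S = "borel_on (I \<times> I)"
  have bk: "markov_kernel ?S (bN N)" for N using bN[of N] by (auto simp: sri_class_def sri_chain_def)
  have xs: "xN N \<in> space ?S" for N using xN by simp
  define L where "L N = chain_law ?S (bN N) (xN N)" for N
  have Lp: "prob_space (L N)" for N unfolding L_def by (rule prob_space_chain_law[OF bk xs])
  have Ls: "\<omega> k \<in> I \<times> I" if "\<omega> \<in> space (L N)" for \<omega> k N
    using that unfolding L_def chain_law_space[OF bk xs] by auto
  define ff where "ff N l k R = fN N l (fst (R k) - snd (R k))" for N l k and R :: "nat \<Rightarrow> (real^'n) \<times> (real^'n)"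
  define pp where "pp N l k R = \<phi> l ((1 / sqrt (real N)) *\<^sub>R (fst (R k) - real k *\<^sub>R sN N))" for N l k and R :: "nat \<Rightarrow> (real^'n) \<times> (real^'n)"
  have ffm: "ff N l k \<in> borel_measurable (L N)" if "l \<in> {1..m}" for N l k
    unfolding ff_def L_def
    by (rule measurable_compose[OF measurable_compose[OF chain_law_component_measurable[OF bk xs] dif_map_measurable[OF I(2,3)]] fm[OF that]])
  have ppm: "pp N l k \<in> borel_measurable (L N)" if "l \<in> {1..m}" for N l k
  proof -
    have "(\<lambda>R. fst (R k)) \<in> L N \<rightarrow>\<^sub>M borel" unfolding L_def
      by (rule measurable_compose[OF chain_law_component_measurable[OF bk xs] fst_snd_measurable_borel_on(1)])
    then have "(\<lambda>R. (1 / sqrt (real N)) *\<^sub>R (fst (R k) - real k *\<^sub>R sN N)) \<in> L N \<rightarrow>\<^sub>M borel" by measurable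
    from measurable_compose[OF this \<phi>(1)[OF that]] show ?thesis unfolding pp_def .
  qed
  have dI: "fst w - snd w \<in> I" if "w \<in> I \<times> I" for w :: "(real^'n) \<times> (real^'n)"
    using that I by (metis SigmaE add_uminus_conv_diff fst_conv snd_conv)
  have fA: "\<bar>fN N l z\<bar> \<le> A" if "l \<in> {1..m}" "z \<in> I" for N l z
  proof -
    have "A * exp (- a * norm z) \<le> A * 1" using Aa by (intro mult_left_mono) auto
    then show ?thesis using fd[OF that, of N] by linarith
  qed
  have ffb: "\<bar>ff N l k R\<bar> \<le> A" if "l \<in> {1..m}" "R \<in> space (L N)" for N l k R
    unfolding ff_def by (rule fA[OF that(1) dI[OF Ls[OF that(2)]]])
  have ppb: "\<bar>pp N l k R\<bar> \<le> C\<phi>" if "l \<in> {1..m}" for N l k R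
    unfolding pp_def by (rule \<phi>(2)[OF that])
  define aN where "aN N r = (\<integral>R. (\<Prod>l\<in>{1..m}. ff N l (r l) R * pp N l (r l) R) \<partial>L N)" for N r
  define \<Phi> where "\<Phi> = (\<Prod>l\<in>{1..m}. \<phi> l x1)"
  define D where "D N = {r \<in> increasing_times m. \<forall>l\<in>{1..m}. real (r l) \<le> real N * t}" for N
  have prodm: "(\<lambda>R. \<Prod>l\<in>{1..m}. ff N l (r l) R * pp N l (r l) R) \<in> borel_measurable (L N)" for N r
    by (intro borel_measurable_prod borel_measurable_times ffm ppm)
  have prodfm: "(\<lambda>R. \<Prod>l\<in>{1..m}. ff N l (r l) R) \<in> borel_measurable (L N)" for N r
    by (intro borel_measurable_prod ffm)
  have prodb: "\<bar>\<Prod>l\<in>{1..m}. ff N l (r l) R * pp N l (r l) R\<bar> \<le> (A * C\<phi>) ^ m" if "R \<in> space (L N)" for N r R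
  proof -
    have "\<bar>\<Prod>l\<in>{1..m}. ff N l (r l) R * pp N l (r l) R\<bar> \<le> (\<Prod>l\<in>{1..m}. A * C\<phi>)"
      unfolding abs_prod abs_mult using Aa C\<phi> ffb[OF _ that] ppb
      by (intro prod_mono conjI mult_mono) auto
    then show ?thesis by simp
  qed
  have prodfb: "\<bar>\<Prod>l\<in>{1..m}. ff N l (r l) R\<bar> \<le> A ^ m" if "R \<in> space (L N)" for N r R
  proof -
    have "\<bar>\<Prod>l\<in>{1..m}. ff N l (r l) R\<bar> \<le> (\<Prod>l\<in>{1..m}. A)"
      unfolding abs_prod using ffb[OF _ that] by (intro prod_mono conjI) auto
    then show ?thesis by simp
  qed
  have prodi: "integrable (L N) (\<lambda>R. \<Prod>l\<in>{1..m}. ff N l (r l) R * pp N l (r l) R)" for N r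
    by (rule finite_measure.integrable_const_bound[OF prob_space.finite_measure[OF Lp], where B="(A * C\<phi>) ^ m"])
      (use prodm prodb in auto)
  have prodfi: "integrable (L N) (\<lambda>R. \<Prod>l\<in>{1..m}. ff N l (r l) R)" for N r
    by (rule finite_measure.integrable_const_bound[OF prob_space.finite_measure[OF Lp], where B="A ^ m"])
      (use prodfm prodfb in auto)
  have Dfin: "finite (D N)" for N
  proof (rule finite_subset[OF _ finite_increasing_times_bounded[of m "Suc (nat \<lfloor>real N * t\<rfloor>)"]])
    show "D N \<subseteq> {r \<in> increasing_times m. \<forall>l\<in>{1..m}. r l < Suc (nat \<lfloor>real N * t\<rfloor>)}"
      unfolding D_def by (auto simp: less_Suc_eq_le le_nat_floor)
  qed
  have pre: "prelimit_functional I (bN N) (xN N) (sN N) N t m (fN N) \<phi> = (\<Sum>r\<in>D N. aN N r)" for N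
    unfolding prelimit_functional_def aN_def L_def[symmetric] D_def[symmetric]
    by (subst Bochner_Integration.integral_sum[symmetric]) (use prodi in \<open>auto simp: ff_def pp_def\<close>)
  have lim_f: "(\<lambda>N. \<integral>R. (\<Prod>l\<in>{1..m}. ff N l (r l) R) \<partial>L N) \<longlonglongrightarrow> dif_correlation I (dif_kernel I b) y m f r"
    if r: "r \<in> increasing_times m" for r
  proof -
    have "finite (r ` {1..m})" by simp
    then obtain n where n: "\<forall>l\<in>{1..m}. r l < n" unfolding finite_nat_set_iff_bounded by auto
    define h where "h g = (\<lambda>k z. if k \<in> r ` {1..m} then g (inv_into {1..m} r k) z else 1)" for g :: "nat \<Rightarrow> real^'n \<Rightarrow> real"
    have into: "inv_into {1..m} r k \<in> {1..m}" if "k \<in> r ` {1..m}" for k using that by (rule inv_into_into)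
    have hm: "h (fN N) k \<in> borel_measurable (borel_on I)" for N k
      unfolding h_def using fm into by (cases "k \<in> r ` {1..m}") simp_all
    have "(\<integral>R. (\<Prod>l\<in>{1..m}. ff N l (r l) R) \<partial>L N) = chain_prod (dif_kernel I (bN N)) n (h (fN N)) (fst (xN N) - snd (xN N))" for N
    proof -
      have "(\<integral>R. (\<Prod>l\<in>{1..m}. ff N l (r l) R) \<partial>L N)
          = chain_prod (bN N) n (\<lambda>k x. if k \<in> r ` {1..m} then fN N (inv_into {1..m} r k) (fst x - snd x) else 1) (xN N)"
        unfolding ff_def L_def
      proof (rule integral_prod_increasing_times[OF bk xs r n])
        show "(\<lambda>x. fN N l (fst x - snd x)) \<in> borel_measurable ?S" if "l \<in> {1..m}" for l
          by (rule measurable_compose[OF dif_map_measurable[OF I(2,3)] fm[OF that]])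
        show "\<bar>fN N l (fst x - snd x)\<bar> \<le> A" if "l \<in> {1..m}" "x \<in> space ?S" for l x
          using fA[OF that(1) dI] that(2) by simp
      qed
      also have "\<dots> = chain_prod (bN N) n (\<lambda>k x. h (fN N) k (fst x - snd x)) (xN N)" by (simp add: h_def)
      also have "\<dots> = chain_prod (dif_kernel I (bN N)) n (h (fN N)) (fst (xN N) - snd (xN N))"
        by (rule chain_prod_dif[OF I bk inv xN hm])
      finally show ?thesis .
    qed
    moreover have "(\<lambda>N. chain_prod (dif_kernel I (bN N)) n (h (fN N)) (fst (xN N) - snd (xN N)))
        \<longlonglongrightarrow> chain_prod (dif_kernel I b) n (h f) y"
    proof (rule chain_prod_tendsto[where C="max A 1"])
      show "\<bar>h (fN N) k z\<bar> \<le> max A 1" if "z \<in> I" for N k z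
        using fA[OF into that, of k N] by (auto simp: h_def)
      show "(\<lambda>N. h (fN N) k (zN N)) \<longlonglongrightarrow> h f k z" if "\<And>N. zN N \<in> I" "z \<in> I" "zN \<longlonglongrightarrow> z" for k zN z
        using flim[OF into that, of k] by (cases "k \<in> r ` {1..m}") (simp_all add: h_def)
      show "(\<lambda>N. tv_dist (dif_kernel I (bN N) (zN N)) (dif_kernel I b z)) \<longlonglongrightarrow> 0"
        if "\<And>N. zN N \<in> I" "z \<in> I" "zN \<longlonglongrightarrow> z" for zN z
        by (rule dif_kernel_tv_tendsto[OF I bk b lim cont that])
    qed (use hm dI xN y Aa markov_kernel_dif_kernel[OF I bk] markov_kernel_dif_kernel[OF I b] in auto)
    moreover have "dif_correlation I (dif_kernel I b) y m f r = chain_prod (dif_kernel I b) n (h f) y"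
      unfolding dif_correlation_def h_def
    proof (rule integral_prod_increasing_times[OF markov_kernel_dif_kernel[OF I b] _ r n, where C=A])
      have lf: "(\<lambda>N. fN N l z) \<longlonglongrightarrow> f l z" if "l \<in> {1..m}" "z \<in> I" for l z
        by (rule flim[OF that(1)]) (use that in auto)
      show "f l \<in> borel_measurable (borel_on I)" if l: "l \<in> {1..m}" for l
        by (rule borel_measurable_LIMSEQ_real[OF _ fm[OF l]]) (use lf[OF l] in simp)
      show "\<bar>f l z\<bar> \<le> A" if l: "l \<in> {1..m}" and z: "z \<in> space (borel_on I)" for l z
        by (rule LIMSEQ_le_const2[OF tendsto_rabs[OF lf[OF l]]]) (use z fA[OF l] in auto)
    qed (use y in simp)
    ultimately show ?thesis by simp
  qed
  \<comment> \<open>The \<phi>-factors are frozen at x1 while the f-factors still vary with N and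
    are merely bounded. By \<open>abs_prod_diff_le\<close> the error is a multiple of a sum of
    one-time errors.\<close>
  have lim_a: "(\<lambda>N. aN N r) \<longlonglongrightarrow> \<Phi> * dif_correlation I (dif_kernel I b) y m f r" if r: "r \<in> increasing_times m" for r
  proof -
    define E where "E N = A ^ m * C\<phi> ^ m * (\<Sum>l\<in>{1..m}. \<integral>R. \<bar>pp N l (r l) R - \<phi> l x1\<bar> \<partial>L N)" for N
    have "(\<lambda>N. \<integral>R. \<bar>pp N l (r l) R - \<phi> l x1\<bar> \<partial>L N) \<longlonglongrightarrow> 0" if "l \<in> {1..m}" for l
      unfolding pp_def L_def by (rule test_function_replacement[OF \<sigma> M bN xN sN x1 \<phi>[OF that]])
    then have "E \<longlonglongrightarrow> A ^ m * C\<phi> ^ m * (\<Sum>l\<in>{1..m}. 0)"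
      unfolding E_def by (intro tendsto_mult tendsto_const tendsto_sum)
    then have E0: "E \<longlonglongrightarrow> 0" by simp
    have "\<bar>aN N r - \<Phi> * (\<integral>R. (\<Prod>l\<in>{1..m}. ff N l (r l) R) \<partial>L N)\<bar> \<le> E N" for N
    proof -
      interpret prob_space "L N" by (rule Lp)
      have pi: "integrable (L N) (\<lambda>R. \<bar>pp N l (r l) R - \<phi> l x1\<bar>)" if "l \<in> {1..m}" for l
      proof (rule integrable_const_bound[where B="2 * C\<phi>"])
        have "\<bar>pp N l (r l) R - \<phi> l x1\<bar> \<le> 2 * C\<phi>" for R using ppb[OF that, of N "r l" R] \<phi>(2)[OF that, of x1] by linarith
        then show "AE R in L N. norm \<bar>pp N l (r l) R - \<phi> l x1\<bar> \<le> 2 * C\<phi>" by simp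
      qed (use ppm[OF that] in measurable)
      have eq: "aN N r - \<Phi> * (\<integral>R. (\<Prod>l\<in>{1..m}. ff N l (r l) R) \<partial>L N)
          = (\<integral>R. (\<Prod>l\<in>{1..m}. ff N l (r l) R * pp N l (r l) R) - \<Phi> * (\<Prod>l\<in>{1..m}. ff N l (r l) R) \<partial>L N)"
        unfolding aN_def using prodi[of N r] prodfi[of N r] by simp
      have "\<bar>aN N r - \<Phi> * (\<integral>R. (\<Prod>l\<in>{1..m}. ff N l (r l) R) \<partial>L N)\<bar>
          \<le> (\<integral>R. A ^ m * C\<phi> ^ m * (\<Sum>l\<in>{1..m}. \<bar>pp N l (r l) R - \<phi> l x1\<bar>) \<partial>L N)"
        unfolding eq
      proof (rule integral_abs_bound[THEN order_trans], rule integral_mono)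
        show "integrable (L N) (\<lambda>R. \<bar>(\<Prod>l\<in>{1..m}. ff N l (r l) R * pp N l (r l) R) - \<Phi> * (\<Prod>l\<in>{1..m}. ff N l (r l) R)\<bar>)"
          using prodi[of N r] prodfi[of N r] by (intro integrable_abs Bochner_Integration.integrable_diff integrable_mult_right)
        show "integrable (L N) (\<lambda>R. A ^ m * C\<phi> ^ m * (\<Sum>l\<in>{1..m}. \<bar>pp N l (r l) R - \<phi> l x1\<bar>))"
          by (intro integrable_mult_right Bochner_Integration.integrable_sum pi)
        fix R assume R: "R \<in> space (L N)"
        have "(\<Prod>l\<in>{1..m}. ff N l (r l) R * pp N l (r l) R) - \<Phi> * (\<Prod>l\<in>{1..m}. ff N l (r l) R)
            = (\<Prod>l\<in>{1..m}. ff N l (r l) R) * ((\<Prod>l\<in>{1..m}. pp N l (r l) R) - (\<Prod>l\<in>{1..m}. \<phi> l x1))"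
          unfolding prod.distrib \<Phi>_def right_diff_distrib by (simp only: mult.commute)
        also have "\<bar>\<dots>\<bar> = \<bar>\<Prod>l\<in>{1..m}. ff N l (r l) R\<bar> * \<bar>(\<Prod>l\<in>{1..m}. pp N l (r l) R) - (\<Prod>l\<in>{1..m}. \<phi> l x1)\<bar>"
          by (rule abs_mult)
        also have "\<dots> \<le> A ^ m * (C\<phi> ^ card {1..m} * (\<Sum>l\<in>{1..m}. \<bar>pp N l (r l) R - \<phi> l x1\<bar>))"
          using Aa by (intro mult_mono prodfb[OF R] abs_prod_diff_le ppb \<phi>(2) C\<phi>) auto
        finally show "\<bar>(\<Prod>l\<in>{1..m}. ff N l (r l) R * pp N l (r l) R) - \<Phi> * (\<Prod>l\<in>{1..m}. ff N l (r l) R)\<bar>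
            \<le> A ^ m * C\<phi> ^ m * (\<Sum>l\<in>{1..m}. \<bar>pp N l (r l) R - \<phi> l x1\<bar>)" by (simp add: mult.assoc)
      qed
      also have "\<dots> = A ^ m * C\<phi> ^ m * (\<integral>R. (\<Sum>l\<in>{1..m}. \<bar>pp N l (r l) R - \<phi> l x1\<bar>) \<partial>L N)"
        by (rule integral_mult_right_zero)
      also have "(\<integral>R. (\<Sum>l\<in>{1..m}. \<bar>pp N l (r l) R - \<phi> l x1\<bar>) \<partial>L N)
          = (\<Sum>l\<in>{1..m}. \<integral>R. \<bar>pp N l (r l) R - \<phi> l x1\<bar> \<partial>L N)"
        by (rule Bochner_Integration.integral_sum, rule pi)
      finally show ?thesis unfolding E_def .
    qed
    then have "(\<lambda>N. aN N r - \<Phi> * (\<integral>R. (\<Prod>l\<in>{1..m}. ff N l (r l) R) \<partial>L N)) \<longlonglongrightarrow> 0"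
      by (intro Lim_null_comparison[OF _ E0]) simp
    from tendsto_add[OF this tendsto_mult_left[OF lim_f[OF r], of \<Phi>]] show ?thesis by simp
  qed
  obtain C0' where C0': "C0' > 0" "\<And>z::real^'n. exp (- a * norm z) \<le> C0' * pot K z ^ 5"
    using exp_le_pot_power5[OF Aa(2) lyap(1)] by blast
  \<comment> \<open>Each of the m factors, f times \<phi>, is at most C0 times \<open>u ^ 5\<close>,
    so \<open>C0 ^ m\<close> compares the summands with those of \<open>late_sum\<close>.\<close>
  define C0 where "C0 = A * C0' * C\<phi>"
  have C00: "C0 > 0" using Aa C0' C\<phi> by (simp add: C0_def)
  have tails: "\<exists>Y. finite Y \<and> Y \<subseteq> increasing_times m \<and>
      (\<forall>\<^sub>F N in sequentially. \<forall>Z. finite Z \<and> Z \<subseteq> increasing_times m - Y \<longrightarrow> (\<Sum>r\<in>Z. \<bar>aN N r\<bar>) \<le> \<eta>)" if \<eta>: "\<eta> > 0" for \<eta>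
  proof -
    have "\<eta> / C0 ^ m > 0" using \<eta> C00 by simp
    from late_sum_uniformly_small[OF lyap(2,3) this, of m, where 'a="(real^'n) \<times> (real^'n)"]
    obtain T where T: "\<And>S K u n x. lyapunov_chain (S :: ((real^'n) \<times> (real^'n)) measure) K u c \<Longrightarrow> x \<in> space S \<Longrightarrow>
        lyapunov_chain.late_sum K u m n T x \<le> \<eta> / C0 ^ m" by blast
    show ?thesis
    \<comment> \<open>The exceptional finite set consists of the sequences that lie entirely before
      T; any other one visits a time >= T and is counted by \<open>late_sum\<close>.\<close>
    proof (intro exI[of _ "{r \<in> increasing_times m. \<forall>l\<in>{1..m}. r l < T}"] conjI finite_increasing_times_bounded)
      show "\<forall>\<^sub>F N in sequentially. \<forall>Z. finite Z \<and> Z \<subseteq> increasing_times m - {r \<in> increasing_times m. \<forall>l\<in>{1..m}. r l < T}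
          \<longrightarrow> (\<Sum>r\<in>Z. \<bar>aN N r\<bar>) \<le> \<eta>"
        using lyap(4)
      proof eventually_elim
        case (elim N)
        then interpret ly: lyapunov_chain ?S "bN N" "\<lambda>x. pot K (fst x - snd x)" c .
        show ?case
        proof (intro allI impI, elim conjE)
          fix Z assume Z: "finite Z" "Z \<subseteq> increasing_times m - {r \<in> increasing_times m. \<forall>l\<in>{1..m}. r l < T}"
          have "finite (\<Union>r\<in>Z. r ` {1..m})" using Z by simp
          then obtain n where n: "\<And>r l. r \<in> Z \<Longrightarrow> l \<in> {1..m} \<Longrightarrow> r l < n"
            unfolding finite_nat_set_iff_bounded by blast
          have "\<bar>aN N r\<bar> \<le> C0 ^ m * chain_prod (bN N) n (ly.wt (r ` {1..m})) (xN N)" if rZ: "r \<in> Z" for r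
          proof -
            have r: "r \<in> increasing_times m" using rZ Z by auto
            have nr: "\<forall>l\<in>{1..m}. r l < n" using n rZ by auto
            define U where "U R = (\<Prod>l\<in>{1..m}. pot K (fst (R (r l)) - snd (R (r l))) ^ 5)" for R :: "nat \<Rightarrow> (real^'n) \<times> (real^'n)"
            have pm: "(\<lambda>x. pot K (fst x - snd x) ^ 5) \<in> borel_measurable ?S"
              by (intro borel_measurable_power ly.u_meas)
            have pb: "\<bar>pot K z ^ 5\<bar> \<le> 1" for z :: "real^'n"
              using pot_pos[OF lyap(1), of z] pot_le_1[OF lyap(1), of z] by (simp add: power_le_one)
            have "(\<integral>R. U R \<partial>L N) = chain_prod (bN N) n (\<lambda>k x. if k \<in> r ` {1..m} then pot K (fst x - snd x) ^ 5 else 1) (xN N)"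
              unfolding U_def L_def
              by (rule integral_prod_increasing_times[OF bk xs r nr, where h="\<lambda>_ x. pot K (fst x - snd x) ^ 5" and C=1]) (use pm pb in auto)
            then have U: "(\<integral>R. U R \<partial>L N) = chain_prod (bN N) n (ly.wt (r ` {1..m})) (xN N)"
              by (simp add: ly.wt_def[abs_def])
            interpret prob_space "L N" by (rule Lp)
            have "\<bar>aN N r\<bar> \<le> (\<integral>R. C0 ^ m * U R \<partial>L N)"
              unfolding aN_def
            proof (rule integral_abs_bound[THEN order_trans], rule integral_mono)
              show "integrable (L N) (\<lambda>R. \<bar>\<Prod>l\<in>{1..m}. ff N l (r l) R * pp N l (r l) R\<bar>)" by (intro integrable_abs prodi)
              show "integrable (L N) (\<lambda>R. C0 ^ m * U R)"
              proof (intro integrable_mult_right integrable_const_bound[where B=1])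
                show "U \<in> borel_measurable (L N)" unfolding U_def L_def
                  by (intro borel_measurable_prod measurable_compose[OF chain_law_component_measurable[OF bk xs] pm])
                have "\<bar>U R\<bar> \<le> 1" for R unfolding U_def abs_prod by (rule prod_le_1) (use pb in auto)
                then show "AE R in L N. norm (U R) \<le> 1" by simp
              qed
              fix R assume R: "R \<in> space (L N)"
              have "\<bar>\<Prod>l\<in>{1..m}. ff N l (r l) R * pp N l (r l) R\<bar> \<le> (\<Prod>l\<in>{1..m}. C0 * pot K (fst (R (r l)) - snd (R (r l))) ^ 5)"
                unfolding abs_prod
              proof (rule prod_mono, intro conjI abs_ge_zero)
                fix l assume l: "l \<in> {1..m}"
                let ?z = "fst (R (r l)) - snd (R (r l))"
                have "\<bar>ff N l (r l) R\<bar> \<le> A * exp (- a * norm ?z)"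
                  unfolding ff_def by (rule fd[OF l dI[OF Ls[OF R]]])
                also have "\<dots> \<le> A * (C0' * pot K ?z ^ 5)" using Aa C0' by (intro mult_left_mono) auto
                finally have "\<bar>ff N l (r l) R\<bar> * \<bar>pp N l (r l) R\<bar> \<le> A * (C0' * pot K ?z ^ 5) * C\<phi>"
                  using ppb[OF l] Aa C0' pot_pos[OF lyap(1), of ?z] by (intro mult_mono) auto
                then show "\<bar>ff N l (r l) R * pp N l (r l) R\<bar> \<le> C0 * pot K ?z ^ 5"
                  by (simp add: abs_mult C0_def mult_ac)
              qed
              also have "\<dots> = C0 ^ m * U R" by (simp add: prod.distrib U_def)
              finally show "\<bar>\<Prod>l\<in>{1..m}. ff N l (r l) R * pp N l (r l) R\<bar> \<le> C0 ^ m * U R" .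
            qed
            then show ?thesis using U by simp
          qed
          then have "(\<Sum>r\<in>Z. \<bar>aN N r\<bar>) \<le> (\<Sum>r\<in>Z. C0 ^ m * chain_prod (bN N) n (ly.wt (r ` {1..m})) (xN N))"
            by (rule sum_mono)
          also have "\<dots> = C0 ^ m * (\<Sum>r\<in>Z. chain_prod (bN N) n (ly.wt (r ` {1..m})) (xN N))"
            by (rule sum_distrib_left[symmetric])
          also have "\<dots> \<le> C0 ^ m * ly.late_sum m n T (xN N)"
          proof (intro mult_left_mono ly.sum_increasing_times_le_late_sum)
            show "\<exists>l\<in>{1..m}. T \<le> r l" if "r \<in> Z" for r
            proof -
              have "\<not> (\<forall>l\<in>{1..m}. r l < T)" using that Z(2) by blast
              then show ?thesis by (meson not_le)
            qed
            show "r l < n" if "r \<in> Z" "l \<in> {1..m}" for r l by (rule n[OF that])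
          qed (use Z xN C00 in auto)
          also have "\<dots> \<le> C0 ^ m * (\<eta> / C0 ^ m)"
            using C00 by (intro mult_left_mono T[OF elim xs]) auto
          also have "\<dots> = \<eta>" using C00 by simp
          finally show "(\<Sum>r\<in>Z. \<bar>aN N r\<bar>) \<le> \<eta>" .
        qed
      qed
    qed auto
  qed
  have Dsub: "D N \<subseteq> increasing_times m" for N by (auto simp: D_def)
  \<comment> \<open>This is why t is absent from the limit: every fixed sequence eventually fits
    below \<open>N * t\<close>.\<close>
  have Dev: "\<forall>\<^sub>F N in sequentially. r \<in> D N" if r: "r \<in> increasing_times m" for r
  proof -
    have "\<forall>\<^sub>F N in sequentially. real k \<le> real N * t" for k
    proof (rule eventually_sequentiallyI)
      fix N assume "nat \<lceil>real k / t\<rceil> \<le> N"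
      then have "real k / t \<le> real N" by linarith
      then show "real k \<le> real N * t" using t by (simp add: pos_divide_le_eq)
    qed
    then have "\<forall>\<^sub>F N in sequentially. \<forall>l\<in>{1..m}. real (r l) \<le> real N * t" by (intro eventually_ball_finite) auto
    then show ?thesis by eventually_elim (use r in \<open>auto simp: D_def\<close>)
  qed
  from infsum_tendsto_of_uniform_tails[where aN=aN and D=D, OF lim_a Dfin Dsub Dev tails]
  show "(\<lambda>r. (\<Prod>l\<in>{1..m}. \<phi> l x1) * dif_correlation I (dif_kernel I b) y m f r) summable_on (increasing_times m)"
    "(\<lambda>N. prelimit_functional I (bN N) (xN N) (sN N) N t m (fN N) \<phi>)
      \<longlonglongrightarrow> (\<Sum>\<^sub>\<infinity>r\<in>increasing_times m. (\<Prod>l\<in>{1..m}. \<phi> l x1) * dif_correlation I (dif_kernel I b) y m f r)"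
    unfolding pre \<Phi>_def by blast+
qed

section \<open>Common constants for the weights and test functions, and the final assembly\<close>

lemma equicontinuous_on_imp_continuous_on:
  assumes "equicontinuous_on S g"
  shows "continuous_on S (g N)"
  using assms unfolding equicontinuous_on_def continuous_on_iff dist_real_def by blast

text \<open>Equicontinuity upgrades pointwise convergence at z to convergence along points tending
  to z, which the moving starting points require.\<close>

lemma equicontinuous_on_tendsto:
  assumes eq: "equicontinuous_on S g" and lim: "(\<lambda>N. g N z) \<longlonglongrightarrow> h z"
    and z: "z \<in> S" "\<And>N. zN N \<in> S" "zN \<longlonglongrightarrow> z"
  shows "(\<lambda>N. g N (zN N)) \<longlonglongrightarrow> h z"
proof -
  have "(\<lambda>N. g N (zN N) - g N z) \<longlonglongrightarrow> 0"
  proof (rule tendstoI)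
    fix e :: real assume "e > 0"
    then obtain d where d: "d > 0" "\<And>N x'. x' \<in> S \<Longrightarrow> dist x' z < d \<Longrightarrow> \<bar>g N x' - g N z\<bar> < e"
      using eq z(1) unfolding equicontinuous_on_def by blast
    have "\<forall>\<^sub>F N in sequentially. dist (zN N) z < d" by (rule tendstoD[OF z(3) d(1)])
    then show "\<forall>\<^sub>F N in sequentially. dist (g N (zN N) - g N z) 0 < e"
      by eventually_elim (use d(2) z(2) in simp)
  qed
  from tendsto_add[OF this lim] show ?thesis by simp
qed

lemma common_exp_decay:
  fixes g :: "nat \<Rightarrow> 'l \<Rightarrow> 'a::real_normed_vector \<Rightarrow> real"
  assumes "finite L" "\<forall>l\<in>L. \<exists>A>0. \<exists>c>0. \<forall>N. \<forall>x\<in>I. \<bar>g N l x\<bar> \<le> A * exp (- c * norm x)"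
  shows "\<exists>A>0. \<exists>c>0. \<forall>l\<in>L. \<forall>N. \<forall>x\<in>I. \<bar>g N l x\<bar> \<le> A * exp (- c * norm x)"
  using assms
proof (induction L rule: finite_induct)
  case (insert l L)
  then obtain A c where 1: "A > 0" "c > 0" "\<And>l N x. l \<in> L \<Longrightarrow> x \<in> I \<Longrightarrow> \<bar>g N l x\<bar> \<le> A * exp (- c * norm x)"
    by auto
  obtain A' c' where 2: "A' > 0" "c' > 0" "\<And>N x. x \<in> I \<Longrightarrow> \<bar>g N l x\<bar> \<le> A' * exp (- c' * norm x)"
    using insert.prems by auto
  have mono: "p * exp (- q * norm x) \<le> max A A' * exp (- min c c' * norm x)"
    if "p \<le> max A A'" "min c c' \<le> q" "0 \<le> p" for p q and x :: 'a
    using that 1 by (intro mult_mono) (auto intro: mult_right_mono)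
  show ?case
  proof (rule exI[of _ "max A A'"], rule conjI[rotated], rule exI[of _ "min c c'"], intro conjI ballI allI)
    fix k N x assume "k \<in> insert l L" "x \<in> I"
    then show "\<bar>g N k x\<bar> \<le> max A A' * exp (- min c c' * norm x)"
      using order_trans[OF 1(3) mono[of A c]] order_trans[OF 2(3) mono[of A' c']] 1 2 by auto
  qed (use 1 2 in auto)
qed (auto intro: exI[of _ 1])

lemma common_bound:
  fixes g :: "'l \<Rightarrow> 'a \<Rightarrow> real"
  assumes "finite L" "\<forall>l\<in>L. bounded (range (g l))"
  shows "\<exists>C\<ge>1. \<forall>l\<in>L. \<forall>x. \<bar>g l x\<bar> \<le> C"
proof -
  have "bounded (\<Union>l\<in>L. range (g l))" using assms by (intro bounded_UN) auto
  then obtain C where C: "\<And>l x. l \<in> L \<Longrightarrow> \<bar>g l x\<bar> \<le> C" unfolding bounded_iff by auto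
  then have "\<forall>l\<in>L. \<forall>x. \<bar>g l x\<bar> \<le> max C 1" by (meson le_max_iff_disj)
  then show ?thesis by (intro exI[of _ "max C 1"]) auto
qed

lemma admissible_test_funD:
  assumes "admissible_test_fun \<phi>"
  shows "\<phi> \<in> borel_measurable borel" "bounded (range \<phi>)" "isCont \<phi> x"
proof -
  have "\<phi> differentiable (at x)" for x
    using assms unfolding admissible_test_fun_def smooth_def by (metis foldr_Nil id_apply)
  then have c: "isCont \<phi> x" for x by (rule differentiable_imp_continuous_within)
  then show "isCont \<phi> x" .
  show "\<phi> \<in> borel_measurable borel"
    by (rule borel_measurable_continuous_onI) (simp add: continuous_at_imp_continuous_on c)
  show "bounded (range \<phi>)" using assms by (simp add: admissible_test_fun_def)
qed

theorem theorem4p25: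
  fixes I :: "(real^'n) set" and \<sigma> M :: real and F :: "real \<Rightarrow> real"
    and b0 :: "(real^'n) \<times> (real^'n) \<Rightarrow> ((real^'n) \<times> (real^'n)) measure" and \<nu>0 :: "(real^'n) measure"
  assumes "CARD('n) \<ge> 3"
    and "locally compact I" and "0 \<in> I" and "\<forall>x\<in>I. \<forall>y\<in>I. x + y \<in> I" and "\<forall>x\<in>I. - x \<in> I"
    and "\<sigma> > 0" and "M > 0"
    and "antimono_on {0..} F" and "exp_decay_on {0..} F"
    and "b0 \<in> sri_class I \<sigma> M F" and "sri_chain I \<nu>0 F b0" and "centered I \<nu>0 b0"
    and "\<exists>\<delta>>0. repulsive I \<delta> b0"
  shows "\<exists>\<epsilon>>0. \<forall>(bN :: nat \<Rightarrow> (real^'n) \<times> (real^'n) \<Rightarrow> ((real^'n) \<times> (real^'n)) measure)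
      (\<nu>N :: nat \<Rightarrow> (real^'n) measure)
      (b :: (real^'n) \<times> (real^'n) \<Rightarrow> ((real^'n) \<times> (real^'n)) measure) (\<nu> :: (real^'n) measure) (G :: real \<Rightarrow> real)
      (xN :: nat \<Rightarrow> (real^'n) \<times> (real^'n)) (x1 :: real^'n) (y :: real^'n)
      (m :: nat) (\<phi> :: nat \<Rightarrow> real^'n \<Rightarrow> real) (f :: nat \<Rightarrow> real^'n \<Rightarrow> real).
      (\<forall>N. bN N \<in> sri_class I \<sigma> M F \<and> sri_chain I (\<nu>N N) F (bN N) \<and> diag_trans_inv I (bN N)) \<and>
      antimono_on {0..} G \<and> (G \<longlongrightarrow> 0) at_top \<and> sri_chain I \<nu> G b \<and>
      (\<lambda>N. d_sri I (bN N) b) \<longlonglongrightarrow> 0 \<and>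
      (\<exists>\<delta>'>0. repulsive I \<delta>' b) \<and>
      d_sri I b b0 < \<epsilon> \<and>
      covariance_matrix \<nu> = mat 1 \<and>
      condition_F I (dif_kernel I b) \<and>
      (\<forall>N. xN N \<in> I \<times> I) \<and>
      (\<lambda>N. (1 / sqrt (real N)) *\<^sub>R fst (xN N)) \<longlonglongrightarrow> x1 \<and>
      y \<in> I \<and> (\<lambda>N. fst (xN N) - snd (xN N)) \<longlonglongrightarrow> y \<and>
      (\<forall>l\<in>{1..m}. admissible_test_fun (\<phi> l)) \<and>
      (\<forall>l\<in>{1..m}. continuous_on I (f l) \<and> exp_decay_on I (f l))
      \<longrightarrow>
      (dif_correlation I (dif_kernel I b) y m f) summable_on (increasing_times m) \<and>
      (\<forall>t>0. (\<lambda>N. prelimit_functional I (bN N) (xN N) (\<integral>u. u \<partial>\<nu>N N) N t m f \<phi>)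
          \<longlonglongrightarrow> (\<Prod>l\<in>{1..m}. \<phi> l x1) *
            (\<Sum>\<^sub>\<infinity>r\<in>increasing_times m. dif_correlation I (dif_kernel I b) y m f r)) \<and>
      (\<forall>fN :: nat \<Rightarrow> nat \<Rightarrow> real^'n \<Rightarrow> real.
          (\<forall>l\<in>{1..m}.
             equicontinuous_on I (\<lambda>N. fN N l) \<and>
             (\<forall>K\<subseteq>I. compact K \<longrightarrow> uniform_limit K (\<lambda>N. fN N l) (f l) sequentially) \<and>
             (\<exists>A>0. \<exists>c>0. \<forall>N. \<forall>x\<in>I. \<bar>fN N l x\<bar> \<le> A * exp (- c * norm x)))
          \<longrightarrow>
          (\<forall>t>0. (\<lambda>N. prelimit_functional I (bN N) (xN N) (\<integral>u. u \<partial>\<nu>N N) N t m (fN N) \<phi>)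
              \<longlonglongrightarrow> (\<Prod>l\<in>{1..m}. \<phi> l x1) *
                (\<Sum>\<^sub>\<infinity>r\<in>increasing_times m. dif_correlation I (dif_kernel I b) y m f r)))"
proof -
  note card = assms(1) and I = assms(3,4,5) and \<sigma> = assms(6) and M = assms(7) and F = assms(9) and b0 = assms(10,12)
  obtain \<delta> where \<delta>: "\<delta> > 0" "repulsive I \<delta> b0" using assms(13) by blast
  obtain \<epsilon> where \<epsilon>: "\<epsilon> > 0" and drift: "\<And>bN \<nu>N b \<nu> G.
    (\<forall>N. bN N \<in> sri_class I \<sigma> M F \<and> sri_chain I (\<nu>N N) F (bN N)) \<and>
    (G \<longlongrightarrow> 0) at_top \<and> sri_chain I \<nu> G b \<and> (\<lambda>N. d_sri I (bN N) b) \<longlonglongrightarrow> 0 \<and>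
    d_sri I b b0 < \<epsilon> \<and> covariance_matrix \<nu> = mat 1 \<Longrightarrow>
    (\<exists>K\<ge>1. \<exists>c>0. c \<le> 1 \<and> (\<forall>\<^sub>F N in sequentially.
      lyapunov_chain (borel_on (I \<times> I)) (bN N) (\<lambda>x. pot K (fst x - snd x)) c))"
    using sri_uniform_drift[OF card I(1,2) \<sigma> M F b0 \<delta>(2,1)] by meson
  show ?thesis
  proof (rule exI[of _ \<epsilon>], rule conjI[OF \<epsilon>], intro allI, rule impI)
    fix bN :: "nat \<Rightarrow> (real^'n) \<times> (real^'n) \<Rightarrow> ((real^'n) \<times> (real^'n)) measure"
      and \<nu>N :: "nat \<Rightarrow> (real^'n) measure"
      and b :: "(real^'n) \<times> (real^'n) \<Rightarrow> ((real^'n) \<times> (real^'n)) measure" and \<nu> :: "(real^'n) measure" and G :: "real \<Rightarrow> real"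
      and xN :: "nat \<Rightarrow> (real^'n) \<times> (real^'n)" and x1 :: "real^'n" and y :: "real^'n"
      and m :: nat and \<phi> :: "nat \<Rightarrow> real^'n \<Rightarrow> real" and f :: "nat \<Rightarrow> real^'n \<Rightarrow> real"
    assume "(\<forall>N. bN N \<in> sri_class I \<sigma> M F \<and> sri_chain I (\<nu>N N) F (bN N) \<and> diag_trans_inv I (bN N)) \<and>
      antimono_on {0..} G \<and> (G \<longlongrightarrow> 0) at_top \<and> sri_chain I \<nu> G b \<and>
      (\<lambda>N. d_sri I (bN N) b) \<longlonglongrightarrow> 0 \<and>
      (\<exists>\<delta>'>0. repulsive I \<delta>' b) \<and>
      d_sri I b b0 < \<epsilon> \<and>
      covariance_matrix \<nu> = mat 1 \<and>
      condition_F I (dif_kernel I b) \<and>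
      (\<forall>N. xN N \<in> I \<times> I) \<and>
      (\<lambda>N. (1 / sqrt (real N)) *\<^sub>R fst (xN N)) \<longlonglongrightarrow> x1 \<and>
      y \<in> I \<and> (\<lambda>N. fst (xN N) - snd (xN N)) \<longlonglongrightarrow> y \<and>
      (\<forall>l\<in>{1..m}. admissible_test_fun (\<phi> l)) \<and>
      (\<forall>l\<in>{1..m}. continuous_on I (f l) \<and> exp_decay_on I (f l))"
    then have bN: "\<And>N. bN N \<in> sri_class I \<sigma> M F" "\<And>N. sri_chain I (\<nu>N N) F (bN N)" "\<And>N. diag_trans_inv I (bN N)"
      and G: "(G \<longlongrightarrow> 0) at_top" and b: "sri_chain I \<nu> G b" and lim: "(\<lambda>N. d_sri I (bN N) b) \<longlonglongrightarrow> 0"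
      and d: "d_sri I b b0 < \<epsilon>" and cov: "covariance_matrix \<nu> = mat 1" and cF: "condition_F I (dif_kernel I b)"
      and xN: "\<And>N. xN N \<in> I \<times> I" and x1: "(\<lambda>N. (1 / sqrt (real N)) *\<^sub>R fst (xN N)) \<longlonglongrightarrow> x1"
      and y: "y \<in> I" "(\<lambda>N. fst (xN N) - snd (xN N)) \<longlonglongrightarrow> y"
      and \<phi>: "\<And>l. l \<in> {1..m} \<Longrightarrow> admissible_test_fun (\<phi> l)"
      and f: "\<And>l. l \<in> {1..m} \<Longrightarrow> continuous_on I (f l)" "\<And>l. l \<in> {1..m} \<Longrightarrow> exp_decay_on I (f l)"
      by auto
    have bk: "markov_kernel (borel_on (I \<times> I)) b" and \<nu>: "\<nu> \<in> space (prob_algebra (borel_on I))"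
      using b by (auto simp: sri_chain_def)
    have cont: "\<forall>x\<in>I. ((\<lambda>x'. tv_dist (dif_kernel I b x') (dif_kernel I b x)) \<longlongrightarrow> 0) (at x within I)"
      using cF by (simp add: condition_F_def)
    obtain K c where lyap: "K \<ge> 1" "0 < c" "c \<le> 1"
      "\<forall>\<^sub>F N in sequentially. lyapunov_chain (borel_on (I \<times> I)) (bN N) (\<lambda>x. pot K (fst x - snd x)) c"
      using drift[of bN \<nu>N G \<nu> b] bN G b lim d cov by blast
    have sN: "norm (\<integral>u. u \<partial>\<nu>N N) \<le> 1 + moment_bound \<sigma> M" for N
      by (rule base_mean_bounded[OF I(1,2) \<sigma> M F subgroup_unbounded[OF I(1,2) \<nu> cov] bN(1,2)])
    let ?d = "dif_correlation I (dif_kernel I b) y m f"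
    let ?adm = "\<lambda>fN. \<forall>l\<in>{1..m}. equicontinuous_on I (\<lambda>N. fN N l) \<and>
       (\<forall>K\<subseteq>I. compact K \<longrightarrow> uniform_limit K (\<lambda>N. fN N l) (f l) sequentially) \<and>
       (\<exists>A>0. \<exists>c>0. \<forall>N. \<forall>x\<in>I. \<bar>fN N l x\<bar> \<le> A * exp (- c * norm x))"
    have main: "(\<lambda>r. (\<Prod>l\<in>{1..m}. \<psi> l x1) * ?d r) summable_on (increasing_times m) \<and>
      (\<lambda>N. prelimit_functional I (bN N) (xN N) (\<integral>u. u \<partial>\<nu>N N) N t m (fN N) \<psi>)
        \<longlonglongrightarrow> (\<Prod>l\<in>{1..m}. \<psi> l x1) * (\<Sum>\<^sub>\<infinity>r\<in>increasing_times m. ?d r)"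
      if t: "t > 0" and fN: "?adm fN" and \<psi>: "\<And>l. l \<in> {1..m} \<Longrightarrow> admissible_test_fun (\<psi> l)"
      for t and fN :: "nat \<Rightarrow> nat \<Rightarrow> real^'n \<Rightarrow> real" and \<psi> :: "nat \<Rightarrow> real^'n \<Rightarrow> real"
    proof -
      obtain A a where Aa: "A > 0" "a > 0" "\<And>l N x. l \<in> {1..m} \<Longrightarrow> x \<in> I \<Longrightarrow> \<bar>fN N l x\<bar> \<le> A * exp (- a * norm x)"
        using common_exp_decay[of "{1..m}" I fN] fN by auto
      obtain C where C: "C \<ge> 1" "\<And>l w. l \<in> {1..m} \<Longrightarrow> \<bar>\<psi> l w\<bar> \<le> C"
        using common_bound[of "{1..m}" \<psi>] admissible_test_funD(2)[OF \<psi>] by auto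
      have fm: "fN N l \<in> borel_measurable (borel_on I)" if "l \<in> {1..m}" for N l
        by (rule borel_measurable_continuous_on_restrict, rule equicontinuous_on_imp_continuous_on[where g="\<lambda>N. fN N l"])
          (use fN that in blast)
      have flim: "(\<lambda>N. fN N l (zN N)) \<longlonglongrightarrow> f l z"
        if l: "l \<in> {1..m}" and z: "\<And>N. zN N \<in> I" "z \<in> I" "zN \<longlonglongrightarrow> z" for l zN z
      proof (rule equicontinuous_on_tendsto[where g="\<lambda>N. fN N l" and h="f l", OF _ _ z(2,1,3)])
        \<comment> \<open>Uniform convergence on the compact set {z} is pointwise convergence;
          equicontinuity extends it to moving points.\<close>
        have "{z} \<subseteq> I" "compact {z}" using z(2) by auto
        then have "uniform_limit {z} (\<lambda>N. fN N l) (f l) sequentially" using fN l by blast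
        then show "(\<lambda>N. fN N l z) \<longlonglongrightarrow> f l z" by (rule tendsto_uniform_limitI) simp
      qed (use fN l in blast)
      note lim_thm = multi_time_limit[where I=I and \<sigma>=\<sigma> and M=M and bN=bN and F=F and b=b and K=K and c=c and xN=xN
          and ?x1.0=x1 and y=y and sN="\<lambda>N. \<integral>u. u \<partial>\<nu>N N" and ?C1.0="1 + moment_bound \<sigma> M" and m=m and \<phi>=\<psi> and C\<phi>=C
          and fN=fN and A=A and a=a and f=f and t=t, OF I \<sigma> M bN(1,3) bk lim cont lyap xN x1 y sN
          admissible_test_funD(1)[OF \<psi>] C(2) admissible_test_funD(3)[OF \<psi>] C(1) fm Aa(3,1,2) flim t]
      have "(\<Sum>\<^sub>\<infinity>r\<in>increasing_times m. (\<Prod>l\<in>{1..m}. \<psi> l x1) * ?d r)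
          = (\<Prod>l\<in>{1..m}. \<psi> l x1) * (\<Sum>\<^sub>\<infinity>r\<in>increasing_times m. ?d r)"
        by (rule infsum_cmult_right')
      with lim_thm show ?thesis by (simp only: simp_thms)
    qed
    \<comment> \<open>The claim for fixed f^l is the case of a constant sequence.\<close>
    have f_adm: "?adm (\<lambda>_. f)"
    proof (intro ballI conjI allI impI)
      fix l assume l: "l \<in> {1..m}"
      show "equicontinuous_on I (\<lambda>N. f l)"
        using f(1)[OF l] unfolding equicontinuous_on_def continuous_on_iff dist_real_def by blast
      show "\<exists>A>0. \<exists>c>0. \<forall>N::nat. \<forall>x\<in>I. \<bar>f l x\<bar> \<le> A * exp (- c * norm x)"
        using f(2)[OF l] by (simp add: exp_decay_on_def)
    qed (rule uniform_limit_const)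
    \<comment> \<open>For the given \<phi> the factor at x1 may vanish, and then summability of the
      products says nothing about the correlations. Constant test functions 1 give their summability
      directly.\<close>
    have one: "admissible_test_fun (\<lambda>_::real^'n. 1)"
    proof -
      have c: "\<exists>c. foldr partial_deriv is (\<lambda>_::real^'n. 1) = (\<lambda>_. c)" for "is"
      proof (induction "is")
        case (Cons i "is")
        then obtain c where "foldr partial_deriv is (\<lambda>_::real^'n. 1) = (\<lambda>_. c)" by blast
        then show ?case by (auto simp: partial_deriv_def[abs_def] frechet_derivative_const)
      qed auto
      have b: "bounded (range (foldr partial_deriv is (\<lambda>_::real^'n. 1)))" for "is" using c[of "is"] by auto
      have "smooth (\<lambda>_::real^'n. 1)"
        unfolding smooth_def
      proof (intro allI)
        fix "is" and x :: "real^'n"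
        show "foldr partial_deriv is (\<lambda>_. 1) differentiable at x" using c[of "is"] by auto
      qed
      then show ?thesis
        unfolding admissible_test_fun_def using b[of "[]"] b[of "[i]" for i] b[of "[i, j]" for i j] by simp
    qed
    show "?d summable_on (increasing_times m) \<and>
      (\<forall>t>0. (\<lambda>N. prelimit_functional I (bN N) (xN N) (\<integral>u. u \<partial>\<nu>N N) N t m f \<phi>)
          \<longlonglongrightarrow> (\<Prod>l\<in>{1..m}. \<phi> l x1) * (\<Sum>\<^sub>\<infinity>r\<in>increasing_times m. ?d r)) \<and>
      (\<forall>fN. ?adm fN \<longrightarrow>
          (\<forall>t>0. (\<lambda>N. prelimit_functional I (bN N) (xN N) (\<integral>u. u \<partial>\<nu>N N) N t m (fN N) \<phi>)
              \<longlonglongrightarrow> (\<Prod>l\<in>{1..m}. \<phi> l x1) * (\<Sum>\<^sub>\<infinity>r\<in>increasing_times m. ?d r)))"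
    proof (intro conjI allI impI)
      show "?d summable_on (increasing_times m)"
        using main[OF zero_less_one f_adm, of "\<lambda>_ _. 1"] one by simp
      show "(\<lambda>N. prelimit_functional I (bN N) (xN N) (\<integral>u. u \<partial>\<nu>N N) N t m f \<phi>)
          \<longlonglongrightarrow> (\<Prod>l\<in>{1..m}. \<phi> l x1) * (\<Sum>\<^sub>\<infinity>r\<in>increasing_times m. ?d r)" if "t > 0" for t
        by (rule conjunct2[OF main[OF that f_adm \<phi>]])
      show "(\<lambda>N. prelimit_functional I (bN N) (xN N) (\<integral>u. u \<partial>\<nu>N N) N t m (fN N) \<phi>)
          \<longlonglongrightarrow> (\<Prod>l\<in>{1..m}. \<phi> l x1) * (\<Sum>\<^sub>\<infinity>r\<in>increasing_times m. ?d r)" if "?adm fN" "t > 0" for fN t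
        by (rule conjunct2[OF main[OF that(2,1) \<phi>]])
    qed
  qed
qed

end
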